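(* Let $0<q<1$, $t\in\mathbb{R}$, and let $a\in\mathbb{R}$ be such that $t=q^a-q^{-a}$. Let $A=\mathcal{O}_q(SU(2))$. There exists a $\delta_A^{-1/2}$-invariant integral $\psi_t:\mathcal{U}_q(\mathfrak{k}_t)\to\mathbb{C}$, concretely determined by $$\psi_t(e_{[a+n]})=\frac{q^{a+n}+q^{-a-n}}{q^a+q^{-a}},\qquad\forall n\in\mathbb{Z}.$$
   Context: $A=\mathcal{O}_q(SU(2))$ is the universal unital algebra generated by $\alpha,\beta,\gamma,\delta$ with $\alpha\beta=q\beta\alpha$, $\alpha\gamma=q\gamma\alpha$, $\beta\gamma=\gamma\beta$, $\beta\delta=q\delta\beta$, $\gamma\delta=q\delta\gamma$, $\alpha\delta-q\beta\gamma=1$, $\delta\alpha-q^{-1}\gamma\beta=1$. It is a CQG Hopf $*$-algebra (a Hopf $*$-algebra with an invariant state $\Phi_A$) with $\alpha^*=\delta$, $\beta^*=-q\gamma$, $\gamma^*=-q^{-1}\beta$, $\delta^*=\alpha$, and coproduct making $\begin{pmatrix}\alpha&\beta\\\gamma&\delta\end{pmatrix}$ a matrix corepresentation. $U=U_q(\mathfrak{su}(2))$ is the Hopf $*$-algebra generated by $e,f,k^{\pm1}$ with $ke=q^2ek$, $kf=q^{-2}fk$, $ef-fe=\frac{k-k^{-1}}{q-q^{-1}}$, $e^*=fk$, $f^*=k^{-1}e$, $k^*=k$, $\Delta(e)=e\otimes1+k\otimes e$, $\Delta(f)=f\otimes k^{-1}+1\otimes f$, $\Delta(k)=k\otimes k$.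 For each integer $n\ge0$ it has the representation $\pi_{n/2}$ on the Hilbert space $V_{n/2}$ with orthonormal basis $\xi_0,\dots,\xi_n$: $\pi_{n/2}(k)\xi_p=q^{n-2p}\xi_p$, $(q^{-1}-q)\pi_{n/2}(e)\xi_p=\sqrt{(q^{-n+p-1}-q^{n-p+1})(q^{-p}-q^p)}\,q^{\frac n2-p+1}\xi_{p-1}$, $(q^{-1}-q)\pi_{n/2}(f)\xi_p=\sqrt{(q^{-n+p}-q^{n-p})(q^{-p-1}-q^{p+1})}\,q^{-\frac n2+p}\xi_{p+1}$. There is a non-degenerate unitary Hopf $*$-algebra pairing $\tau:A\otimes U\to\mathbb{C}$ for which $\alpha,\beta,\gamma,\delta$ are the matrix coefficients of $V_{1/2}$: applying $\tau(-,x)$ entrywise to $\begin{pmatrix}\alpha&\beta\\\gamma&\delta\end{pmatrix}$ gives the matrix of $\pi_{1/2}(x)$ in the basis $\xi_0,\xi_1$. Hence $U\subseteq\mathscr{U}:=\mathrm{Lin}(A,\mathbb{C})\cong\prod_{n\ge0}\mathrm{End}(V_{n/2})$, a unital $*$-algebra with convolution product, and $\tau(a,\omega)=\omega(a)$ for $\omega\in\mathscr{U}$. In this case $\delta_A^{1/2}=k$, where $\delta_A$ is the character $\varepsilon\circ\sigma_A^{-1}$ of $A$, with $\varepsilon$ the counit and $\sigma_A$ the modular automorphism ($\Phi_A(ab)=\Phi_A(b\sigma_A(a))$); so $\delta_A^{-1/2}=k^{-1}$. Put $[x]=\frac{q^x-q^{-x}}{q-q^{-1}}$ and $B_t=q^{-1/2}(e-fk)-i(q-q^{-1})^{-1}tk$.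 Then $B_t^*=-B_t$, and $B_t$ generates a left coideal $*$-subalgebra $I=U_q(\mathfrak{k}_t)\subseteq U$. Put $B=\mathcal{O}_q(S_t^2)=\{b\in A\mid\tau(b_{(1)},h)b_{(2)}=\varepsilon(h)b\ \forall h\in I\}$ (a Podleś sphere), a unital right coideal $*$-subalgebra of $A$. The spectrum of $\pi_{n/2}(iB_t)$ is $\{[a+n-2p]\mid p=0,\dots,n\}$. Let $B_+=B\cap\ker\varepsilon$, $C=A/AB_+$, and $\mathscr{I}=\mathrm{Lin}(C,\mathbb{C})\subseteq\mathscr{U}$ (functionals vanishing on $AB_+$), which is the closure of $I$ for pointwise convergence, a product of finite-dimensional matrix algebras; $\mathcal{I}=\mathcal{U}_q(\mathfrak{k}_t)\subseteq\mathscr{I}$ is the corresponding direct sum. It is the $*$-algebra of finitely supported functions on $\{[a+n]\mid n\in\mathbb{Z}\}$, with $e_{[a+n]}$ the Dirac function at $[a+n]$; as an element of $\mathscr{U}$, $e_{[a+n]}$ acts in every $V_{m/2}$ as the orthogonal projection onto the $[a+n]$-eigenspace of $\pi_{m/2}(iB_t)$. $\mathcal{I}$ is a right $A$-module by $\tau(c,x\lhd a')=\tau(a'c,x)$, $a'\in A$, $c\in C$. Let $\Phi_C\in\mathcal{I}$ be the self-adjoint support projection of the representation $\varepsilon_{|\mathscr{I}}$, i.e. $\Phi_C = e_{[a]}$. For $g\in\mathscr{U}$, a $g$-invariant integral on $\mathcal{I}$ is a functional $\psi:\mathcal{I}\to\mathbb{C}$ with $\psi(x\lhd a')=\tau(a',g)\psi(x)$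 for all $x\in\mathcal{I},a'\in A$, $\psi(\Phi_C)=1$, and $\psi(x^*x)\ge0$ for all $x\in\mathcal{I}$. *)

theory Defs
  imports
    Complex_Main
    "HOL-Library.Poly_Mapping"
    "HOL-Library.Product_Plus"
    "HOL-Library.Complex_Order"
    "Jordan_Normal_Form.Schur_Decomposition"
begin

section \<open>Free algebras, tensor squares, presentations\<close>

text \<open>
  The free unital complex algebra on \<open>'g\<close> is the monoid algebra of the monoid of words; the
  product of \<open>\<Rightarrow>\<^sub>0\<close> is the convolution product.  The monoid algebra of pairs of words is the
  tensor square of the free algebra.
\<close>

datatype 'g word = Word (letters: "'g list")

instantiation word :: (type) monoid_add
begin
definition "0 = Word []"
definition "v + w = Word (letters v @ letters w)"
instance by standard (simp_all add: zero_word_def plus_word_def)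
end

type_synonym 'g falg = "'g word \<Rightarrow>\<^sub>0 complex"
type_synonym 'g falg2 = "('g word \<times> 'g word) \<Rightarrow>\<^sub>0 complex"

definition sc :: "complex \<Rightarrow> 'm::monoid_add \<Rightarrow>\<^sub>0 complex" where
  "sc c = Poly_Mapping.single 0 c"

definition mon :: "'g word \<Rightarrow> 'g falg" where
  "mon w = Poly_Mapping.single w 1"

definition gen :: "'g \<Rightarrow> 'g falg" where
  "gen g = mon (Word [g])"

definition tens :: "'g falg \<Rightarrow> 'g falg \<Rightarrow> 'g falg2" where
  "tens x y = (\<Sum>v\<in>Poly_Mapping.keys x. \<Sum>w\<in>Poly_Mapping.keys y.
     Poly_Mapping.single (v, w) (Poly_Mapping.lookup x v * Poly_Mapping.lookup y w))"

text \<open>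
  \<open>free_hom \<iota> \<phi>\<close> is the multiplicative, \<open>free_antihom \<iota> \<phi>\<close> the antimultiplicative extension of a
  map \<open>\<phi>\<close> on generators, where scalars act on the target through \<open>\<iota>\<close> (so \<open>\<iota> = sc \<circ> cnj\<close> gives an
  antilinear map).
\<close>

definition free_hom :: "(complex \<Rightarrow> 'r::ring_1) \<Rightarrow> ('g \<Rightarrow> 'r) \<Rightarrow> 'g falg \<Rightarrow> 'r" where
  "free_hom \<iota> \<phi> x = (\<Sum>w\<in>Poly_Mapping.keys x.
     \<iota> (Poly_Mapping.lookup x w) * prod_list (map \<phi> (letters w)))"

definition free_antihom :: "(complex \<Rightarrow> 'r::ring_1) \<Rightarrow> ('g \<Rightarrow> 'r) \<Rightarrow> 'g falg \<Rightarrow> 'r" where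
  "free_antihom \<iota> \<phi> x = (\<Sum>w\<in>Poly_Mapping.keys x.
     \<iota> (Poly_Mapping.lookup x w) * prod_list (map \<phi> (rev (letters w))))"

definition linear_functional :: "('g falg \<Rightarrow> complex) \<Rightarrow> bool" where
  "linear_functional \<omega> \<longleftrightarrow>
     (\<forall>x y. \<omega> (x + y) = \<omega> x + \<omega> y) \<and> (\<forall>c x. \<omega> (sc c * x) = c * \<omega> x)"

text \<open>Slice maps: \<open>\<omega> \<otimes> \<chi>\<close>, \<open>\<omega> \<otimes> id\<close> and \<open>id \<otimes> \<omega>\<close> for linear functionals \<open>\<omega>\<close>, \<open>\<chi>\<close>.\<close>

definition slice_both :: "('g falg \<Rightarrow> complex) \<Rightarrow> ('g falg \<Rightarrow> complex) \<Rightarrow> 'g falg2 \<Rightarrow> complex" where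
  "slice_both \<omega> \<chi> z = (\<Sum>p\<in>Poly_Mapping.keys z.
     Poly_Mapping.lookup z p * \<omega> (mon (fst p)) * \<chi> (mon (snd p)))"

definition slice_left :: "('g falg \<Rightarrow> complex) \<Rightarrow> 'g falg2 \<Rightarrow> 'g falg" where
  "slice_left \<omega> z = (\<Sum>p\<in>Poly_Mapping.keys z.
     sc (Poly_Mapping.lookup z p * \<omega> (mon (fst p))) * mon (snd p))"

definition slice_right :: "('g falg \<Rightarrow> complex) \<Rightarrow> 'g falg2 \<Rightarrow> 'g falg" where
  "slice_right \<omega> z = (\<Sum>p\<in>Poly_Mapping.keys z.
     sc (Poly_Mapping.lookup z p * \<omega> (mon (snd p))) * mon (fst p))"

inductive_set ideal_gen :: "'r::ring_1 set \<Rightarrow> 'r set" for R where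
  zero: "0 \<in> ideal_gen R"
| add: "x \<in> ideal_gen R \<Longrightarrow> r \<in> R \<Longrightarrow> x + u * r * v \<in> ideal_gen R"

inductive_set subalgebra_gen :: "'g falg set \<Rightarrow> 'g falg set" for S where
  scalar: "sc c \<in> subalgebra_gen S"
| base: "x \<in> S \<Longrightarrow> x \<in> subalgebra_gen S"
| add: "x \<in> subalgebra_gen S \<Longrightarrow> y \<in> subalgebra_gen S \<Longrightarrow> x + y \<in> subalgebra_gen S"
| mult: "x \<in> subalgebra_gen S \<Longrightarrow> y \<in> subalgebra_gen S \<Longrightarrow> x * y \<in> subalgebra_gen S"


section \<open>The Hopf $*$-algebra $A = O_q(SU(2))$\<close>

text \<open>
  The algebra \<open>A\<close> is the quotient of the free algebra by the ideal \<open>ideal_A q\<close>.  Throughout,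
  elements of \<open>A\<close> are given by representatives in the free algebra, equality in \<open>A\<close> is equality
  modulo \<open>ideal_A q\<close>, and a linear functional on \<open>A\<close> is a linear functional on the free algebra
  that vanishes on \<open>ideal_A q\<close>.  The same convention is used for \<open>U\<close> below.
\<close>

datatype genA = GAlpha | GBeta | GGamma | GDelta

abbreviation "al \<equiv> gen GAlpha"
abbreviation "be \<equiv> gen GBeta"
abbreviation "ga \<equiv> gen GGamma"
abbreviation "de \<equiv> gen GDelta"

definition rels_A :: "real \<Rightarrow> genA falg set" where
  "rels_A q = {
     al * be - sc q * be * al,
     al * ga - sc q * ga * al,
     be * ga - ga * be,
     be * de - sc q * de * be,
     ga * de - sc q * de * ga,
     al * de - sc q * be * ga - 1,
     de * al - sc (1 / q) * ga * be - 1}"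

definition ideal_A :: "real \<Rightarrow> genA falg set" where
  "ideal_A q = ideal_gen (rels_A q)"

definition eqA :: "real \<Rightarrow> genA falg \<Rightarrow> genA falg \<Rightarrow> bool" where
  "eqA q x y \<longleftrightarrow> x - y \<in> ideal_A q"

fun copA_gen :: "genA \<Rightarrow> genA falg2" where
  "copA_gen GAlpha = tens al al + tens be ga"
| "copA_gen GBeta  = tens al be + tens be de"
| "copA_gen GGamma = tens ga al + tens de ga"
| "copA_gen GDelta = tens ga be + tens de de"

fun counA_gen :: "genA \<Rightarrow> complex" where
  "counA_gen GAlpha = 1"
| "counA_gen GBeta  = 0"
| "counA_gen GGamma = 0"
| "counA_gen GDelta = 1"

fun antA_gen :: "real \<Rightarrow> genA \<Rightarrow> genA falg" where
  "antA_gen q GAlpha = de"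
| "antA_gen q GBeta  = - sc (1 / q) * be"
| "antA_gen q GGamma = - sc q * ga"
| "antA_gen q GDelta = al"

fun starA_gen :: "real \<Rightarrow> genA \<Rightarrow> genA falg" where
  "starA_gen q GAlpha = de"
| "starA_gen q GBeta  = - sc q * ga"
| "starA_gen q GGamma = - sc (1 / q) * be"
| "starA_gen q GDelta = al"

definition copA :: "genA falg \<Rightarrow> genA falg2" where "copA = free_hom sc copA_gen"
definition counA :: "genA falg \<Rightarrow> complex" where "counA = free_hom id counA_gen"
definition antA :: "real \<Rightarrow> genA falg \<Rightarrow> genA falg" where "antA q = free_antihom sc (antA_gen q)"
definition starA :: "real \<Rightarrow> genA falg \<Rightarrow> genA falg" where
  "starA q = free_antihom (sc \<circ> cnj) (starA_gen q)"

text \<open>The full dual \<open>Lin(A, \<complex>)\<close> with its convolution product (unit \<open>counA\<close>) and involution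
  \<open>\<omega>\<^sup>*(a) = cnj (\<omega> (S(a)\<^sup>*))\<close>.\<close>

definition dualA :: "real \<Rightarrow> (genA falg \<Rightarrow> complex) set" where
  "dualA q = {\<omega>. linear_functional \<omega> \<and> (\<forall>x\<in>ideal_A q. \<omega> x = 0)}"

definition conv :: "(genA falg \<Rightarrow> complex) \<Rightarrow> (genA falg \<Rightarrow> complex) \<Rightarrow> genA falg \<Rightarrow> complex" where
  "conv \<omega> \<chi> a = slice_both \<omega> \<chi> (copA a)"

definition dual_star :: "real \<Rightarrow> (genA falg \<Rightarrow> complex) \<Rightarrow> genA falg \<Rightarrow> complex" where
  "dual_star q \<omega> a = cnj (\<omega> (starA q (antA q a)))"

definition dual_positive :: "real \<Rightarrow> (genA falg \<Rightarrow> complex) \<Rightarrow> bool" where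
  "dual_positive q h \<longleftrightarrow> (\<exists>y\<in>dualA q. h = conv (dual_star q y) y)"

definition dual_sqrt :: "real \<Rightarrow> (genA falg \<Rightarrow> complex) \<Rightarrow> genA falg \<Rightarrow> complex" where
  "dual_sqrt q d = (THE h. h \<in> dualA q \<and> dual_positive q h \<and> conv h h = d)"

definition dual_inv :: "real \<Rightarrow> (genA falg \<Rightarrow> complex) \<Rightarrow> genA falg \<Rightarrow> complex" where
  "dual_inv q h = (THE g. g \<in> dualA q \<and> conv g h = counA \<and> conv h g = counA)"

definition invariant_state :: "real \<Rightarrow> (genA falg \<Rightarrow> complex) \<Rightarrow> bool" where
  "invariant_state q \<Phi> \<longleftrightarrow>
     \<Phi> \<in> dualA q \<and> \<Phi> 1 = 1 \<and> (\<forall>a. 0 \<le> \<Phi> (starA q a * a)) \<and>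
     (\<forall>a. eqA q (slice_right \<Phi> (copA a)) (sc (\<Phi> a)) \<and>
          eqA q (slice_left \<Phi> (copA a)) (sc (\<Phi> a)))"

text \<open>\<open>\<sigma>\<close> represents an algebra automorphism of \<open>A\<close> with \<open>\<Phi>(ab) = \<Phi>(b \<sigma>(a))\<close>.\<close>

definition modular_automorphism ::
  "real \<Rightarrow> (genA falg \<Rightarrow> complex) \<Rightarrow> (genA falg \<Rightarrow> genA falg) \<Rightarrow> bool" where
  "modular_automorphism q \<Phi> \<sigma> \<longleftrightarrow>
     (\<forall>x y. eqA q (\<sigma> x) (\<sigma> y) \<longleftrightarrow> eqA q x y) \<and>
     (\<forall>y. \<exists>x. eqA q (\<sigma> x) y) \<and>
     (\<forall>x y. eqA q (\<sigma> (x + y)) (\<sigma> x + \<sigma> y)) \<and>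
     (\<forall>c x. eqA q (\<sigma> (sc c * x)) (sc c * \<sigma> x)) \<and>
     (\<forall>x y. eqA q (\<sigma> (x * y)) (\<sigma> x * \<sigma> y)) \<and>
     eqA q (\<sigma> 1) 1 \<and>
     (\<forall>a b. \<Phi> (a * b) = \<Phi> (b * \<sigma> a))"

text \<open>The character \<open>\<delta>\<^sub>A = \<epsilon> \<circ> \<sigma>\<^sub>A\<^sup>-\<^sup>1\<close>, and the inverse of its positive square root in \<open>Lin(A, \<complex>)\<close>.\<close>

definition deltaA :: "real \<Rightarrow> (genA falg \<Rightarrow> genA falg) \<Rightarrow> genA falg \<Rightarrow> complex" where
  "deltaA q \<sigma> a = counA (SOME b. eqA q (\<sigma> b) a)"

definition deltaA_minus_half :: "real \<Rightarrow> (genA falg \<Rightarrow> genA falg) \<Rightarrow> genA falg \<Rightarrow> complex" where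
  "deltaA_minus_half q \<sigma> = dual_inv q (dual_sqrt q (deltaA q \<sigma>))"


section \<open>The Hopf $*$-algebra $U = U_q(su(2))$ and its representations\<close>

datatype genU = GE | GF | GK | GKinv

abbreviation "Ee \<equiv> gen GE"
abbreviation "Ff \<equiv> gen GF"
abbreviation "Kk \<equiv> gen GK"
abbreviation "Ki \<equiv> gen GKinv"

definition rels_U :: "real \<Rightarrow> genU falg set" where
  "rels_U q = {
     Kk * Ki - 1,
     Ki * Kk - 1,
     Kk * Ee - sc (q ^ 2) * Ee * Kk,
     Kk * Ff - sc (1 / q ^ 2) * Ff * Kk,
     Ee * Ff - Ff * Ee - sc (1 / (q - 1 / q)) * (Kk - Ki)}"

definition ideal_U :: "real \<Rightarrow> genU falg set" where
  "ideal_U q = ideal_gen (rels_U q)"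

fun copU_gen :: "genU \<Rightarrow> genU falg2" where
  "copU_gen GE = tens Ee 1 + tens Kk Ee"
| "copU_gen GF = tens Ff Ki + tens 1 Ff"
| "copU_gen GK = tens Kk Kk"
| "copU_gen GKinv = tens Ki Ki"

fun counU_gen :: "genU \<Rightarrow> complex" where
  "counU_gen GE = 0"
| "counU_gen GF = 0"
| "counU_gen GK = 1"
| "counU_gen GKinv = 1"

fun antU_gen :: "genU \<Rightarrow> genU falg" where
  "antU_gen GE = - (Ki * Ee)"
| "antU_gen GF = - (Ff * Kk)"
| "antU_gen GK = Ki"
| "antU_gen GKinv = Kk"

fun starU_gen :: "genU \<Rightarrow> genU falg" where
  "starU_gen GE = Ff * Kk"
| "starU_gen GF = Ki * Ee"
| "starU_gen GK = Kk"
| "starU_gen GKinv = Ki"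

definition copU :: "genU falg \<Rightarrow> genU falg2" where "copU = free_hom sc copU_gen"
definition counU :: "genU falg \<Rightarrow> complex" where "counU = free_hom id counU_gen"
definition antU :: "genU falg \<Rightarrow> genU falg" where "antU = free_antihom sc antU_gen"
definition starU :: "genU falg \<Rightarrow> genU falg" where "starU = free_antihom (sc \<circ> cnj) starU_gen"

text \<open>Matrices of the generators in the orthonormal basis \<open>\<xi>\<^sub>0, \<dots>, \<xi>\<^sub>n\<close> of \<open>V\<^bsub>n/2\<^esub>\<close>: the entry at
  \<open>(r, p)\<close> is the coefficient of \<open>\<xi>\<^sub>r\<close> in the image of \<open>\<xi>\<^sub>p\<close>.\<close>

fun rep_gen_entry :: "real \<Rightarrow> nat \<Rightarrow> genU \<Rightarrow> nat \<Rightarrow> nat \<Rightarrow> real" where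
  "rep_gen_entry q n GK r p = (if r = p then q powr (real n - 2 * real p) else 0)"
| "rep_gen_entry q n GKinv r p = (if r = p then q powr (2 * real p - real n) else 0)"
| "rep_gen_entry q n GE r p = (if r + 1 = p then
     sqrt ((q powr (- real n + real p - 1) - q powr (real n - real p + 1))
           * (q powr (- real p) - q powr (real p)))
     * q powr (real n / 2 - real p + 1) / (1 / q - q) else 0)"
| "rep_gen_entry q n GF r p = (if r = p + 1 then
     sqrt ((q powr (- real n + real p) - q powr (real n - real p))
           * (q powr (- real p - 1) - q powr (real p + 1)))
     * q powr (- real n / 2 + real p) / (1 / q - q) else 0)"

definition rep_gen :: "real \<Rightarrow> nat \<Rightarrow> genU \<Rightarrow> complex mat" where
  "rep_gen q n g = mat (n + 1) (n + 1) (\<lambda>(r, p). complex_of_real (rep_gen_entry q n g r p))"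

definition rep_word :: "real \<Rightarrow> nat \<Rightarrow> genU word \<Rightarrow> complex mat" where
  "rep_word q n w = foldr (\<lambda>g M. rep_gen q n g * M) (letters w) (1\<^sub>m (n + 1))"

definition rep :: "real \<Rightarrow> nat \<Rightarrow> genU falg \<Rightarrow> complex mat" where
  "rep q n x = mat (n + 1) (n + 1) (\<lambda>(r, p).
     \<Sum>w\<in>Poly_Mapping.keys x. Poly_Mapping.lookup x w * rep_word q n w $$ (r, p))"


section \<open>The pairing\<close>

text \<open>The non-degenerate unitary Hopf $*$-algebra pairing of \<open>A\<close> and \<open>U\<close> for which the generators of
  \<open>A\<close> are the matrix coefficients of \<open>V\<^bsub>1/2\<^esub>\<close>.\<close>

definition hopf_pairing :: "real \<Rightarrow> (genA falg \<Rightarrow> genU falg \<Rightarrow> complex) \<Rightarrow> bool" where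
  "hopf_pairing q \<tau> \<longleftrightarrow>
     \<comment> \<open>bilinear on the quotients\<close>
     (\<forall>x. linear_functional (\<lambda>a. \<tau> a x)) \<and> (\<forall>a. linear_functional (\<tau> a)) \<and>
     (\<forall>a\<in>ideal_A q. \<forall>x. \<tau> a x = 0) \<and> (\<forall>x\<in>ideal_U q. \<forall>a. \<tau> a x = 0) \<and>
     \<comment> \<open>Hopf pairing\<close>
     (\<forall>a b x. \<tau> (a * b) x = slice_both (\<tau> a) (\<tau> b) (copU x)) \<and>
     (\<forall>a x y. \<tau> a (x * y) = slice_both (\<lambda>b. \<tau> b x) (\<lambda>b. \<tau> b y) (copA a)) \<and>
     (\<forall>x. \<tau> 1 x = counU x) \<and> (\<forall>a. \<tau> a 1 = counA a) \<and>
     (\<forall>a x. \<tau> (antA q a) x = \<tau> a (antU x)) \<and>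
     \<comment> \<open>unitary\<close>
     (\<forall>a x. \<tau> (starA q a) x = cnj (\<tau> a (starU (antU x)))) \<and>
     (\<forall>a x. \<tau> a (starU x) = cnj (\<tau> (starA q (antA q a)) x)) \<and>
     \<comment> \<open>non-degenerate\<close>
     (\<forall>a. (\<forall>x. \<tau> a x = 0) \<longrightarrow> a \<in> ideal_A q) \<and>
     (\<forall>x. (\<forall>a. \<tau> a x = 0) \<longrightarrow> x \<in> ideal_U q) \<and>
     \<comment> \<open>values on generators\<close>
     (\<forall>x. \<tau> al x = rep q 1 x $$ (0, 0) \<and> \<tau> be x = rep q 1 x $$ (0, 1) \<and>
          \<tau> ga x = rep q 1 x $$ (1, 0) \<and> \<tau> de x = rep q 1 x $$ (1, 1))"

text \<open>The element of \<open>A\<close> that pairs with \<open>x\<close> to the \<open>(r, p)\<close> matrix entry of \<open>\<pi>\<^bsub>n/2\<^esub>(x)\<close>; by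
  non-degeneracy it is unique modulo \<open>ideal_A q\<close>.  Evaluation on these elements is the action of
  \<open>Lin(A, \<complex>)\<close> on \<open>V\<^bsub>n/2\<^esub>\<close>.\<close>

definition matrix_coeff ::
  "real \<Rightarrow> (genA falg \<Rightarrow> genU falg \<Rightarrow> complex) \<Rightarrow> nat \<Rightarrow> nat \<Rightarrow> nat \<Rightarrow> genA falg" where
  "matrix_coeff q \<tau> n r p = (SOME u. \<forall>x. \<tau> u x = rep q n x $$ (r, p))"

definition dual_rep ::
  "real \<Rightarrow> (genA falg \<Rightarrow> genU falg \<Rightarrow> complex) \<Rightarrow> nat \<Rightarrow> (genA falg \<Rightarrow> complex) \<Rightarrow> complex mat" where
  "dual_rep q \<tau> n \<omega> = mat (n + 1) (n + 1) (\<lambda>(r, p). \<omega> (matrix_coeff q \<tau> n r p))"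


section \<open>The coideals\<close>

definition qnum :: "real \<Rightarrow> real \<Rightarrow> real" where
  "qnum q x = (q powr x - q powr (- x)) / (q - 1 / q)"

definition Bt :: "real \<Rightarrow> real \<Rightarrow> genU falg" where
  "Bt q t = sc (q powr (- 1 / 2)) * (Ee - Ff * Kk) - sc (\<i> * (1 / (q - 1 / q)) * t) * Kk"

definition coideal_I :: "real \<Rightarrow> real \<Rightarrow> genU falg set" where
  "coideal_I q t = subalgebra_gen {Bt q t}"

definition podles ::
  "real \<Rightarrow> (genA falg \<Rightarrow> genU falg \<Rightarrow> complex) \<Rightarrow> real \<Rightarrow> genA falg set" where
  "podles q \<tau> t = {b. \<forall>h\<in>coideal_I q t.
     eqA q (slice_left (\<lambda>c. \<tau> c h) (copA b)) (sc (counU h) * b)}"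

definition podles_plus ::
  "real \<Rightarrow> (genA falg \<Rightarrow> genU falg \<Rightarrow> complex) \<Rightarrow> real \<Rightarrow> genA falg set" where
  "podles_plus q \<tau> t = {b \<in> podles q \<tau> t. counA b = 0}"

definition left_ideal_AB ::
  "real \<Rightarrow> (genA falg \<Rightarrow> genU falg \<Rightarrow> complex) \<Rightarrow> real \<Rightarrow> genA falg set" where
  "left_ideal_AB q \<tau> t = {x. \<exists>(n::nat) a b.
     (\<forall>i<n. b i \<in> podles_plus q \<tau> t) \<and> x = (\<Sum>i<n. a i * b i)}"

text \<open>\<open>Lin(C, \<complex>)\<close> for \<open>C = A / A B\<^sub>+\<close>.\<close>

definition dualC ::
  "real \<Rightarrow> (genA falg \<Rightarrow> genU falg \<Rightarrow> complex) \<Rightarrow> real \<Rightarrow> (genA falg \<Rightarrow> complex) set" where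
  "dualC q \<tau> t = {\<omega> \<in> dualA q. \<forall>x\<in>left_ideal_AB q \<tau> t. \<omega> x = 0}"

definition fin_dim_ideal ::
  "(genA falg \<Rightarrow> complex) set \<Rightarrow> (genA falg \<Rightarrow> complex) set \<Rightarrow> bool" where
  "fin_dim_ideal D J \<longleftrightarrow>
     J \<subseteq> D \<and> (\<lambda>a. 0) \<in> J \<and>
     (\<forall>x\<in>J. \<forall>y\<in>J. (\<lambda>a. x a + y a) \<in> J) \<and> (\<forall>c. \<forall>x\<in>J. (\<lambda>a. c * x a) \<in> J) \<and>
     (\<forall>x\<in>J. \<forall>y\<in>D. conv x y \<in> J \<and> conv y x \<in> J) \<and>
     (\<exists>S. finite S \<and> (\<forall>x\<in>J. \<exists>c. x = (\<lambda>a. \<Sum>s\<in>S. c s * s a)))"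

text \<open>The algebra \<open>U\<^sub>q(k\<^sub>t)\<close>.  \<open>Lin(C, \<complex>)\<close> is a product of finite-dimensional matrix algebras, and in
  such a product the direct sum of the factors is the union of the finite-dimensional two-sided
  ideals.\<close>

definition Uqkt ::
  "real \<Rightarrow> (genA falg \<Rightarrow> genU falg \<Rightarrow> complex) \<Rightarrow> real \<Rightarrow> (genA falg \<Rightarrow> complex) set" where
  "Uqkt q \<tau> t = \<Union>{J. fin_dim_ideal (dualC q \<tau> t) J}"

definition orth_eigenprojection :: "nat \<Rightarrow> complex mat \<Rightarrow> complex \<Rightarrow> complex mat \<Rightarrow> bool" where
  "orth_eigenprojection d M l P \<longleftrightarrow>
     P \<in> carrier_mat d d \<and> P * P = P \<and> mat_adjoint P = P \<and>
     {v \<in> carrier_vec d. P *\<^sub>v v = v} = {v \<in> carrier_vec d. M *\<^sub>v v = l \<cdot>\<^sub>v v}"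

text \<open>The Dirac function at \<open>l\<close>.\<close>

definition dirac ::
  "real \<Rightarrow> (genA falg \<Rightarrow> genU falg \<Rightarrow> complex) \<Rightarrow> real \<Rightarrow> real \<Rightarrow> genA falg \<Rightarrow> complex" where
  "dirac q \<tau> t l = (THE \<omega>. \<omega> \<in> Uqkt q \<tau> t \<and>
     (\<forall>m. orth_eigenprojection (m + 1) (rep q m (sc \<i> * Bt q t)) (complex_of_real l)
            (dual_rep q \<tau> m \<omega>)))"

text \<open>The support projection of the one-dimensional representation of \<open>Lin(C, \<complex>)\<close> given by the
  counit, \<open>x \<mapsto> x 1\<close>.\<close>

definition PhiC ::
  "real \<Rightarrow> (genA falg \<Rightarrow> genU falg \<Rightarrow> complex) \<Rightarrow> real \<Rightarrow> genA falg \<Rightarrow> complex" where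
  "PhiC q \<tau> t = (THE p. p \<in> Uqkt q \<tau> t \<and> conv p p = p \<and> dual_star q p = p \<and> p 1 = 1 \<and>
     (\<forall>x\<in>dualC q \<tau> t. conv x p = (\<lambda>a. x 1 * p a) \<and> conv p x = (\<lambda>a. x 1 * p a)))"

text \<open>The right \<open>A\<close>-module structure \<open>\<tau>(c, x \<lhd> a) = \<tau>(a c, x)\<close>.\<close>

definition ract :: "(genA falg \<Rightarrow> complex) \<Rightarrow> genA falg \<Rightarrow> genA falg \<Rightarrow> complex" where
  "ract x a = (\<lambda>c. x (a * c))"

definition linear_on_Uqkt ::
  "real \<Rightarrow> (genA falg \<Rightarrow> genU falg \<Rightarrow> complex) \<Rightarrow> real
     \<Rightarrow> ((genA falg \<Rightarrow> complex) \<Rightarrow> complex) \<Rightarrow> bool" where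
  "linear_on_Uqkt q \<tau> t \<psi> \<longleftrightarrow>
     (\<forall>x\<in>Uqkt q \<tau> t. \<forall>y\<in>Uqkt q \<tau> t. \<psi> (\<lambda>a. x a + y a) = \<psi> x + \<psi> y) \<and>
     (\<forall>c. \<forall>x\<in>Uqkt q \<tau> t. \<psi> (\<lambda>a. c * x a) = c * \<psi> x)"

definition invariant_integral ::
  "real \<Rightarrow> (genA falg \<Rightarrow> genU falg \<Rightarrow> complex) \<Rightarrow> real \<Rightarrow> (genA falg \<Rightarrow> complex)
     \<Rightarrow> ((genA falg \<Rightarrow> complex) \<Rightarrow> complex) \<Rightarrow> bool" where
  "invariant_integral q \<tau> t g \<psi> \<longleftrightarrow>
     linear_on_Uqkt q \<tau> t \<psi> \<and>
     (\<forall>x\<in>Uqkt q \<tau> t. \<forall>a. \<psi> (ract x a) = g a * \<psi> x) \<and>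
     \<psi> (PhiC q \<tau> t) = 1 \<and>
     (\<forall>x\<in>Uqkt q \<tau> t. 0 \<le> \<psi> (conv (dual_star q x) x))"

end

theory Submission
  imports Defs "HOL-Library.Function_Algebras"
begin

text \<open>
  Everything is carried over to functions on the integers.  Up to the relations of \<open>U\<close>,
  \<open>\<Delta>(B\<^sub>t) = q\<^bsup>-1/2\<^esup> (e - f k) \<otimes> 1 + k \<otimes> B\<^sub>t\<close>.  So if \<open>v\<close> is an eigenvector of \<open>i B\<^sub>t\<close> for \<open>[a + n]\<close>,
  then \<open>i B\<^sub>t\<close> maps \<open>V\<^bsub>1/2\<^esub> \<otimes> v\<close> to itself, by a matrix of size two with the eigenvalues
  \<open>[a + n + 1]\<close> and \<open>[a + n - 1]\<close>.  The entries of its spectral projections \<open>P\<^sup>+\<close> and \<open>P\<^sup>-\<close> are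
  rational functions (\<open>prj\<close>) of \<open>\<nu> = - i q\<^bsup>a + n\<^esup>\<close>.  This suggests the right action
  \<open>(f \<lhd> u\<^sub>i\<^sub>j)(n) = P\<^sup>+(i, j) f(n + 1) + P\<^sup>-(i, j) f(n - 1)\<close> of the matrix entries \<open>u\<^sub>i\<^sub>j\<close> on functions
  \<open>f\<close> on the integers, which is \<open>acts\<close>.  It respects the relations of \<open>A\<close> (\<open>acts_relations\<close>), so
  \<open>om f x = (f \<lhd> x)(0)\<close> is a functional on \<open>A\<close>.  The map \<open>om\<close> turns the pointwise product into
  convolution, conjugation into the involution, the constant 1 into the counit, the action into
  the module structure \<open>\<lhd>\<close>, and the function \<open>n \<mapsto> [a + n]\<close> into the pairing with \<open>i B\<^sub>t\<close>
  (\<open>om_conv\<close>, \<open>om_star\<close>, \<open>om_counA\<close>, \<open>om_ract\<close>, \<open>tau_iB\<close>).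

  The functionals on \<open>C = A / A B\<^sub>+\<close> are exactly those of the form \<open>om f\<close> (\<open>dualC_eq\<close>).  An element
  of the Podles sphere is an eigenvector of convolution by \<open>i B\<^sub>t\<close>, hence is seen by \<open>om f\<close> only
  through \<open>f(0)\<close> and the counit; so \<open>om f\<close> kills \<open>A B\<^sub>+\<close>.  For the converse, \<open>C\<close> is spanned by
  the classes of ladder elements, which arise from 1 by successive left multiplications with
  \<open>\<delta> + \<mu> \<beta>\<close> for suitable \<open>\<mu>\<close>.  Quadratic elements of the sphere determine the action of the
  generators on the first of them, and the relations of \<open>A\<close> propagate the formula to all of them
  (\<open>ladder_module\<close>).  Since \<open>om f\<close> takes the value \<open>f(n)\<close> at the \<open>n\<close>-th ladder element, the
  union of the finite-dimensional ideals of \<open>Lin(C, \<complex>)\<close> corresponds to the finitely supported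
  functions (\<open>Uqkt_eq\<close>), and \<open>\<Phi>\<^sub>C\<close> to the indicator function of 0 (\<open>PhiC_eq\<close>).

  That \<open>e\<^bsub>[a + n]\<^esub>\<close> corresponds to the indicator function of \<open>n\<close> (\<open>dirac_eq\<close>) is a statement about
  all representations \<open>V\<^bsub>m/2\<^esub>\<close>.  Their matrix coefficients exist in \<open>A\<close> because \<open>V\<^bsub>(m + 1)/2\<^esub>\<close> embeds
  into \<open>V\<^bsub>1/2\<^esub> \<otimes> V\<^bsub>m/2\<^esub>\<close> (\<open>matrix_coeff_exists\<close>), and the eigenvalue \<open>[a + n]\<close> occurs in the
  representation with \<open>m = |n|\<close>, which makes the characterisation by eigenprojections unique
  (\<open>eigenvector_exists\<close>).

  On finitely supported functions the integral is \<open>f \<mapsto> \<Sum>\<^sub>n f(n) w(n)\<close> with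
  \<open>w(n) = (q\<^bsup>a + n\<^esup> + q\<^bsup>- a - n\<^esup>) / (q\<^bsup>a\<^esup> + q\<^bsup>- a\<^esup>)\<close>.  The numerator of \<open>w(n)\<close> is up to a constant the
  denominator \<open>\<nu> - 1 / \<nu>\<close> of the projections, so after shifting the summation index the
  denominators cancel and invariance on generators is a short computation (\<open>weight_act\<close>): the
  integral is multiplied by the character \<open>\<alpha> \<mapsto> 1 / q\<close>, \<open>\<beta>, \<gamma> \<mapsto> 0\<close>, \<open>\<delta> \<mapsto> q\<close>.  Positivity holds because
  \<open>w > 0\<close>, and uniqueness because the Dirac functions span.

  It remains to identify this character with \<open>\<delta>\<^sub>A\<^bsup>-1/2\<^esup>\<close> for an arbitrary invariant state and modular
  automorphism.  If \<open>\<sigma>\<^sub>A(x) = u\<^sub>i\<^sub>j\<close>, then \<open>\<Phi>(x b) = \<Phi>(b u\<^sub>i\<^sub>j)\<close> for all \<open>b\<close>, and strong invariance of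
  \<open>\<Phi>\<close> turns this identity into a formula for the counit of \<open>x\<close> in terms of the values of \<open>\<Phi>\<close> on
  quadratic elements (\<open>counit_modular_preimage\<close>).  Thus \<open>\<delta>\<^sub>A\<close> is the character \<open>\<alpha> \<mapsto> q\<^sup>2\<close>,
  \<open>\<delta> \<mapsto> q\<^bsup>-2\<^esup>\<close>, which acts by positive diagonal matrices on all tensor powers of \<open>V\<^bsub>1/2\<^esub>\<close>.  Uniqueness
  of positive square roots of such matrices determines \<open>\<delta>\<^sub>A\<^bsup>1/2\<^esup>\<close> (\<open>dual_sqrt_chi\<close>).
\<close>

section \<open>Calculus in free algebras and their tensor squares\<close>

lemma poly_mapping_induct_single [case_names single add]:
  fixes x :: "'m \<Rightarrow>\<^sub>0 'c::comm_monoid_add"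
  assumes s: "\<And>w c. P (Poly_Mapping.single w c)"
    and a: "\<And>x y. P x \<Longrightarrow> P y \<Longrightarrow> P (x + y)"
  shows "P x"
proof -
  have x: "x = (\<Sum>k\<in>Poly_Mapping.keys x. Poly_Mapping.single k (Poly_Mapping.lookup x k))"
    by (rule poly_mapping_eqI)
      (simp add: lookup_sum lookup_single when_def in_keys_iff)
  have "P (\<Sum>k\<in>S. Poly_Mapping.single k (Poly_Mapping.lookup x k))" if "finite S" for S
    using that
  proof (induction S)
    case empty
    show ?case using s[of undefined 0] by simp
  next
    case (insert k S)
    then show ?case by (simp add: a s)
  qed
  then show ?thesis by (subst x) simp
qed

lemma sum_keys_single:
  assumes "\<And>k. h k 0 = 0"
  shows "(\<Sum>k\<in>Poly_Mapping.keys (Poly_Mapping.single w c).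
            h k (Poly_Mapping.lookup (Poly_Mapping.single w c) k)) = h w c"
  using assms by simp

lemma sc_0 [simp]: "sc 0 = 0" by (simp add: sc_def)
lemma sc_1 [simp]: "sc 1 = 1" by (simp add: sc_def)
lemma sc_add: "sc (c + d) = sc c + sc d" by (simp add: sc_def single_add)
lemma sc_uminus: "sc (- c) = - sc c" by (simp add: sc_def single_uminus)
lemma sc_mult: "sc (c * d) = sc c * sc d" by (simp add: sc_def mult_single)
lemma sc_mult_assoc: "sc c * (sc d * x) = sc (c * d) * x" by (simp add: sc_mult mult.assoc)

lemma sc_commute: "x * sc c = sc c * x"
  by (induction x rule: poly_mapping_induct_single)
    (simp_all add: sc_def mult_single mult.commute distrib_left distrib_right)

lemma sc_left_commute: "x * (sc c * y) = sc c * (x * y)"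
  by (metis mult.assoc sc_commute)

lemma single_conv_sc_mon: "Poly_Mapping.single w c = sc c * mon w"
  by (simp add: sc_def mon_def mult_single)

lemma mon_Nil [simp]: "mon (Word []) = 1"
  by (metis mon_def single_one zero_word_def)

lemma mon_add: "mon (v + w) = mon v * mon w"
  by (simp add: mon_def mult_single)

lemma mon_Cons: "mon (Word (g # w)) = gen g * mon (Word w)"
  by (simp add: gen_def mon_add [symmetric] plus_word_def)

lemma mon_snoc: "mon (Word (w @ [g])) = mon (Word w) * gen g"
  by (simp add: gen_def mon_add [symmetric] plus_word_def)

lemma falg_induct_mon [case_names mon add scale]:
  assumes "\<And>w. P (mon w)" "\<And>x y. P x \<Longrightarrow> P y \<Longrightarrow> P (x + y)" "\<And>c x. P x \<Longrightarrow> P (sc c * x)"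
  shows "P x"
  by (induction x rule: poly_mapping_induct_single) (auto simp: single_conv_sc_mon assms)

text \<open>Words are built letter by letter, so an identity between linear or multiplicative maps follows
  once it is stable under attaching one generator.  Most statements about \<open>A\<close> and \<open>U\<close> below are
  proved in this way, peeling off generators on the side on which the map in question recurses.\<close>

lemma falg_induct_left [case_names one add scale gen]:
  assumes "P 1" "\<And>x y. P x \<Longrightarrow> P y \<Longrightarrow> P (x + y)" "\<And>c x. P x \<Longrightarrow> P (sc c * x)"
    and "\<And>g x. P x \<Longrightarrow> P (gen g * x)"
  shows "P x"
proof (induction x rule: falg_induct_mon)
  case (mon w)
  have "P (mon (Word l))" for l
    by (induction l) (simp_all add: assms(1) mon_Cons assms(4))
  then show ?case by (metis word.exhaust)
qed (use assms in auto)

lemma falg_induct_right [case_names one add scale gen]: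
  assumes "P 1" "\<And>x y. P x \<Longrightarrow> P y \<Longrightarrow> P (x + y)" "\<And>c x. P x \<Longrightarrow> P (sc c * x)"
    and "\<And>g x. P x \<Longrightarrow> P (x * gen g)"
  shows "P x"
proof (induction x rule: falg_induct_mon)
  case (mon w)
  have "P (mon (Word l))" for l
    by (induction l rule: rev_induct) (simp_all add: assms(1) mon_snoc assms(4))
  then show ?case by (metis word.exhaust)
qed (use assms in auto)

subsection \<open>Homomorphic extensions\<close>

lemma free_hom_add:
  assumes "\<iota> 0 = 0" "\<And>c d. \<iota> (c + d) = \<iota> c + \<iota> d"
  shows "free_hom \<iota> \<phi> (x + y) = free_hom \<iota> \<phi> x + free_hom \<iota> \<phi> y"
  unfolding free_hom_def
  by (rule setsum_keys_plus_distrib[where f = "\<lambda>w c. \<iota> c * prod_list (map \<phi> (letters w))"])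
    (simp_all add: assms distrib_right)

lemma free_hom_single:
  assumes "\<iota> 0 = 0"
  shows "free_hom \<iota> \<phi> (Poly_Mapping.single w c) = \<iota> c * prod_list (map \<phi> (letters w))"
  unfolding free_hom_def
  by (rule sum_keys_single[where h = "\<lambda>w c. \<iota> c * prod_list (map \<phi> (letters w))"])
    (simp add: assms)

lemma free_hom_gen:
  assumes "\<iota> 0 = 0" "\<iota> 1 = 1"
  shows "free_hom \<iota> \<phi> (gen g) = \<phi> g"
  by (simp add: gen_def mon_def free_hom_single assms)

lemma free_hom_sc: "\<iota> 0 = 0 \<Longrightarrow> free_hom \<iota> \<phi> (sc c) = \<iota> c"
  by (simp add: sc_def free_hom_single zero_word_def)

lemma free_hom_mult:
  assumes "\<iota> 0 = 0" "\<And>c d. \<iota> (c + d) = \<iota> c + \<iota> d" "\<And>c d. \<iota> (c * d) = \<iota> c * \<iota> d"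
    and "\<And>c y. y * \<iota> c = \<iota> c * y"
  shows "free_hom \<iota> \<phi> (x * y) = free_hom \<iota> \<phi> x * free_hom \<iota> \<phi> y"
proof (induction x rule: poly_mapping_induct_single)
  case (single v c)
  show ?case
  proof (induction y rule: poly_mapping_induct_single)
    case (single w d)
    show ?case
      by (simp add: mult_single free_hom_single assms(1-3) plus_word_def)
        (metis assms(4) mult.assoc)
  qed (simp add: free_hom_add assms(1,2) distrib_left)
qed (simp add: free_hom_add assms(1,2) distrib_right)

lemma free_antihom_add:
  assumes "\<iota> 0 = 0" "\<And>c d. \<iota> (c + d) = \<iota> c + \<iota> d"
  shows "free_antihom \<iota> \<phi> (x + y) = free_antihom \<iota> \<phi> x + free_antihom \<iota> \<phi> y"
  unfolding free_antihom_def
  by (rule setsum_keys_plus_distrib[where f = "\<lambda>w c. \<iota> c * prod_list (map \<phi> (rev (letters w)))"])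
    (simp_all add: assms distrib_right)

lemma free_antihom_single:
  assumes "\<iota> 0 = 0"
  shows "free_antihom \<iota> \<phi> (Poly_Mapping.single w c) = \<iota> c * prod_list (map \<phi> (rev (letters w)))"
  unfolding free_antihom_def
  by (rule sum_keys_single[where h = "\<lambda>w c. \<iota> c * prod_list (map \<phi> (rev (letters w)))"])
    (simp add: assms)

lemma free_antihom_gen:
  assumes "\<iota> 0 = 0" "\<iota> 1 = 1"
  shows "free_antihom \<iota> \<phi> (gen g) = \<phi> g"
  by (simp add: gen_def mon_def free_antihom_single assms)

lemma free_antihom_sc: "\<iota> 0 = 0 \<Longrightarrow> free_antihom \<iota> \<phi> (sc c) = \<iota> c"
  by (simp add: sc_def free_antihom_single zero_word_def)

lemma free_antihom_mult:
  assumes "\<iota> 0 = 0" "\<And>c d. \<iota> (c + d) = \<iota> c + \<iota> d" "\<And>c d. \<iota> (c * d) = \<iota> c * \<iota> d"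
    and "\<And>c y. y * \<iota> c = \<iota> c * y"
  shows "free_antihom \<iota> \<phi> (x * y) = free_antihom \<iota> \<phi> y * free_antihom \<iota> \<phi> x"
proof (induction x rule: poly_mapping_induct_single)
  case (single v c)
  show ?case
  proof (induction y rule: poly_mapping_induct_single)
    case (single w d)
    show ?case
      by (simp add: mult_single free_antihom_single assms(1-3) plus_word_def)
        (metis assms(4) mult.assoc)
  qed (simp add: free_antihom_add assms(1,2) distrib_left distrib_right)
qed (simp add: free_antihom_add assms(1,2) distrib_left distrib_right)

subsection \<open>Linear functionals and ideals\<close>

lemma linear_functionalD:
  assumes "linear_functional \<omega>"
  shows "\<omega> (x + y) = \<omega> x + \<omega> y" "\<omega> (sc c * x) = c * \<omega> x" "\<omega> 0 = 0"
    "\<omega> (- x) = - \<omega> x" "\<omega> (x - y) = \<omega> x - \<omega> y" "\<omega> (sc c) = c * \<omega> 1" "\<omega> (x * sc c) = c * \<omega> x"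
    "\<omega> (x * (sc c * y)) = c * \<omega> (x * y)"
proof -
  show a: "\<omega> (x + y) = \<omega> x + \<omega> y" and s: "\<omega> (sc c * x) = c * \<omega> x" for x y c
    using assms by (auto simp: linear_functional_def)
  show z: "\<omega> 0 = 0" using s[of 0 0] by simp
  show m: "\<omega> (- x) = - \<omega> x" for x using s[of "-1" x] by (simp add: sc_uminus)
  show "\<omega> (x - y) = \<omega> x - \<omega> y" using a[of x "- y"] by (simp add: m)
  show "\<omega> (sc c) = c * \<omega> 1" using s[of c 1] by simp
  show "\<omega> (x * sc c) = c * \<omega> x" by (simp add: sc_commute s)
  show "\<omega> (x * (sc c * y)) = c * \<omega> (x * y)" by (simp add: sc_left_commute s)
qed

lemma linear_functional_sum:
  assumes "linear_functional \<omega>"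
  shows "\<omega> (\<Sum>i\<in>S. f i) = (\<Sum>i\<in>S. \<omega> (f i))"
  by (induction S rule: infinite_finite_induct) (simp_all add: linear_functionalD[OF assms])

lemma linear_functional_mult_left: "linear_functional \<omega> \<Longrightarrow> linear_functional (\<lambda>c. \<omega> (x * c))"
  by (simp add: linear_functional_def distrib_left sc_left_commute)

lemma linear_functional_mult_right: "linear_functional \<omega> \<Longrightarrow> linear_functional (\<lambda>c. \<omega> (c * x))"
  by (simp add: linear_functional_def distrib_right mult.assoc)

lemma linear_functional_ext:
  assumes "linear_functional \<omega>" "linear_functional \<chi>" "\<And>w. \<omega> (mon w) = \<chi> (mon w)"
  shows "\<omega> x = \<chi> x"
  by (induction x rule: falg_induct_mon) (simp_all add: linear_functionalD assms)

lemma ideal_gen_base: "r \<in> R \<Longrightarrow> r \<in> ideal_gen R"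
  using ideal_gen.add[OF ideal_gen.zero, of r R 1 1] by simp

lemma ideal_gen_add: "y \<in> ideal_gen R \<Longrightarrow> x \<in> ideal_gen R \<Longrightarrow> x + y \<in> ideal_gen R"
  by (induction rule: ideal_gen.induct) (auto simp: add.assoc [symmetric] intro: ideal_gen.intros)

lemma ideal_gen_mult_left: "x \<in> ideal_gen R \<Longrightarrow> a * x \<in> ideal_gen R"
proof (induction rule: ideal_gen.induct)
  case (add x r u v)
  then show ?case using ideal_gen.add[of "a * x" R r "a * u" v]
    by (simp add: distrib_left mult.assoc)
qed (simp add: ideal_gen.zero)

lemma ideal_gen_mult_right: "x \<in> ideal_gen R \<Longrightarrow> x * a \<in> ideal_gen R"
proof (induction rule: ideal_gen.induct)
  case (add x r u v)
  then show ?case using ideal_gen.add[of "x * a" R r u "v * a"]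
    by (simp add: distrib_right mult.assoc)
qed (simp add: ideal_gen.zero)

lemma ideal_gen_uminus: "x \<in> ideal_gen R \<Longrightarrow> - x \<in> ideal_gen R"
  using ideal_gen_mult_left[of x R "- 1"] by simp

text \<open>The elements of an ideal are sums of products \<open>u * r * v\<close> with a relation \<open>r\<close>.  Hence a property
  that is stable under sums has to be checked on these products only.\<close>

lemma ideal_gen_induct_ideal:
  assumes "x \<in> ideal_gen R" "P 0" "\<And>x y. P x \<Longrightarrow> P y \<Longrightarrow> P (x + y)"
    and "\<And>r u v. r \<in> R \<Longrightarrow> P (u * r * v)"
  shows "P x"
  using assms by (induction rule: ideal_gen.induct) auto

subsection \<open>Bilinear maps on the tensor square\<close>

definition bilin :: "('g falg \<Rightarrow> 'g falg \<Rightarrow> 'h falg) \<Rightarrow> bool" where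
  "bilin B \<longleftrightarrow>
     (\<forall>x x' y. B (x + x') y = B x y + B x' y) \<and> (\<forall>x y y'. B x (y + y') = B x y + B x y') \<and>
     (\<forall>c x y. B (sc c * x) y = sc c * B x y) \<and> (\<forall>c x y. B x (sc c * y) = sc c * B x y)"

text \<open>The linear map on the tensor square that a bilinear map induces.  The slice maps are
  instances, which gives them a common set of rules.\<close>

definition tapp :: "('g falg \<Rightarrow> 'g falg \<Rightarrow> 'h falg) \<Rightarrow> 'g falg2 \<Rightarrow> 'h falg" where
  "tapp B z = (\<Sum>p\<in>Poly_Mapping.keys z.
     sc (Poly_Mapping.lookup z p) * B (mon (fst p)) (mon (snd p)))"

lemma tapp_add: "tapp B (x + y) = tapp B x + tapp B y"
  unfolding tapp_def
  by (rule setsum_keys_plus_distrib[where f = "\<lambda>p c. sc c * B (mon (fst p)) (mon (snd p))"])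
    (simp_all add: sc_add distrib_right)

lemma tapp_single: "tapp B (Poly_Mapping.single p c) = sc c * B (mon (fst p)) (mon (snd p))"
  unfolding tapp_def
  by (rule sum_keys_single[where h = "\<lambda>p c. sc c * B (mon (fst p)) (mon (snd p))"]) simp

lemma tapp_one [simp]: "tapp B 1 = B 1 1"
  using tapp_single[of B 0 1] by (simp only: single_one) (simp add: zero_prod_def zero_word_def)

lemma tapp_scale: "tapp B (sc c * z) = sc c * tapp B z"
proof (induction z rule: poly_mapping_induct_single)
  case (single p d)
  have "sc c * Poly_Mapping.single p d = Poly_Mapping.single p (c * d)"
    by (simp add: sc_def mult_single)
  then show ?case by (simp add: tapp_single sc_mult mult.assoc)
qed (simp add: distrib_left tapp_add)

lemma tapp_fun_add: "tapp (\<lambda>x y. B x y + B' x y) z = tapp B z + tapp B' z"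
  by (simp add: tapp_def distrib_left sum.distrib)

lemma tapp_fun_mult_left: "tapp (\<lambda>x y. a * B x y) z = a * tapp B z"
  by (simp add: tapp_def sum_distrib_left sc_left_commute)

lemma tapp_fun_mult_right: "tapp (\<lambda>x y. B x y * a) z = tapp B z * a"
  by (simp add: tapp_def sum_distrib_right mult.assoc)

lemma tens_add_left: "tens (x + x') y = tens x y + tens x' y"
  unfolding tens_def
  by (rule setsum_keys_plus_distrib[where f = "\<lambda>v c. \<Sum>w\<in>Poly_Mapping.keys y.
     Poly_Mapping.single (v, w) (c * Poly_Mapping.lookup y w)"])
    (simp_all add: distrib_right single_add sum.distrib)

lemma tens_add_right: "tens x (y + y') = tens x y + tens x y'"
proof -
  have "(\<Sum>w\<in>Poly_Mapping.keys (y + y'). Poly_Mapping.single (v, w) (c * Poly_Mapping.lookup (y + y') w))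
     = (\<Sum>w\<in>Poly_Mapping.keys y. Poly_Mapping.single (v, w) (c * Poly_Mapping.lookup y w))
     + (\<Sum>w\<in>Poly_Mapping.keys y'. Poly_Mapping.single (v, w) (c * Poly_Mapping.lookup y' w))"
    for v :: "'a word" and c
    by (rule setsum_keys_plus_distrib[where f = "\<lambda>w d. Poly_Mapping.single (v, w) (c * d)"])
      (simp_all add: distrib_left single_add)
  then show ?thesis by (simp add: tens_def sum.distrib)
qed

lemma tens_single:
  "tens (Poly_Mapping.single v c) (Poly_Mapping.single w d) = Poly_Mapping.single (v, w) (c * d)"
  unfolding tens_def
  by (subst sum_keys_single[where h = "\<lambda>v c. \<Sum>w'\<in>Poly_Mapping.keys (Poly_Mapping.single w d).
     Poly_Mapping.single (v, w') (c * Poly_Mapping.lookup (Poly_Mapping.single w d) w')"])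
    (simp_all add: sum_keys_single[where h = "\<lambda>w' d. Poly_Mapping.single (v, w') (c * d)"])

lemma tapp_tens_mult:
  assumes "bilin B"
  shows "tapp B (tens x y * z) = tapp (\<lambda>a b. B (x * a) (y * b)) z"
proof (induction x rule: poly_mapping_induct_single)
  case (single v c)
  show ?case
  proof (induction y rule: poly_mapping_induct_single)
    case (single w d)
    show ?case
    proof (induction z rule: poly_mapping_induct_single)
      case (single p k)
      have "tapp B (tens (Poly_Mapping.single v c) (Poly_Mapping.single w d) * Poly_Mapping.single p k)
          = sc (c * d * k) * B (mon v * mon (fst p)) (mon w * mon (snd p))"
        by (simp add: tens_single mult_single tapp_single mon_add)
      also have "\<dots> = tapp (\<lambda>a b. B (Poly_Mapping.single v c * a) (Poly_Mapping.single w d * b))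
             (Poly_Mapping.single p k)"
        using assms
        by (simp add: tapp_single single_conv_sc_mon bilin_def mult.assoc sc_mult_assoc mult.commute mult.left_commute)
      finally show ?case .
    qed (simp_all add: distrib_left tapp_add)
  next
    case (add y y')
    then show ?case using assms
      by (simp add: tens_add_right distrib_right tapp_add bilin_def tapp_fun_add)
  qed
next
  case (add x x')
  then show ?case using assms
    by (simp add: tens_add_left distrib_right tapp_add bilin_def tapp_fun_add)
qed

lemma tapp_mult_tens:
  assumes "bilin B"
  shows "tapp B (z * tens x y) = tapp (\<lambda>a b. B (a * x) (b * y)) z"
proof (induction x rule: poly_mapping_induct_single)
  case (single v c)
  show ?case
  proof (induction y rule: poly_mapping_induct_single)
    case (single w d)
    show ?case
    proof (induction z rule: poly_mapping_induct_single)
      case (single p k)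
      have "tapp B (Poly_Mapping.single p k * tens (Poly_Mapping.single v c) (Poly_Mapping.single w d))
          = sc (k * (c * d)) * B (mon (fst p) * mon v) (mon (snd p) * mon w)"
        by (simp add: tens_single mult_single tapp_single mon_add)
      also have "\<dots> = tapp (\<lambda>a b. B (a * Poly_Mapping.single v c) (b * Poly_Mapping.single w d))
             (Poly_Mapping.single p k)"
        using assms
        by (simp add: tapp_single single_conv_sc_mon bilin_def sc_left_commute [of "mon u" for u]
            sc_mult_assoc ac_simps)
      finally show ?case .
    qed (simp_all add: distrib_right tapp_add)
  next
    case (add y y')
    then show ?case using assms
      by (simp add: tens_add_right distrib_left tapp_add bilin_def tapp_fun_add)
  qed
next
  case (add x x')
  then show ?case using assms
    by (simp add: tens_add_left distrib_left tapp_add bilin_def tapp_fun_add)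
qed

lemma tapp_tens: "bilin B \<Longrightarrow> tapp B (tens x y) = B x y"
  using tapp_tens_mult[of B x y 1] by simp

lemma tens_mult: "tens x y * tens x' y' = tens (x * x') (y * y')"
proof (induction x rule: poly_mapping_induct_single)
  case (single v c)
  show ?case
  proof (induction y rule: poly_mapping_induct_single)
    case (single w d)
    show ?case
    proof (induction x' rule: poly_mapping_induct_single)
      case (single v' c')
      show ?case
        by (induction y' rule: poly_mapping_induct_single)
          (simp_all add: tens_single mult_single distrib_left tens_add_right ac_simps)
    qed (simp_all add: distrib_left tens_add_left)
  qed (simp_all add: distrib_right tens_add_right)
qed (simp_all add: distrib_right tens_add_left)

lemma slice_left_tapp: "slice_left \<omega> z = tapp (\<lambda>x y. sc (\<omega> x) * y) z"
  by (simp add: slice_left_def tapp_def sc_mult mult.assoc)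

lemma slice_right_tapp: "slice_right \<omega> z = tapp (\<lambda>x y. sc (\<omega> y) * x) z"
  by (simp add: slice_right_def tapp_def sc_mult mult.assoc)

lemma bilin_slice_left: "linear_functional \<omega> \<Longrightarrow> bilin (\<lambda>x y. sc (\<omega> x) * y)"
  by (simp add: bilin_def linear_functionalD sc_add distrib_right distrib_left sc_mult_assoc
      mult.commute)

lemma bilin_slice_right: "linear_functional \<omega> \<Longrightarrow> bilin (\<lambda>x y. sc (\<omega> y) * x)"
  by (simp add: bilin_def linear_functionalD sc_add distrib_right distrib_left sc_mult_assoc
      mult.commute)

lemma slice_both_left:
  assumes "linear_functional \<chi>"
  shows "slice_both \<omega> \<chi> z = \<chi> (slice_left \<omega> z)"
  by (simp add: slice_both_def slice_left_def linear_functional_sum[OF assms] linear_functionalD[OF assms])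

lemma slice_both_right:
  assumes "linear_functional \<omega>"
  shows "slice_both \<omega> \<chi> z = \<omega> (slice_right \<chi> z)"
  by (simp add: slice_both_def slice_right_def linear_functional_sum[OF assms] linear_functionalD[OF assms]
      ac_simps)

lemma slice_both_tens_mult:
  assumes "linear_functional \<omega>" "linear_functional \<chi>"
  shows "slice_both \<omega> \<chi> (tens x y * z) = slice_both (\<lambda>a. \<omega> (x * a)) (\<lambda>b. \<chi> (y * b)) z"
proof -
  have "slice_both \<omega> \<chi> (tens x y * z) = \<chi> (y * slice_left (\<lambda>a. \<omega> (x * a)) z)"
    using assms
    by (simp add: slice_both_left slice_left_tapp tapp_tens_mult bilin_slice_left
        sc_left_commute [symmetric] tapp_fun_mult_left)
  also have "\<dots> = slice_both (\<lambda>a. \<omega> (x * a)) (\<lambda>b. \<chi> (y * b)) z"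
    using assms by (simp add: slice_both_left linear_functional_mult_left)
  finally show ?thesis .
qed

lemma slice_both_tens:
  assumes "linear_functional \<omega>" "linear_functional \<chi>"
  shows "slice_both \<omega> \<chi> (tens x y) = \<omega> x * \<chi> y"
  using assms by (simp add: slice_both_left slice_left_tapp tapp_tens bilin_slice_left linear_functionalD)

lemma slice_both_add:
  assumes "linear_functional \<chi>"
  shows "slice_both \<omega> \<chi> (z + z') = slice_both \<omega> \<chi> z + slice_both \<omega> \<chi> z'"
  using assms by (simp add: slice_both_left slice_left_tapp tapp_add linear_functionalD)

lemma slice_both_scale:
  assumes "linear_functional \<chi>"
  shows "slice_both \<omega> \<chi> (sc c * z) = c * slice_both \<omega> \<chi> z"
  using assms by (simp add: slice_both_left slice_left_tapp tapp_scale linear_functionalD)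

lemma slice_both_fun_add_left:
  "slice_both (\<lambda>a. f a + f' a) g z = slice_both f g z + slice_both f' g z"
  by (simp add: slice_both_def algebra_simps sum.distrib)

lemma slice_both_fun_add_right:
  "slice_both f (\<lambda>a. g a + g' a) z = slice_both f g z + slice_both f g' z"
  by (simp add: slice_both_def algebra_simps sum.distrib)

lemma slice_both_fun_scale_left: "slice_both (\<lambda>a. c * f a) g z = c * slice_both f g z"
  by (simp add: slice_both_def algebra_simps sum_distrib_left)

lemma slice_both_fun_scale_right: "slice_both f (\<lambda>a. c * g a) z = c * slice_both f g z"
  by (simp add: slice_both_def algebra_simps sum_distrib_left)

section \<open>The Hopf algebra $O_q(SU(2))$\<close>

text \<open>The fundamental corepresentation, with \<open>False\<close> for the index of \<open>\<xi>\<^sub>0\<close> and \<open>True\<close> for that of \<open>\<xi>\<^sub>1\<close>.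
  Writing the generators as \<open>u i j\<close> makes all structure maps matrix formulas, so that four cases
  are treated at once.\<close>

fun ug :: "bool \<Rightarrow> bool \<Rightarrow> genA" where
  "ug False False = GAlpha"
| "ug False True = GBeta"
| "ug True False = GGamma"
| "ug True True = GDelta"

abbreviation u :: "bool \<Rightarrow> bool \<Rightarrow> genA falg" where "u i j \<equiv> gen (ug i j)"

lemma genA_ug: "\<exists>i j. g = ug i j"
  by (cases g) (metis ug.simps)+

lemma sum_bool: "(\<Sum>k\<in>UNIV. f k) = f False + f True"
  for f :: "bool \<Rightarrow> 'b::comm_monoid_add"
  by (simp add: UNIV_bool add.commute)

lemma falgA_induct_left [case_names one add scale gen]:
  assumes "P 1" "\<And>x y. P x \<Longrightarrow> P y \<Longrightarrow> P (x + y)" "\<And>c x. P x \<Longrightarrow> P (sc c * x)"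
    and "\<And>i j x. P x \<Longrightarrow> P (u i j * x)"
  shows "P x"
  using assms by (induction x rule: falg_induct_left) (metis genA_ug)+

lemma falgA_induct_right [case_names one add scale gen]:
  assumes "P 1" "\<And>x y. P x \<Longrightarrow> P y \<Longrightarrow> P (x + y)" "\<And>c x. P x \<Longrightarrow> P (sc c * x)"
    and "\<And>i j x. P x \<Longrightarrow> P (x * u i j)"
  shows "P x"
  using assms by (induction x rule: falg_induct_right) (metis genA_ug)+

lemma copA_hom:
  "copA (x + y) = copA x + copA y" "copA (x * y) = copA x * copA y" "copA (sc c) = sc c"
  "copA 1 = 1" "copA (gen g) = copA_gen g"
proof -
  show "copA (x * y) = copA x * copA y"
    unfolding copA_def by (rule free_hom_mult) (simp, simp add: sc_add, simp add: sc_mult, simp add: sc_commute)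
  show "copA 1 = 1" using free_hom_sc[of sc copA_gen 1] by (simp add: copA_def)
qed (simp_all add: copA_def free_hom_add sc_add free_hom_sc free_hom_gen)

lemma copA_u: "copA (u i j) = (\<Sum>k\<in>UNIV. tens (u i k) (u k j))"
  by (cases i; cases j) (simp_all add: copA_hom sum_bool)

lemma tapp_copA_one: "tapp B (copA 1) = B 1 1"
  by (simp add: copA_hom)

lemma tapp_copA_add: "tapp B (copA (x + y)) = tapp B (copA x) + tapp B (copA y)"
  by (simp add: copA_hom tapp_add)

lemma tapp_copA_scale: "tapp B (copA (sc c * x)) = sc c * tapp B (copA x)"
  by (simp add: copA_hom tapp_scale)

lemma tapp_copA_left:
  assumes "bilin B"
  shows "tapp B (copA (u i j * x)) = (\<Sum>k\<in>UNIV. tapp (\<lambda>a b. B (u i k * a) (u k j * b)) (copA x))"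
  by (simp add: copA_hom(2) copA_u sum_bool distrib_right tapp_add tapp_tens_mult assms)

lemma tapp_copA_right:
  assumes "bilin B"
  shows "tapp B (copA (x * u i j)) = (\<Sum>k\<in>UNIV. tapp (\<lambda>a b. B (a * u i k) (b * u k j)) (copA x))"
  by (simp add: copA_hom(2) copA_u sum_bool distrib_left tapp_add tapp_mult_tens assms)

lemma slice_left_copA_left:
  assumes "linear_functional f"
  shows "slice_left f (copA (u i j * x)) = (\<Sum>k\<in>UNIV. u k j * slice_left (\<lambda>a. f (u i k * a)) (copA x))"
  by (simp add: slice_left_tapp tapp_copA_left bilin_slice_left assms
      tapp_fun_mult_left [symmetric] sc_left_commute)

lemma slice_right_copA_left:
  assumes "linear_functional f"
  shows "slice_right f (copA (u i j * x)) = (\<Sum>k\<in>UNIV. u i k * slice_right (\<lambda>a. f (u k j * a)) (copA x))"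
  by (simp add: slice_right_tapp tapp_copA_left bilin_slice_right assms
      tapp_fun_mult_left [symmetric] sc_left_commute)

lemma slice_right_copA_right:
  assumes "linear_functional f"
  shows "slice_right f (copA (x * u i j)) = (\<Sum>k\<in>UNIV. slice_right (\<lambda>a. f (a * u k j)) (copA x) * u i k)"
  by (simp add: slice_right_tapp tapp_copA_right bilin_slice_right assms
      tapp_fun_mult_right [symmetric] mult.assoc)

lemma conv_one: "linear_functional f \<Longrightarrow> linear_functional g \<Longrightarrow> conv f g 1 = f 1 * g 1"
  by (simp add: conv_def slice_both_left slice_left_tapp tapp_copA_one linear_functionalD)

lemma conv_add:
  "linear_functional g \<Longrightarrow> conv f g (x + y) = conv f g x + conv f g y"
  by (simp add: conv_def copA_hom slice_both_add)

lemma conv_scale: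
  "linear_functional g \<Longrightarrow> conv f g (sc c * x) = c * conv f g x"
  by (simp add: conv_def copA_hom slice_both_scale)

lemma linear_functional_conv: "linear_functional g \<Longrightarrow> linear_functional (conv f g)"
  by (simp add: linear_functional_def conv_add conv_scale)

text \<open>As \<open>\<Delta>(u\<^sub>i\<^sub>j x) = \<Sum>\<^sub>k u\<^sub>i\<^sub>k x\<^sub>1 \<otimes> u\<^sub>k\<^sub>j x\<^sub>2\<close>, a convolution at \<open>u i j * x\<close> is a sum of convolutions of
  translated functionals at \<open>x\<close>.  This is the recursion behind all inductions about \<open>conv\<close>.\<close>

lemma conv_left:
  assumes "linear_functional f" "linear_functional g"
  shows "conv f g (u i j * x) = (\<Sum>k\<in>UNIV. conv (\<lambda>a. f (u i k * a)) (\<lambda>b. g (u k j * b)) x)"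
  using assms
  by (simp add: conv_def slice_both_left linear_functional_mult_left slice_left_copA_left sum_bool
      linear_functionalD)

lemma conv_right:
  assumes "linear_functional f" "linear_functional g"
  shows "conv f g (x * u i j) = (\<Sum>k\<in>UNIV. conv (\<lambda>a. f (a * u i k)) (\<lambda>b. g (b * u k j)) x)"
  using assms
  by (simp add: conv_def slice_both_right linear_functional_mult_right slice_right_copA_right sum_bool
      linear_functionalD)

lemma conv_fun_linear:
  "conv (\<lambda>a. f a + f' a) g x = conv f g x + conv f' g x"
  "conv f (\<lambda>a. g a + g' a) x = conv f g x + conv f g' x"
  "conv (\<lambda>a. c * f a) g x = c * conv f g x"
  "conv f (\<lambda>a. c * g a) x = c * conv f g x"
  by (simp_all add: conv_def slice_both_fun_add_left slice_both_fun_add_right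
      slice_both_fun_scale_left slice_both_fun_scale_right)

lemma conv_eval_left: "linear_functional g \<Longrightarrow> conv f g x = g (slice_left f (copA x))"
  by (simp add: conv_def slice_both_left)

lemma conv_eval_right: "linear_functional f \<Longrightarrow> conv f g x = f (slice_right g (copA x))"
  by (simp add: conv_def slice_both_right)

lemma conv_assoc:
  assumes "linear_functional f" "linear_functional g" "linear_functional h"
  shows "conv (conv f g) h = conv f (conv g h)"
proof
  fix x
  show "conv (conv f g) h x = conv f (conv g h) x"
    using assms
  proof (induction x arbitrary: f g h rule: falgA_induct_left)
    case one
    then show ?case by (simp add: conv_one linear_functional_conv)
  next
    case (gen i j x)
    then show ?case
      by (simp add: conv_left linear_functional_conv sum_bool conv_fun_linear linear_functional_mult_left)
  qed (simp_all add: conv_add conv_scale linear_functional_conv)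
qed

lemma counA_hom:
  "counA (x + y) = counA x + counA y" "counA (x * y) = counA x * counA y" "counA (sc c) = c"
  "counA 1 = 1" "counA (u i j) = (if i = j then 1 else 0)"
proof -
  show "counA (x * y) = counA x * counA y"
    unfolding counA_def by (rule free_hom_mult) simp_all
  show "counA 1 = 1" using free_hom_sc[of id counA_gen 1] by (simp add: counA_def)
  show "counA (u i j) = (if i = j then 1 else 0)"
    by (cases i; cases j) (simp_all add: counA_def free_hom_gen)
qed (simp_all add: counA_def free_hom_add free_hom_sc)

lemma linear_functional_counA: "linear_functional counA"
  by (simp add: linear_functional_def counA_hom)

lemma conv_counA_left:
  assumes "linear_functional f"
  shows "conv counA f = f"
proof
  fix x
  show "conv counA f x = f x"
    using assms
  proof (induction x arbitrary: f rule: falgA_induct_left)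
    case (gen i j x)
    then show ?case
      by (cases i; simp add: conv_left linear_functional_counA sum_bool counA_hom conv_fun_linear
          linear_functional_mult_left)
  qed (simp_all add: conv_one linear_functional_counA conv_add conv_scale linear_functionalD counA_hom)
qed

lemma conv_counA_right:
  assumes "linear_functional f"
  shows "conv f counA = f"
proof
  fix x
  show "conv f counA x = f x"
    using assms
  proof (induction x arbitrary: f rule: falgA_induct_left)
    case (gen i j x)
    then show ?case
      by (cases j; simp add: conv_left linear_functional_counA sum_bool counA_hom conv_fun_linear
          linear_functional_mult_left)
  qed (simp_all add: conv_one linear_functional_counA conv_add conv_scale linear_functionalD counA_hom)
qed

lemma antA_hom:
  "antA q (x + y) = antA q x + antA q y" "antA q (x * y) = antA q y * antA q x" "antA q (sc c) = sc c"
  "antA q 1 = 1" "antA q (gen g) = antA_gen q g"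
proof -
  show "antA q (x * y) = antA q y * antA q x"
    unfolding antA_def by (rule free_antihom_mult) (simp, simp add: sc_add, simp add: sc_mult, simp add: sc_commute)
  show "antA q 1 = 1" using free_antihom_sc[of sc "antA_gen q" 1] by (simp add: antA_def)
qed (simp_all add: antA_def free_antihom_add sc_add free_antihom_sc free_antihom_gen)

lemma antA_scale: "antA q (sc c * x) = sc c * antA q x"
  by (simp add: antA_hom sc_commute)

lemma starA_hom:
  "starA q (x + y) = starA q x + starA q y" "starA q (x * y) = starA q y * starA q x"
  "starA q (sc c) = sc (cnj c)" "starA q 1 = 1" "starA q (gen g) = starA_gen q g"
proof -
  show "starA q (x * y) = starA q y * starA q x"
    unfolding starA_def by (rule free_antihom_mult) (simp, simp add: sc_add, simp add: sc_mult, simp add: sc_commute)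
  show "starA q 1 = 1" using free_antihom_sc[of "sc \<circ> cnj" "starA_gen q" 1] by (simp add: starA_def)
qed (simp_all add: starA_def free_antihom_add sc_add free_antihom_sc free_antihom_gen)

lemma starA_uminus: "starA q (- x) = - starA q x"
  using starA_hom(1)[of q x "- x"] starA_hom(3)[of q 0] by (simp add: eq_neg_iff_add_eq_0 add.commute)

lemma starA_scale: "starA q (sc c * x) = sc (cnj c) * starA q x"
  by (simp add: starA_hom sc_commute)

text \<open>Antipode and involution both reverse products, so their composition is multiplicative; on the
  fundamental corepresentation it is the transposition \<open>star_ant_u\<close>.  Only this composition enters
  the involution of the dual.\<close>

lemma star_ant_hom:
  "starA q (antA q (x + y)) = starA q (antA q x) + starA q (antA q y)"
  "starA q (antA q (sc c * x)) = sc (cnj c) * starA q (antA q x)"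
  "starA q (antA q (x * y)) = starA q (antA q x) * starA q (antA q y)"
  "starA q (antA q 1) = 1"
  by (simp_all add: antA_hom starA_hom antA_scale starA_scale)

lemma star_ant_u: "q \<noteq> 0 \<Longrightarrow> starA q (antA q (u i j)) = u j i"
  by (cases i; cases j)
    (simp_all add: antA_hom starA_hom starA_uminus starA_scale sc_mult_assoc sc_commute[of "sc k * x" for k x])

lemma dual_star_hom:
  assumes "linear_functional f"
  shows "linear_functional (dual_star q f)"
  using assms by (simp add: linear_functional_def dual_star_def star_ant_hom(1,2))

subsection \<open>Equality in the quotient and functionals on it\<close>

lemma eqA_refl: "eqA q x x" by (simp add: eqA_def ideal_A_def ideal_gen.zero)
lemma eqA_sym: "eqA q x y \<Longrightarrow> eqA q y x"
  unfolding eqA_def ideal_A_def using ideal_gen_uminus by fastforce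
lemma eqA_trans [trans]: "eqA q x y \<Longrightarrow> eqA q y z \<Longrightarrow> eqA q x z"
  unfolding eqA_def ideal_A_def using ideal_gen_add by fastforce
lemma eqA_add: "eqA q x x' \<Longrightarrow> eqA q y y' \<Longrightarrow> eqA q (x + y) (x' + y')"
  unfolding eqA_def ideal_A_def using ideal_gen_add by (metis add_diff_add)
lemma eqA_mult_left: "eqA q x x' \<Longrightarrow> eqA q (a * x) (a * x')"
  unfolding eqA_def ideal_A_def using ideal_gen_mult_left by (metis right_diff_distrib)
lemma eqA_mult_right: "eqA q x x' \<Longrightarrow> eqA q (x * a) (x' * a)"
  unfolding eqA_def ideal_A_def using ideal_gen_mult_right by (metis left_diff_distrib)

lemma dualA_linear: "\<omega> \<in> dualA q \<Longrightarrow> linear_functional \<omega>" by (simp add: dualA_def)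

lemma dualA_eqA: "\<omega> \<in> dualA q \<Longrightarrow> eqA q x y \<Longrightarrow> \<omega> x = \<omega> y"
  using linear_functionalD(5)[OF dualA_linear, of \<omega> q x y] by (simp add: dualA_def eqA_def)

lemma dualA_translate_left: "\<omega> \<in> dualA q \<Longrightarrow> (\<lambda>c. \<omega> (x * c)) \<in> dualA q"
  by (simp add: dualA_def linear_functional_mult_left ideal_A_def ideal_gen_mult_left)

lemma dualA_translate_right: "\<omega> \<in> dualA q \<Longrightarrow> (\<lambda>c. \<omega> (c * x)) \<in> dualA q"
  by (simp add: dualA_def linear_functional_mult_right ideal_A_def ideal_gen_mult_right)

lemma dualA_add: "\<omega> \<in> dualA q \<Longrightarrow> \<chi> \<in> dualA q \<Longrightarrow> (\<lambda>c. \<omega> c + \<chi> c) \<in> dualA q"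
  by (auto simp: dualA_def linear_functional_def algebra_simps)

lemma dualA_scale: "\<omega> \<in> dualA q \<Longrightarrow> (\<lambda>c. k * \<omega> c) \<in> dualA q"
  by (auto simp: dualA_def linear_functional_def algebra_simps)

lemma dualA_I:
  assumes "linear_functional \<omega>" "\<And>r a b. r \<in> rels_A q \<Longrightarrow> \<omega> (a * r * b) = 0"
  shows "\<omega> \<in> dualA q"
proof -
  have "\<omega> x = 0" if "x \<in> ideal_A q" for x
    using that unfolding ideal_A_def
    by (rule ideal_gen_induct_ideal) (simp_all add: assms linear_functionalD[OF assms(1)])
  then show ?thesis using assms by (simp add: dualA_def)
qed

lemma dualA_rel: "\<omega> \<in> dualA q \<Longrightarrow> r \<in> rels_A q \<Longrightarrow> \<omega> (x * r * y) = 0"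
  unfolding dualA_def ideal_A_def
  by (simp add: ideal_gen_mult_left ideal_gen_mult_right ideal_gen_base)

text \<open>The relations of \<open>A\<close> as rewrite rules below a functional: they bring words into the order
  \<open>\<beta>, \<gamma>, \<alpha>, \<delta>\<close> and remove adjacent \<open>\<alpha>\<close> and \<open>\<delta>\<close>.  The context \<open>x\<close>, \<open>y\<close> lets them apply
  inside a word that is associated to the right.\<close>

lemma dualA_rules:
  assumes "\<omega> \<in> dualA q"
  shows "\<omega> (x * (al * (be * y))) = q * \<omega> (x * (be * (al * y)))"
    "\<omega> (x * (al * (ga * y))) = q * \<omega> (x * (ga * (al * y)))"
    "\<omega> (x * (ga * (be * y))) = \<omega> (x * (be * (ga * y)))"
    "q \<noteq> 0 \<Longrightarrow> \<omega> (x * (de * (be * y))) = 1 / q * \<omega> (x * (be * (de * y)))"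
    "q \<noteq> 0 \<Longrightarrow> \<omega> (x * (de * (ga * y))) = 1 / q * \<omega> (x * (ga * (de * y)))"
    "\<omega> (x * (al * (de * y))) = q * \<omega> (x * (be * (ga * y))) + \<omega> (x * y)"
    "\<omega> (x * (de * (al * y))) = 1 / q * \<omega> (x * (be * (ga * y))) + \<omega> (x * y)"
proof -
  note lin = linear_functionalD[OF dualA_linear[OF assms]]
  note ex = lin ring_distribs mult.assoc
  have r: "\<omega> (x * r * y) = 0" if "r \<in> rels_A q" for r
    using dualA_rel[OF assms that] .
  have 3: "\<omega> (x * (ga * (be * y))) = \<omega> (x * (be * (ga * y)))"
    using r[of "be * ga - ga * be"] by (simp add: rels_A_def ex)
  show "\<omega> (x * (al * (be * y))) = q * \<omega> (x * (be * (al * y)))"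
    using r[of "al * be - sc q * be * al"] by (simp add: rels_A_def ex)
  show "\<omega> (x * (al * (ga * y))) = q * \<omega> (x * (ga * (al * y)))"
    using r[of "al * ga - sc q * ga * al"] by (simp add: rels_A_def ex)
  show "\<omega> (x * (ga * (be * y))) = \<omega> (x * (be * (ga * y)))" by (rule 3)
  show "\<omega> (x * (de * (be * y))) = 1 / q * \<omega> (x * (be * (de * y)))" if "q \<noteq> 0"
    using r[of "be * de - sc q * de * be"] that by (simp add: rels_A_def ex field_simps)
  show "\<omega> (x * (de * (ga * y))) = 1 / q * \<omega> (x * (ga * (de * y)))" if "q \<noteq> 0"
    using r[of "ga * de - sc q * de * ga"] that by (simp add: rels_A_def ex field_simps)
  show "\<omega> (x * (al * (de * y))) = q * \<omega> (x * (be * (ga * y))) + \<omega> (x * y)"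
    using r[of "al * de - sc q * be * ga - 1"] by (simp add: rels_A_def ex diff_eq_eq add.commute)
  show "\<omega> (x * (de * (al * y))) = 1 / q * \<omega> (x * (be * (ga * y))) + \<omega> (x * y)"
    using r[of "de * al - sc (1 / q) * ga * be - 1"] 3 by (simp add: rels_A_def ex diff_eq_eq add.commute del: of_real_divide)
qed

lemma counA_dualA: "q \<noteq> 0 \<Longrightarrow> counA \<in> dualA q"
proof (rule dualA_I[OF linear_functional_counA])
  fix r x y assume "r \<in> rels_A q"
  note D = linear_functionalD[OF linear_functional_counA]
  have g: "counA al = 1" "counA be = 0" "counA ga = 0" "counA de = 1"
    using counA_hom(5)[of False False] counA_hom(5)[of False True] counA_hom(5)[of True False]
      counA_hom(5)[of True True] by simp_all
  from \<open>r \<in> rels_A q\<close> have "counA r = 0"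
    by (auto simp: rels_A_def D(5) counA_hom g)
  then show "counA (x * r * y) = 0" by (simp add: counA_hom)
qed

section \<open>The right action of $O_q(SU(2))$ on functions on the integers\<close>

text \<open>Entries of the rank one projection \<open>(\<nu>, -1)\<^sup>T (\<nu>, 1) / (\<nu>\<^sup>2 - 1)\<close>.  For \<open>\<nu> = - i q\<^bsup>a + n\<^esup>\<close> it is the
  spectral projection for \<open>[a + n + 1]\<close> of the matrix by which \<open>i B\<^sub>t\<close> acts on \<open>V\<^bsub>1/2\<^esub> \<otimes> v\<close>, when \<open>v\<close>
  is an eigenvector for \<open>[a + n]\<close>.  Replacing \<open>\<nu>\<close> by \<open>1 / \<nu>\<close> gives the one for \<open>[a + n - 1]\<close>.\<close>

fun prj :: "complex \<Rightarrow> genA \<Rightarrow> complex" where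
  "prj \<nu> GAlpha = \<nu> / (\<nu> - 1 / \<nu>)"
| "prj \<nu> GBeta = 1 / (\<nu> - 1 / \<nu>)"
| "prj \<nu> GGamma = - 1 / (\<nu> - 1 / \<nu>)"
| "prj \<nu> GDelta = - (1 / \<nu>) / (\<nu> - 1 / \<nu>)"

lemma prj_values:
  assumes "\<nu> \<noteq> 0" "\<nu> * \<nu> - 1 = e" "e \<noteq> 0"
  shows "prj \<nu> GAlpha = \<nu> * \<nu> / e" "prj \<nu> GBeta = \<nu> / e" "prj \<nu> GGamma = - \<nu> / e" "prj \<nu> GDelta = - 1 / e"
    "prj (1 / \<nu>) GAlpha = - 1 / e" "prj (1 / \<nu>) GBeta = - \<nu> / e" "prj (1 / \<nu>) GGamma = \<nu> / e"
    "prj (1 / \<nu>) GDelta = \<nu> * \<nu> / e"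
proof -
  have "\<nu> - 1 / \<nu> = e / \<nu>" "1 / \<nu> - \<nu> = - e / \<nu>"
    using assms by (auto simp: field_simps)
  then show "prj \<nu> GAlpha = \<nu> * \<nu> / e" "prj \<nu> GBeta = \<nu> / e" "prj \<nu> GGamma = - \<nu> / e" "prj \<nu> GDelta = - 1 / e"
    "prj (1 / \<nu>) GAlpha = - 1 / e" "prj (1 / \<nu>) GBeta = - \<nu> / e" "prj (1 / \<nu>) GGamma = \<nu> / e"
    "prj (1 / \<nu>) GDelta = \<nu> * \<nu> / e"
    using assms by simp_all
qed

lemma prj_projection:
  assumes "\<nu> \<noteq> 0" "\<nu> - 1 / \<nu> \<noteq> 0"
  shows "prj \<nu> (ug i False) * prj \<nu> (ug False j) + prj \<nu> (ug i True) * prj \<nu> (ug True j) = prj \<nu> (ug i j)"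
    and "prj \<nu> (ug i False) * prj (1 / \<nu>) (ug False j) + prj \<nu> (ug i True) * prj (1 / \<nu>) (ug True j) = 0"
    and "prj \<nu> (ug i j) + prj (1 / \<nu>) (ug i j) = (if i = j then 1 else 0)"
proof -
  define e where "e = \<nu> * \<nu> - 1"
  have e: "e \<noteq> 0" using assms by (auto simp: e_def field_simps)
  note M = prj_values[OF assms(1) e_def [symmetric] e]
  show "prj \<nu> (ug i False) * prj \<nu> (ug False j) + prj \<nu> (ug i True) * prj \<nu> (ug True j) = prj \<nu> (ug i j)"
    using e by (cases i; cases j; simp add: M del: prj.simps; simp add: field_simps; simp add: e_def algebra_simps)
  show "prj \<nu> (ug i False) * prj (1 / \<nu>) (ug False j) + prj \<nu> (ug i True) * prj (1 / \<nu>) (ug True j) = 0"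
    using e by (cases i; cases j; simp add: M del: prj.simps)
  show "prj \<nu> (ug i j) + prj (1 / \<nu>) (ug i j) = (if i = j then 1 else 0)"
    using e by (cases i; cases j; simp add: M del: prj.simps; simp add: field_simps; simp add: e_def algebra_simps)
qed

text \<open>On the imaginary axis the projections are self-adjoint, as \<open>i B\<^sub>t\<close> is.\<close>

lemma prj_cnj:
  assumes "cnj \<nu> = - \<nu>"
  shows "cnj (prj \<nu> (ug i j)) = prj \<nu> (ug j i)"
proof -
  have d: "1 / \<nu> - \<nu> = - (\<nu> - 1 / \<nu>)" by simp
  show ?thesis using assms
    by (cases i; cases j; simp add: d del: minus_diff_eq)
qed

lemma prj_inverse_cnj:
  assumes "cnj \<nu> = - \<nu>"
  shows "cnj (prj (1 / \<nu>) (ug i j)) = prj (1 / \<nu>) (ug j i)"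
  using prj_cnj[of "1 / \<nu>"] assms by simp

locale sphere =
  fixes q a :: real
  assumes q: "0 < q" "q < 1"
begin

lemma q_nz [simp]: "q \<noteq> 0" and cq_nz [simp]: "complex_of_real q \<noteq> 0" using q by auto

definition nu :: "int \<Rightarrow> complex" where
  "nu n = - \<i> * complex_of_real (q powr (a + n))"

lemma nu_nz [simp]: "nu n \<noteq> 0" using q by (simp add: nu_def)

lemma nu_cnj: "cnj (nu n) = - nu n" by (simp add: nu_def)

lemma nu_suc: "nu (n + 1) = q * nu n"
proof -
  have "a + real_of_int (n + 1) = (a + real_of_int n) + 1" by simp
  then have "q powr (a + real_of_int (n + 1)) = q powr (a + real_of_int n) * q"
    using q by (simp only: powr_add) simp
  then show ?thesis by (simp add: nu_def)
qed

lemma nu_pred: "nu (n - 1) = nu n / q"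
  using nu_suc[of "n - 1"] by simp

text \<open>The square of an imaginary number is not 1; this keeps all denominators away from 0.\<close>

lemma imaginary_denominator:
  fixes \<nu> :: complex
  assumes "\<nu> \<noteq> 0" "cnj \<nu> = - \<nu>"
  shows "\<nu> * \<nu> \<noteq> 1" "\<nu> - 1 / \<nu> \<noteq> 0"
proof -
  have "Re (cnj \<nu>) = Re (- \<nu>)" by (simp only: assms(2))
  then have r: "Re \<nu> = 0" by simp
  have "\<nu> * \<nu> = complex_of_real (- (Im \<nu> * Im \<nu>))" using r by (simp add: complex_eq_iff)
  moreover have "- (Im \<nu> * Im \<nu>) \<noteq> 1" using zero_le_square[of "Im \<nu>"] by linarith
  ultimately show *: "\<nu> * \<nu> \<noteq> 1" by (simp only: of_real_eq_1_iff not_False_eq_True)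
  show "\<nu> - 1 / \<nu> \<noteq> 0" using * assms(1) by (auto simp: divide_simps)
qed

lemma nu_den: "nu n - 1 / nu n \<noteq> 0"
  by (rule imaginary_denominator) (simp_all add: nu_cnj)

definition act :: "genA \<Rightarrow> (int \<Rightarrow> complex) \<Rightarrow> int \<Rightarrow> complex" where
  "act g f n = prj (nu n) g * f (n + 1) + prj (1 / nu n) g * f (n - 1)"

text \<open>The letter on the left of a word acts first, which makes this a right action.\<close>

definition acts :: "genA falg \<Rightarrow> (int \<Rightarrow> complex) \<Rightarrow> int \<Rightarrow> complex" where
  "acts x f n = (\<Sum>w\<in>Poly_Mapping.keys x.
     Poly_Mapping.lookup x w * foldl (\<lambda>f g. act g f) f (letters w) n)"

lemma act_linear:
  "act g (\<lambda>n. f n + h n) = (\<lambda>n. act g f n + act g h n)" "act g (\<lambda>n. c * f n) = (\<lambda>n. c * act g f n)"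
  "act g (\<lambda>n. 0) = (\<lambda>n. 0)"
  by (simp_all add: act_def fun_eq_iff algebra_simps)

lemma acts_add: "acts (x + y) f n = acts x f n + acts y f n"
  unfolding acts_def
  by (rule setsum_keys_plus_distrib[where f = "\<lambda>w c. c * foldl (\<lambda>f g. act g f) f (letters w) n"])
    (simp_all add: distrib_right)

lemma acts_single: "acts (Poly_Mapping.single w c) f n = c * foldl (\<lambda>f g. act g f) f (letters w) n"
  unfolding acts_def
  by (rule sum_keys_single[where h = "\<lambda>w c. c * foldl (\<lambda>f g. act g f) f (letters w) n"]) simp

lemma acts_one [simp]: "acts 1 f = f"
  using acts_single[of 0 1 f] by (simp add: zero_word_def fun_eq_iff flip: single_one)

lemma acts_gen: "acts (gen g) f = act g f"
  by (simp add: gen_def mon_def acts_single fun_eq_iff)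

lemma foldl_act_linear:
  "foldl (\<lambda>f g. act g f) (\<lambda>n. f n + h n) w = (\<lambda>n. foldl (\<lambda>f g. act g f) f w n + foldl (\<lambda>f g. act g f) h w n)"
  "foldl (\<lambda>f g. act g f) (\<lambda>n. c * f n) w = (\<lambda>n. c * foldl (\<lambda>f g. act g f) f w n)"
  by (induction w arbitrary: f h) (simp_all add: act_linear)

lemma acts_fun_linear:
  "acts x (\<lambda>n. f n + h n) = (\<lambda>n. acts x f n + acts x h n)" "acts x (\<lambda>n. c * f n) = (\<lambda>n. c * acts x f n)"
  by (simp_all add: acts_def fun_eq_iff foldl_act_linear distrib_left sum.distrib sum_distrib_left ac_simps)

lemma acts_mult: "acts (x * y) f = acts y (acts x f)"
proof
  fix k
  show "acts (x * y) f k = acts y (acts x f) k"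
  proof (induction y rule: poly_mapping_induct_single)
  case (single w d)
  show ?case
  proof (induction x rule: poly_mapping_induct_single)
    case (single v c)
    have "acts (Poly_Mapping.single v c) f = (\<lambda>n. c * foldl (\<lambda>f g. act g f) f (letters v) n)"
      by (simp add: fun_eq_iff acts_single)
    then show ?case
      by (simp add: mult_single acts_single plus_word_def foldl_act_linear)
  next
    case (add x x')
    have "acts (x + x') f = (\<lambda>n. acts x f n + acts x' f n)" by (simp add: fun_eq_iff acts_add)
    with add show ?case by (simp add: distrib_right acts_add acts_fun_linear)
  qed
  qed (simp add: distrib_left acts_add)
qed

lemma acts_scale: "acts (sc c * x) f n = c * acts x f n"
proof -
  have "acts (sc c) f n = c * f n" for f n
    by (simp add: sc_def acts_single zero_word_def)
  then show ?thesis unfolding acts_mult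
    by (metis (mono_tags, lifting) acts_fun_linear(2) acts_mult sc_commute)
qed

lemma acts_linear_functional: "linear_functional (\<lambda>x. acts x f n)"
  by (simp add: linear_functional_def acts_add acts_scale)

lemma acts_zero: "acts x (\<lambda>n. 0) = (\<lambda>n. 0)"
  using acts_fun_linear(2)[of x 0 "\<lambda>n. 0"] by simp

text \<open>A word of length two moves \<open>n\<close> by \<open>-2\<close>, \<open>0\<close> or \<open>2\<close>, and its coefficients are products of entries of
  the projections at \<open>\<nu>\<close>, \<open>q \<nu>\<close> and \<open>\<nu> / q\<close>.  After multiplication with the common denominator the
  relations become polynomial identities in \<open>\<nu>\<close> and \<open>q\<close>.\<close>

lemma acts_relations:
  assumes "r \<in> rels_A q"
  shows "acts r f = (\<lambda>n. 0)"
proof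
  fix n
  define \<nu> Q where "\<nu> = nu n" and "Q = complex_of_real q"
  have Q: "Q \<noteq> 0" "cnj Q = Q" by (simp_all add: Q_def)
  have nz: "\<nu> \<noteq> 0" and c: "cnj \<nu> = - \<nu>" by (simp_all add: \<nu>_def nu_cnj)
  have m: "\<nu> * \<nu> \<noteq> 1" "(Q * \<nu>) * (Q * \<nu>) \<noteq> 1" "(\<nu> / Q) * (\<nu> / Q) \<noteq> 1"
    by (rule imaginary_denominator(1); simp add: nz c Q)+
  have d0: "\<nu> - 1 / \<nu> = (\<nu> * \<nu> - 1) / \<nu>" "1 / \<nu> - \<nu> = - (\<nu> * \<nu> - 1) / \<nu>"
    using nz by (simp_all add: field_simps)
  have d1: "Q * \<nu> - 1 / (Q * \<nu>) = (Q * Q * \<nu> * \<nu> - 1) / (Q * \<nu>)"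
    "1 / (Q * \<nu>) - Q * \<nu> = - (Q * Q * \<nu> * \<nu> - 1) / (Q * \<nu>)"
    using nz Q by (simp_all add: field_simps)
  have d2: "\<nu> / Q - Q / \<nu> = (\<nu> * \<nu> - Q * Q) / (Q * \<nu>)" "Q / \<nu> - \<nu> / Q = - (\<nu> * \<nu> - Q * Q) / (Q * \<nu>)"
    using nz Q by (simp_all add: field_simps)
  define e0 e1 e2 where "e0 = \<nu> * \<nu> - 1" and "e1 = Q * Q * \<nu> * \<nu> - 1" and "e2 = \<nu> * \<nu> - Q * Q"
  have e: "e0 \<noteq> 0" "e1 \<noteq> 0" "e2 \<noteq> 0"
    using m nz Q by (auto simp: e0_def e1_def e2_def field_simps)
  \<comment> \<open>numerators of the projections at \<open>\<nu>\<close>, \<open>q \<nu>\<close> and \<open>\<nu> / q\<close> over the common denominators \<open>e0\<close>, \<open>e1\<close>, \<open>e2\<close>\<close>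
  define p0 where "p0 = case_genA (\<nu> * \<nu>) \<nu> (- \<nu>) (- 1)"
  define m0 where "m0 = case_genA (- 1) (- \<nu>) \<nu> (\<nu> * \<nu>)"
  define p1 where "p1 = case_genA (Q * Q * \<nu> * \<nu>) (Q * \<nu>) (- Q * \<nu>) (- 1)"
  define m1 where "m1 = case_genA (- 1) (- Q * \<nu>) (Q * \<nu>) (Q * Q * \<nu> * \<nu>)"
  define p2 where "p2 = case_genA (\<nu> * \<nu>) (Q * \<nu>) (- Q * \<nu>) (- Q * Q)"
  define m2 where "m2 = case_genA (- Q * Q) (- Q * \<nu>) (Q * \<nu>) (\<nu> * \<nu>)"
  have M: "prj \<nu> g = p0 g / e0" "prj (1 / \<nu>) g = m0 g / e0" "prj (Q * \<nu>) g = p1 g / e1"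
    "prj (1 / (Q * \<nu>)) g = m1 g / e1" "prj (\<nu> / Q) g = p2 g / e2" "prj (Q / \<nu>) g = m2 g / e2" for g
    using nz e Q
    by (cases g; simp add: d0 d1 d2 e0_def [symmetric] e1_def [symmetric] e2_def [symmetric]
        p0_def m0_def p1_def m1_def p2_def m2_def)+
  have two: "acts (gen g * gen h) f n =
      prj \<nu> h * (prj (Q * \<nu>) g * f (n + 2) + prj (1 / (Q * \<nu>)) g * f n)
      + prj (1 / \<nu>) h * (prj (\<nu> / Q) g * f n + prj (Q / \<nu>) g * f (n - 2))" for g h
    by (simp add: acts_mult acts_gen act_def nu_suc nu_pred \<nu>_def Q_def add.assoc)
  have N: "acts (gen g * gen h) f n * (e0 * e1 * e2) =
      e2 * p0 h * (p1 g * f (n + 2) + m1 g * f n) + e1 * m0 h * (p2 g * f n + m2 g * f (n - 2))" for g h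
    unfolding two M using e by (simp add: field_simps)
  note lin = linear_functionalD[OF acts_linear_functional]
  define E where "E = e0 * e1 * e2"
  define S where "S g h = e2 * p0 h * (p1 g * f (n + 2) + m1 g * f n)
      + e1 * m0 h * (p2 g * f n + m2 g * f (n - 2))" for g h
  have S: "acts (gen g * gen h) f n * E = S g h" for g h
    unfolding S_def E_def by (rule N)
  have comm: "S GAlpha GBeta = Q * S GBeta GAlpha" "S GAlpha GGamma = Q * S GGamma GAlpha"
    "S GBeta GGamma = S GGamma GBeta" "S GBeta GDelta = Q * S GDelta GBeta"
    "S GGamma GDelta = Q * S GDelta GGamma"
    by (simp_all add: S_def p0_def m0_def p1_def m1_def p2_def m2_def;
        simp add: e0_def e1_def e2_def algebra_simps)+
  have det: "S GAlpha GDelta - Q * S GBeta GGamma = E * f n"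
    by (simp add: S_def p0_def m0_def p1_def m1_def p2_def m2_def E_def;
        simp add: e0_def e1_def e2_def algebra_simps)
  have det': "Q * S GDelta GAlpha - S GGamma GBeta = Q * (E * f n)"
    by (simp add: S_def p0_def m0_def p1_def m1_def p2_def m2_def E_def;
        simp add: e0_def e1_def e2_def algebra_simps)
  have "acts r f n * E = 0"
    using assms unfolding rels_A_def
  proof (elim insertE emptyE)
    assume "r = de * al - sc (1 / q) * ga * be - 1"
    then have "Q * (acts r f n * E) = Q * S GDelta GAlpha - S GGamma GBeta - Q * (E * f n)"
      using Q by (simp add: lin mult.assoc left_diff_distrib S Q_def [symmetric] right_diff_distrib)
    then show ?thesis using det' Q by simp
  qed (use comm det in \<open>simp_all add: lin mult.assoc left_diff_distrib S Q_def [symmetric]\<close>)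
  then show "acts r f n = 0" using e by (simp add: E_def)
qed

lemma acts_dualA: "(\<lambda>x. acts x f n) \<in> dualA q"
  by (rule dualA_I[OF acts_linear_functional]) (simp add: acts_mult acts_relations acts_zero)

text \<open>Split off the last letter \<open>u\<^sub>i\<^sub>j\<close> of the word, with coproduct \<open>\<Sum>\<^sub>k u\<^sub>i\<^sub>k \<otimes> u\<^sub>k\<^sub>j\<close>.  The two factors move \<open>n\<close> by
  \<open>P\<^sup>\<plusminus>(i, k)\<close> and \<open>P\<^sup>\<plusminus>(k, j)\<close>, and summation over \<open>k\<close> multiplies the projections.  Orthogonality kills
  the terms in which \<open>f\<close> and \<open>g\<close> move in different directions, idempotence leaves the others.\<close>

lemma acts_conv: "conv (\<lambda>c. acts c f n) (\<lambda>c. acts c g n) x = acts x (\<lambda>n. f n * g n) n"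
proof (induction x arbitrary: n rule: falgA_induct_right)
  case one
  then show ?case by (simp add: conv_one acts_linear_functional)
next
  case (gen i j x)
  have P: "prj (nu n) (ug i' False) * prj (nu n) (ug False j') + prj (nu n) (ug i' True) * prj (nu n) (ug True j') = prj (nu n) (ug i' j')"
    "prj (nu n) (ug i' False) * prj (1 / nu n) (ug False j') + prj (nu n) (ug i' True) * prj (1 / nu n) (ug True j') = 0"
    for i' j'
    by (rule prj_projection[OF nu_nz nu_den])+
  have "1 / nu n - 1 / (1 / nu n) \<noteq> 0" using nu_den[of n] by auto
  then have inv: "1 / nu n \<noteq> 0" "1 / nu n - 1 / (1 / nu n) \<noteq> 0" by simp_all
  have N: "prj (1 / nu n) (ug i' False) * prj (1 / nu n) (ug False j') + prj (1 / nu n) (ug i' True) * prj (1 / nu n) (ug True j') = prj (1 / nu n) (ug i' j')"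
    "prj (1 / nu n) (ug i' False) * prj (nu n) (ug False j') + prj (1 / nu n) (ug i' True) * prj (nu n) (ug True j') = 0"
    for i' j'
    using prj_projection(1)[OF inv, of i' j'] prj_projection(2)[OF inv, of i' j']
    by (simp_all only: divide_divide_eq_right mult_1_left div_by_1)
  define A B C D where "A = conv (\<lambda>c. acts c f (n + 1)) (\<lambda>c. acts c g (n + 1)) x"
    and "B = conv (\<lambda>c. acts c f (n + 1)) (\<lambda>c. acts c g (n - 1)) x"
    and "C = conv (\<lambda>c. acts c f (n - 1)) (\<lambda>c. acts c g (n + 1)) x"
    and "D = conv (\<lambda>c. acts c f (n - 1)) (\<lambda>c. acts c g (n - 1)) x"
  have "conv (\<lambda>c. acts c f n) (\<lambda>c. acts c g n) (x * u i j) =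
    (\<Sum>k\<in>UNIV. prj (nu n) (ug i k) * (prj (nu n) (ug k j) * A + prj (1 / nu n) (ug k j) * B)
      + prj (1 / nu n) (ug i k) * (prj (nu n) (ug k j) * C + prj (1 / nu n) (ug k j) * D))"
    unfolding conv_right[OF acts_linear_functional acts_linear_functional] acts_mult acts_gen act_def
      conv_fun_linear A_def B_def C_def D_def by (simp only: distrib_left add.assoc)
  also have "\<dots> = (\<Sum>k\<in>UNIV. prj (nu n) (ug i k) * prj (nu n) (ug k j)) * A
      + (\<Sum>k\<in>UNIV. prj (nu n) (ug i k) * prj (1 / nu n) (ug k j)) * B
      + (\<Sum>k\<in>UNIV. prj (1 / nu n) (ug i k) * prj (nu n) (ug k j)) * C
      + (\<Sum>k\<in>UNIV. prj (1 / nu n) (ug i k) * prj (1 / nu n) (ug k j)) * D"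
    by (simp add: sum_bool algebra_simps)
  also have "\<dots> = prj (nu n) (ug i j) * A + prj (1 / nu n) (ug i j) * D"
    by (simp only: sum_bool P N mult_zero_left add_0_right)
  also have "\<dots> = acts (x * u i j) (\<lambda>n. f n * g n) n"
    by (simp only: A_def D_def gen acts_mult acts_gen act_def)
  finally show ?case .
qed (simp_all add: conv_add conv_scale acts_linear_functional acts_add acts_scale)

definition om :: "(int \<Rightarrow> complex) \<Rightarrow> genA falg \<Rightarrow> complex" where
  "om f x = acts x f 0"

lemma om_dualA: "om f \<in> dualA q" using acts_dualA[of f 0] by (simp add: om_def [abs_def])

lemma om_linear: "linear_functional (om f)" using om_dualA dualA_linear by blast

lemma om_conv: "conv (om f) (om g) = om (\<lambda>n. f n * g n)"
  using acts_conv[of f 0 g] by (simp add: om_def [abs_def] fun_eq_iff)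

lemma om_fun_linear: "om (\<lambda>n. f n + g n) x = om f x + om g x" "om (\<lambda>n. c * f n) x = c * om f x"
  by (simp_all add: om_def acts_fun_linear)

lemma om_ract: "om f (x * y) = om (acts x f) y" by (simp add: om_def acts_mult)

text \<open>The two projections add up to the identity matrix, which is the counit of \<open>u\<close>.\<close>

lemma acts_counit: "acts x (\<lambda>n. 1) = (\<lambda>n. counA x)"
proof (induction x rule: falgA_induct_left)
  case (gen i j x)
  have "act (ug i j) (\<lambda>n. 1) = (\<lambda>n. (if i = j then 1 else 0) * 1)"
  proof
    fix n
    show "act (ug i j) (\<lambda>n. 1) n = (if i = j then 1 else 0) * 1"
      using prj_projection(3)[OF nu_nz nu_den, of n i j] by (simp only: act_def mult_1_right)
  qed
  then have "acts (u i j * x) (\<lambda>n. 1) = acts x (\<lambda>n. (if i = j then 1 else 0) * 1)"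
    by (simp only: acts_mult acts_gen)
  also have "\<dots> = (\<lambda>n. (if i = j then 1 else 0) * acts x (\<lambda>n. 1) n)"
    by (rule acts_fun_linear(2))
  finally have "acts (u i j * x) (\<lambda>n. 1) = (\<lambda>n. (if i = j then 1 else 0) * acts x (\<lambda>n. 1) n)" .
  then show ?case by (simp add: gen counA_hom)
qed (simp_all add: acts_add acts_scale counA_hom fun_eq_iff)

lemma om_counA: "om (\<lambda>n. 1) = counA"
  by (simp add: om_def acts_counit fun_eq_iff)

lemma om_one: "om f 1 = f 0" by (simp add: om_def)

text \<open>Transposing \<open>u\<close> and conjugating preserves the projections because they are self-adjoint.\<close>

lemma om_star: "dual_star q (om f) = om (\<lambda>n. cnj (f n))"
proof
  fix x
  have "cnj (acts (starA q (antA q x)) f n) = acts x (\<lambda>n. cnj (f n)) n" for n f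
  proof (induction x arbitrary: f n rule: falgA_induct_right)
    case (gen i j x)
    then show ?case
      by (simp add: star_ant_hom star_ant_u acts_mult acts_gen act_def prj_cnj prj_inverse_cnj nu_cnj)
  qed (simp_all add: star_ant_hom(1,2,4) acts_add acts_scale)
  then show "dual_star q (om f) x = om (\<lambda>n. cnj (f n)) x"
    by (simp add: dual_star_def om_def)
qed

end

section \<open>Representations of $U_q(su(2))$\<close>

lemma falgU_linear_entry:
  assumes "r < n + 1" "p < n + 1"
  shows "linear_functional (\<lambda>x. rep q n x $$ (r, p))"
proof -
  let ?f = "\<lambda>x. \<Sum>w\<in>Poly_Mapping.keys x. Poly_Mapping.lookup x w * rep_word q n w $$ (r, p)"
  have e: "rep q n x $$ (r, p) = ?f x" for x using assms by (simp add: rep_def)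
  have add: "?f (x + y) = ?f x + ?f y" for x y
    by (rule setsum_keys_plus_distrib[where f = "\<lambda>w c. c * rep_word q n w $$ (r, p)"])
      (simp_all add: distrib_right)
  have sg: "?f (Poly_Mapping.single w c) = c * rep_word q n w $$ (r, p)" for w c
    by (rule sum_keys_single[where h = "\<lambda>w c. c * rep_word q n w $$ (r, p)"]) simp
  have "?f (sc c * x) = c * ?f x" for c x
  proof (induction x rule: poly_mapping_induct_single)
    case (single w d)
    have "sc c * Poly_Mapping.single w d = Poly_Mapping.single w (c * d)"
      by (simp add: sc_def mult_single)
    show ?case unfolding \<open>sc c * Poly_Mapping.single w d = _\<close> sg by (rule mult.assoc)
  next
    case (add x y)
    then show ?case by (simp only: distrib_left \<open>\<And>x y. ?f (x + y) = ?f x + ?f y\<close>)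
  qed
  with add show ?thesis by (simp add: linear_functional_def e)
qed

lemma rep_mon:
  assumes "r < n + 1" "p < n + 1"
  shows "rep q n (mon w) $$ (r, p) = rep_word q n w $$ (r, p)"
  using assms by (simp add: rep_def mon_def)

lemma rep_carrier [simp]: "rep q n x \<in> carrier_mat (n + 1) (n + 1)"
  by (simp add: rep_def)

lemma rep_dim [simp]: "dim_row (rep q n x) = n + 1" "dim_col (rep q n x) = n + 1"
  by (simp_all add: rep_def)

lemma rep_word_carrier: "rep_word q n w \<in> carrier_mat (n + 1) (n + 1)"
proof -
  have "foldr (\<lambda>g M. rep_gen q n g * M) l (1\<^sub>m (n + 1)) \<in> carrier_mat (n + 1) (n + 1)" for l
    by (induction l) (auto simp: rep_gen_def)
  then show ?thesis by (simp add: rep_word_def)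
qed

lemma rep_entry_gen_mult:
  assumes "r < n + 1" "p < n + 1"
  shows "rep q n (gen g * x) $$ (r, p)
    = (\<Sum>s<n + 1. complex_of_real (rep_gen_entry q n g r s) * rep q n x $$ (s, p))"
proof (induction x rule: falg_induct_mon)
  case (mon w)
  obtain l where w: "w = Word l" by (cases w)
  have c: "rep_word q n w \<in> carrier_mat (n + 1) (n + 1)" by (rule rep_word_carrier)
  have "rep q n (gen g * mon w) $$ (r, p) = rep_word q n (Word (g # l)) $$ (r, p)"
    using assms by (simp only: w mon_Cons [symmetric] rep_mon)
  also have "\<dots> = (rep_gen q n g * rep_word q n w) $$ (r, p)"
    by (simp add: rep_word_def w)
  also have "\<dots> = (\<Sum>s<n + 1. complex_of_real (rep_gen_entry q n g r s) * rep_word q n w $$ (s, p))"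
    using assms c by (simp add: rep_gen_def scalar_prod_def row_def col_def atLeast0LessThan)
  also have "\<dots> = (\<Sum>s<n + 1. complex_of_real (rep_gen_entry q n g r s) * rep q n (mon w) $$ (s, p))"
    using assms by (intro sum.cong) (simp_all add: rep_mon)
  finally show ?case .
next
  case (add x y)
  have l: "rep q n (x + y) $$ (s, p) = rep q n x $$ (s, p) + rep q n y $$ (s, p)" if "s < n + 1" for s x y
    using linear_functionalD(1)[OF falgU_linear_entry] that assms by blast
  show ?case using add assms by (simp add: distrib_left l sum.distrib)
next
  case (scale c x)
  have l: "rep q n (sc c * x) $$ (s, p) = c * rep q n x $$ (s, p)" if "s < n + 1" for s x
    using linear_functionalD(2)[OF falgU_linear_entry] that assms by blast
  have "gen g * (sc c * x) = sc c * (gen g * x)" by (rule sc_left_commute)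
  then show ?case using scale assms
    by (simp add: l sum_distrib_left mult.left_commute del: sum.lessThan_Suc)
qed

lemma rep_entry_one:
  assumes "r < n + 1" "p < n + 1"
  shows "rep q n 1 $$ (r, p) = (if r = p then 1 else 0)"
proof -
  have "rep q n 1 $$ (r, p) = rep_word q n (Word []) $$ (r, p)"
    using rep_mon[OF assms, of q "Word []"] by simp
  then show ?thesis using assms by (simp add: rep_word_def)
qed

lemma rep_one: "rep q n 1 = 1\<^sub>m (n + 1)"
  by (rule eq_matI) (simp_all add: rep_entry_one)

lemma rep_entry_gen:
  assumes "r < n + 1" "p < n + 1"
  shows "rep q n (gen g) $$ (r, p) = complex_of_real (rep_gen_entry q n g r p)"
proof -
  have "rep q n (gen g * 1) $$ (r, p)
      = (\<Sum>s<n + 1. if s = p then complex_of_real (rep_gen_entry q n g r s) else 0)"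
    unfolding rep_entry_gen_mult[OF assms] using assms
    by (intro sum.cong) (auto simp: rep_entry_one)
  then show ?thesis using assms by simp
qed

lemma rep_entry_mult:
  assumes "r < n + 1" "p < n + 1"
  shows "rep q n (x * y) $$ (r, p) = (\<Sum>s<n + 1. rep q n x $$ (r, s) * rep q n y $$ (s, p))"
  using assms(1)
proof (induction x arbitrary: r rule: falg_induct_left)
  case one
  have "(\<Sum>s<n + 1. rep q n 1 $$ (r, s) * rep q n y $$ (s, p))
      = (\<Sum>s<n + 1. if s = r then rep q n y $$ (s, p) else 0)"
    using one by (intro sum.cong) (auto simp: rep_entry_one)
  then show ?case using one by simp
next
  case (add x x')
  have l: "rep q n (x + y) $$ (r, s) = rep q n x $$ (r, s) + rep q n y $$ (r, s)" if "s < n + 1" for s x y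
    using linear_functionalD(1)[OF falgU_linear_entry] that add.prems by blast
  show ?case using add assms(2) by (simp add: distrib_right l sum.distrib)
next
  case (scale c x)
  have l: "rep q n (sc c * x) $$ (r, s) = c * rep q n x $$ (r, s)" if "s < n + 1" for s x
    using linear_functionalD(2)[OF falgU_linear_entry] that scale.prems by blast
  show ?case using scale assms(2)
    by (simp add: l mult.assoc sum_distrib_left del: sum.lessThan_Suc)
next
  case (gen g x)
  have "rep q n (gen g * x * y) $$ (r, p)
      = (\<Sum>s<n + 1. complex_of_real (rep_gen_entry q n g r s) *
          (\<Sum>k<n + 1. rep q n x $$ (s, k) * rep q n y $$ (k, p)))"
    unfolding mult.assoc rep_entry_gen_mult[OF gen.prems assms(2)]
    by (intro sum.cong) (simp_all only: gen.IH lessThan_iff)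
  also have "\<dots> = (\<Sum>k<n + 1. (\<Sum>s<n + 1. complex_of_real (rep_gen_entry q n g r s) * rep q n x $$ (s, k)) * rep q n y $$ (k, p))"
    by (simp only: sum_distrib_left sum_distrib_right mult.assoc) (rule sum.swap)
  also have "\<dots> = (\<Sum>k<n + 1. rep q n (gen g * x) $$ (r, k) * rep q n y $$ (k, p))"
    by (intro sum.cong) (simp_all only: rep_entry_gen_mult[OF gen.prems] lessThan_iff)
  finally show ?case .
qed

lemma rep_scale_entry: "r < n + 1 \<Longrightarrow> p < n + 1 \<Longrightarrow> rep q n (sc c * x) $$ (r, p) = c * rep q n x $$ (r, p)"
  using linear_functionalD(2)[OF falgU_linear_entry] by blast

lemma starU_hom:
  "starU (x + y) = starU x + starU y" "starU (x * y) = starU y * starU x"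
  "starU (sc c) = sc (cnj c)" "starU 1 = 1" "starU (gen g) = starU_gen g"
proof -
  show "starU (x * y) = starU y * starU x"
    unfolding starU_def by (rule free_antihom_mult) (simp, simp add: sc_add, simp add: sc_mult, simp add: sc_commute)
  show "starU 1 = 1" using free_antihom_sc[of "sc \<circ> cnj" starU_gen 1] by (simp add: starU_def)
qed (simp_all add: starU_def free_antihom_add sc_add free_antihom_sc free_antihom_gen)

text \<open>The basis is normalised so that \<open>e\<^sup>* = f k\<close> holds; since the matrices are real, only the two square
  roots and the exponents of \<open>q\<close> have to be compared.\<close>

lemma rep_gen_entry_star:
  assumes "0 < q" "r < n + 1" "p < n + 1"
  shows "rep q n (starU_gen g) $$ (r, p) = complex_of_real (rep_gen_entry q n g p r)"
proof -
  have K: "(\<Sum>s<n + 1. complex_of_real (rep_gen_entry q n GF r s) * rep q n Kk $$ (s, p))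
      = complex_of_real (rep_gen_entry q n GF r p * rep_gen_entry q n GK p p)"
  proof -
    have "(\<Sum>s<n + 1. complex_of_real (rep_gen_entry q n GF r s) * rep q n Kk $$ (s, p))
      = (\<Sum>s<n + 1. if s = p then complex_of_real (rep_gen_entry q n GF r p * rep_gen_entry q n GK p p) else 0)"
      using assms by (intro sum.cong) (auto simp: rep_entry_gen simp del: rep_gen_entry.simps(3,4))
    then show ?thesis using assms by simp
  qed
  have E: "(\<Sum>s<n + 1. complex_of_real (rep_gen_entry q n GKinv r s) * rep q n Ee $$ (s, p))
      = complex_of_real (rep_gen_entry q n GKinv r r * rep_gen_entry q n GE r p)"
  proof -
    have "(\<Sum>s<n + 1. complex_of_real (rep_gen_entry q n GKinv r s) * rep q n Ee $$ (s, p))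
      = (\<Sum>s<n + 1. if s = r then complex_of_real (rep_gen_entry q n GKinv r r * rep_gen_entry q n GE r p) else 0)"
      using assms by (intro sum.cong) (auto simp: rep_entry_gen simp del: rep_gen_entry.simps(3,4))
    then show ?thesis using assms by simp
  qed
  have 0: "rep_gen_entry q n GF (Suc p) p * rep_gen_entry q n GK p p = rep_gen_entry q n GE p (Suc p)"
    "rep_gen_entry q n GKinv p p * rep_gen_entry q n GE p (Suc p) = rep_gen_entry q n GF (Suc p) p" for p
  proof -
    have a: "- real n + real (Suc p) - 1 = - real n + real p"
      "real n - real (Suc p) + 1 = real n - real p" "- real (Suc p) = - real p - 1"
      "real n / 2 - real (Suc p) + 1 = real n / 2 - real p"
      by simp_all
    have b: "real (Suc p) = real p + 1" by simp
    define D where "D = 1 / q - q"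
    define S where "S = sqrt ((q powr (- real n + real p) - q powr (real n - real p))
           * (q powr (- real p - 1) - q powr (real p + 1)))"
    have F: "rep_gen_entry q n GF (Suc p) p = S * q powr (- real n / 2 + real p) / D"
      by (simp only: rep_gen_entry.simps S_def D_def Suc_eq_plus1 if_True refl)
    have "rep_gen_entry q n GE p (Suc p) = sqrt ((q powr (- real n + real (Suc p) - 1) - q powr (real n - real (Suc p) + 1))
           * (q powr (- real (Suc p)) - q powr (real (Suc p))))
     * q powr (real n / 2 - real (Suc p) + 1) / D"
      by (simp only: rep_gen_entry.simps D_def Suc_eq_plus1 if_True refl)
    also have "\<dots> = S * q powr (real n / 2 - real p) / D"
      unfolding a unfolding b S_def ..
    finally have E: "rep_gen_entry q n GE p (Suc p) = S * q powr (real n / 2 - real p) / D" .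
    have p1: "q powr (- real n / 2 + real p) * q powr (real n - 2 * real p) = q powr (real n / 2 - real p)"
      unfolding powr_add [symmetric] by (rule arg_cong[of _ _ "\<lambda>e. q powr e"]) (simp add: field_simps)
    have p2: "q powr (2 * real p - real n) * q powr (real n / 2 - real p) = q powr (- real n / 2 + real p)"
      unfolding powr_add [symmetric] by (rule arg_cong[of _ _ "\<lambda>e. q powr e"]) (simp add: field_simps)
    show "rep_gen_entry q n GF (Suc p) p * rep_gen_entry q n GK p p = rep_gen_entry q n GE p (Suc p)"
      unfolding E F p1 [symmetric] by simp
    show "rep_gen_entry q n GKinv p p * rep_gen_entry q n GE p (Suc p) = rep_gen_entry q n GF (Suc p) p"
      unfolding E F p2 [symmetric] by simp
  qed
  have 1: "rep_gen_entry q n GF r p * rep_gen_entry q n GK p p = rep_gen_entry q n GE p r"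
  proof (cases "r = Suc p")
    case True
    then show ?thesis using 0(1)[of p] by blast
  qed simp
  have 2: "rep_gen_entry q n GKinv r r * rep_gen_entry q n GE r p = rep_gen_entry q n GF p r"
  proof (cases "p = Suc r")
    case True
    then show ?thesis using 0(2)[of r] by blast
  qed simp
  show ?thesis
  proof (cases g)
    case GE
    then show ?thesis using assms 1 K by (simp only: starU_gen.simps rep_entry_gen_mult)
  next
    case GF
    then show ?thesis using assms 2 E by (simp only: starU_gen.simps rep_entry_gen_mult)
  qed (use assms in \<open>auto simp: rep_entry_gen\<close>)
qed

lemma rep_star:
  assumes "0 < q" "r < n + 1" "p < n + 1"
  shows "rep q n (starU x) $$ (r, p) = cnj (rep q n x $$ (p, r))"
  using assms(2,3)
proof (induction x arbitrary: r p rule: falg_induct_left)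
  case one
  then show ?case by (simp add: starU_hom rep_entry_one)
next
  case (add x y)
  then show ?case
    using linear_functionalD(1)[OF falgU_linear_entry[OF add.prems]]
      linear_functionalD(1)[OF falgU_linear_entry[OF add.prems(2,1)]]
    by (simp only: starU_hom complex_cnj_add)
next
  case (scale c x)
  have "starU (sc c * x) = sc (cnj c) * starU x"
    by (simp only: starU_hom sc_commute)
  then show ?case
    using scale linear_functionalD(2)[OF falgU_linear_entry[OF scale.prems]]
      linear_functionalD(2)[OF falgU_linear_entry[OF scale.prems(2,1)]]
    by (simp only: complex_cnj_mult)
next
  case (gen g x)
  have "rep q n (starU (gen g * x)) $$ (r, p)
    = (\<Sum>s<n + 1. rep q n (starU x) $$ (r, s) * rep q n (starU_gen g) $$ (s, p))"
    unfolding starU_hom rep_entry_mult[OF gen.prems] ..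
  also have "\<dots> = (\<Sum>s<n + 1. cnj (rep q n x $$ (s, r)) * complex_of_real (rep_gen_entry q n g p s))"
    using gen.prems assms(1)
    by (intro sum.cong) (simp_all only: gen.IH rep_gen_entry_star lessThan_iff)
  also have "\<dots> = cnj (rep q n (gen g * x) $$ (p, r))"
    unfolding rep_entry_gen_mult[OF gen.prems(2,1)]
    by (simp only: cnj_sum complex_cnj_mult complex_cnj_complex_of_real mult.commute)
  finally show ?case .
qed

section \<open>The pairing\<close>

lemma copU_hom:
  "copU (x + y) = copU x + copU y" "copU (x * y) = copU x * copU y" "copU (sc c) = sc c"
  "copU 1 = 1" "copU (gen g) = copU_gen g"
proof -
  show "copU (x * y) = copU x * copU y"
    unfolding copU_def by (rule free_hom_mult) (simp, simp add: sc_add, simp add: sc_mult, simp add: sc_commute)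
  show "copU 1 = 1" using free_hom_sc[of sc copU_gen 1] by (simp add: copU_def)
qed (simp_all add: copU_def free_hom_add sc_add free_hom_sc free_hom_gen)

lemma counU_hom:
  "counU (x + y) = counU x + counU y" "counU (x * y) = counU x * counU y" "counU (sc c) = c"
  "counU 1 = 1" "counU (gen g) = counU_gen g"
proof -
  show "counU (x * y) = counU x * counU y"
    unfolding counU_def by (rule free_hom_mult) simp_all
  show "counU 1 = 1" using free_hom_sc[of id counU_gen 1] by (simp add: counU_def)
qed (simp_all add: counU_def free_hom_add free_hom_sc free_hom_gen)

lemma counU_linear: "linear_functional counU"
  by (simp add: linear_functional_def counU_hom)

locale pairing =
  fixes q :: real and \<tau> :: "genA falg \<Rightarrow> genU falg \<Rightarrow> complex"
  assumes q01: "0 < q" "q < 1" and pairing: "hopf_pairing q \<tau>"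
begin

lemma q_gap: "1 / q - q > 0"
proof -
  have "q * q < 1 * 1" using q01 by (intro mult_strict_mono) simp_all
  then show ?thesis using q01 by (simp add: field_simps)
qed

lemma tau_linear_left: "linear_functional (\<lambda>a. \<tau> a x)"
  and tau_linear_right: "linear_functional (\<tau> a)"
proof -
  have "(\<forall>x. linear_functional (\<lambda>a. \<tau> a x)) \<and> (\<forall>a. linear_functional (\<tau> a))"
    using pairing unfolding hopf_pairing_def by (elim conjE) (intro conjI; assumption)
  then show "linear_functional (\<lambda>a. \<tau> a x)" "linear_functional (\<tau> a)" by simp_all
qed

lemma tau_ideal_U: "x \<in> ideal_U q \<Longrightarrow> \<tau> a x = 0"
  using pairing unfolding hopf_pairing_def by blast+

lemma tau_dualA: "(\<lambda>a. \<tau> a x) \<in> dualA q"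
proof -
  have "\<forall>a\<in>ideal_A q. \<forall>x. \<tau> a x = 0"
    using pairing unfolding hopf_pairing_def by blast
  then show ?thesis using tau_linear_left by (simp add: dualA_def)
qed

lemma tau_mult_left: "\<tau> (a * b) x = slice_both (\<tau> a) (\<tau> b) (copU x)"
  using pairing unfolding hopf_pairing_def by blast

lemma tau_mult_right: "\<tau> a (x * y) = conv (\<lambda>b. \<tau> b x) (\<lambda>b. \<tau> b y) a"
  using pairing unfolding hopf_pairing_def conv_def by blast

lemma tau_one: "\<tau> 1 x = counU x" "\<tau> a 1 = counA a"
  using pairing unfolding hopf_pairing_def by blast+

lemma tau_star_right: "\<tau> a (starU x) = cnj (\<tau> (starA q (antA q a)) x)"
  using pairing unfolding hopf_pairing_def by blast

lemma tau_nondegenerate: "(\<And>x. \<tau> a x = \<tau> b x) \<Longrightarrow> eqA q a b"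
proof -
  assume "\<And>x. \<tau> a x = \<tau> b x"
  then have "\<forall>x. \<tau> (a - b) x = 0"
    by (simp add: linear_functionalD(5)[OF tau_linear_left])
  then show ?thesis using pairing unfolding hopf_pairing_def eqA_def by blast
qed

lemma tau_eqA: "eqA q a b \<Longrightarrow> \<tau> a x = \<tau> b x"
  by (rule dualA_eqA[OF tau_dualA])

lemma tau_u: "\<tau> (u i j) x = rep q 1 x $$ (of_bool i, of_bool j)"
proof -
  have "\<tau> al x = rep q 1 x $$ (0, 0) \<and> \<tau> be x = rep q 1 x $$ (0, 1) \<and>
      \<tau> ga x = rep q 1 x $$ (1, 0) \<and> \<tau> de x = rep q 1 x $$ (1, 1)"
    using pairing unfolding hopf_pairing_def by blast
  then show ?thesis by (cases i; cases j) simp_all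
qed

lemma tau_slice: "\<tau> (slice_left (\<lambda>c. \<tau> c h) (copA b)) y = \<tau> b (h * y)"
  unfolding tau_mult_right by (rule conv_eval_left [symmetric]) (rule tau_linear_left)

lemma tau_u_gens:
  "\<tau> (u i j) Ee = (if \<not> i \<and> j then complex_of_real (q powr (1 / 2)) else 0)"
  "\<tau> (u i j) Ff = (if i \<and> \<not> j then complex_of_real (q powr (- 1 / 2)) else 0)"
  "\<tau> (u i j) Kk = (if i = j then (if i then 1 / q else q) else 0)"
proof -
  note d = q_gap
  have p: "q powr (- 1) = 1 / q" using q01 by (simp add: powr_minus_divide)
  have s: "sqrt ((1 / q - q) * (1 / q - q)) = 1 / q - q" using d by simp
  have e: "rep_gen_entry q 1 GE 0 (Suc 0) = q powr (1 / 2)"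
  proof -
    have "rep_gen_entry q 1 GE 0 (Suc 0) = sqrt ((q powr (- 1) - q powr 1) * (q powr (- 1) - q powr 1)) * q powr (1 / 2) / (1 / q - q)"
      by simp
    also have "\<dots> = q powr (1 / 2)" using d q01 unfolding p powr_one[OF less_imp_le[OF q01(1)]] s by simp
    finally show ?thesis .
  qed
  have f: "rep_gen_entry q 1 GF (Suc 0) 0 = q powr (- 1 / 2)"
  proof -
    have "rep_gen_entry q 1 GF (Suc 0) 0 = sqrt ((q powr (- 1) - q powr 1) * (q powr (- 1) - q powr 1)) * q powr (- 1 / 2) / (1 / q - q)"
      by simp
    also have "\<dots> = q powr (- 1 / 2)" using d q01 unfolding p powr_one[OF less_imp_le[OF q01(1)]] s by simp
    finally show ?thesis .
  qed
  have g: "\<tau> (u i j) (gen g) = complex_of_real (rep_gen_entry q 1 g (of_bool i) (of_bool j))" for g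
    unfolding tau_u by (rule rep_entry_gen) simp_all
  show "\<tau> (u i j) Ee = (if \<not> i \<and> j then complex_of_real (q powr (1 / 2)) else 0)"
  proof (cases "\<not> i \<and> j")
    case True
    then show ?thesis unfolding g using e by (simp del: rep_gen_entry.simps)
  next
    case False
    then have "of_bool i + 1 \<noteq> (of_bool j :: nat)" by auto
    then show ?thesis unfolding g using False by auto
  qed
  show "\<tau> (u i j) Ff = (if i \<and> \<not> j then complex_of_real (q powr (- 1 / 2)) else 0)"
  proof (cases "i \<and> \<not> j")
    case True
    then show ?thesis unfolding g using f by (simp del: rep_gen_entry.simps)
  next
    case False
    then have "of_bool i \<noteq> (of_bool j :: nat) + 1" by auto
    then show ?thesis unfolding g using False by auto
  qed
  show "\<tau> (u i j) Kk = (if i = j then (if i then 1 / q else q) else 0)"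
    unfolding g using q01 p by (cases i; cases j) simp_all
qed

end

section \<open>The Podles sphere and its annihilator\<close>

lemma conv_u:
  assumes "linear_functional f" "linear_functional g"
  shows "conv f g (u i j) = (\<Sum>k\<in>UNIV. f (u i k) * g (u k j))"
  using conv_left[OF assms, of i j 1]
  by (simp add: conv_one linear_functional_mult_left assms)

lemma conv_u_u:
  assumes "linear_functional f" "linear_functional g"
  shows "conv f g (u i j * u k l) = (\<Sum>s\<in>UNIV. \<Sum>r\<in>UNIV. f (u i s * u k r) * g (u s j * u r l))"
  by (simp add: conv_left conv_u linear_functional_mult_left assms)

lemma slice_both_diff:
  assumes "linear_functional \<chi>"
  shows "slice_both \<omega> \<chi> (z - z') = slice_both \<omega> \<chi> z - slice_both \<omega> \<chi> z'"
  using slice_both_add[OF assms, of \<omega> "z - z'" z'] by simp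

locale qsphere = pairing q \<tau> + sphere q a for q \<tau> a +
  fixes t :: real
  assumes t: "t = q powr a - q powr (- a)"
begin

definition iB :: "genU falg" where "iB = sc \<i> * Bt q t"

definition eigval :: "int \<Rightarrow> complex" where "eigval n = complex_of_real (qnum q (a + n))"

lemma q_diff: "q - 1 / q < 0" "complex_of_real q - 1 / complex_of_real q \<noteq> 0"
proof -
  show 1: "q - 1 / q < 0" using q_gap by simp
  have "complex_of_real (q - 1 / q) \<noteq> 0" using 1 by (simp only: of_real_eq_0_iff)
  then show "complex_of_real q - 1 / complex_of_real q \<noteq> 0" by simp
qed

lemma qnum_inj: "qnum q x = qnum q y \<Longrightarrow> x = y"
proof -
  assume *: "qnum q x = qnum q y"
  define X Y where "X = q powr x" and "Y = q powr y"
  have pos: "X > 0" "Y > 0" using q by (simp_all add: X_def Y_def)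
  have "q powr (- x) = 1 / X" "q powr (- y) = 1 / Y"
    using q by (simp_all add: X_def Y_def powr_minus_divide)
  then have "X - 1 / X = Y - 1 / Y"
    using * q_diff by (simp add: qnum_def X_def Y_def)
  then have "(X - Y) * (1 + X * Y) = 0" using pos by (simp add: field_simps)
  moreover have "1 + X * Y > 0" using pos by (simp add: add_pos_pos)
  ultimately have "X = Y" by auto
  then have "ln X = ln Y" by simp
  then show "x = y" using q by (simp add: X_def Y_def ln_powr)
qed

lemma eigval_inj: "eigval m = eigval n \<Longrightarrow> m = n"
  using qnum_inj[of "a + m" "a + n"] by (simp add: eigval_def)

lemma eigval_nu: "eigval n = \<i> * (nu n + 1 / nu n) / (q - 1 / q)"
proof -
  define X where "X = q powr (a + n)"
  have X: "X > 0" using q by (simp add: X_def)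
  have "q powr (- (a + n)) = 1 / X" using q by (simp only: X_def powr_minus_divide)
  then have 1: "eigval n = (complex_of_real X - 1 / complex_of_real X) / (q - 1 / q)"
    by (simp add: eigval_def qnum_def X_def)
  have n: "nu n = - \<i> * complex_of_real X" by (simp add: nu_def X_def)
  have "\<i> * (nu n + 1 / nu n) = complex_of_real X - 1 / complex_of_real X"
    unfolding n using X by (simp add: field_simps)
  then show ?thesis unfolding 1 by simp
qed

definition Nm :: "bool \<Rightarrow> bool \<Rightarrow> complex" where
  "Nm i j = (if i = j then 0 else if j then \<i> else - \<i>)"

definition Km :: "bool \<Rightarrow> bool \<Rightarrow> complex" where
  "Km i j = (if i = j then (if i then 1 / q else q) else 0)"

text \<open>This is the formula for the coproduct of \<open>B\<^sub>t\<close>: multiplied by \<open>i\<close>, its part \<open>q\<^bsup>-1/2\<^esup> (e - f k) \<otimes> 1\<close>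
  contributes \<open>Nm\<close> and its part \<open>k \<otimes> B\<^sub>t\<close> contributes \<open>Km\<close>.\<close>

lemma tau_iB_u: "\<tau> (u i j * x) iB = Nm i j * counA x + Km i j * \<tau> x iB"
proof -
  define c d where "c = complex_of_real (q powr (- 1 / 2))" and "d = \<i> * (1 / (q - 1 / q)) * t"
  define f g where "f = \<tau> (u i j)" and "g = \<tau> x"
  have f: "linear_functional f" and g: "linear_functional g"
    by (simp_all add: f_def g_def tau_linear_right)
  note F = linear_functionalD[OF f] and G = linear_functionalD[OF g]
  have B: "Bt q t = sc c * (Ee - Ff * Kk) - sc d * Kk"
    by (simp add: Bt_def c_def d_def)
  have "copU (Ee - Ff * Kk) + copU (Ff * Kk) = copU Ee"
    by (simp only: copU_hom(1) [symmetric] diff_add_cancel)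
  then have 1: "copU (Ee - Ff * Kk) = copU Ee - copU (Ff * Kk)" by (simp only: eq_diff_eq)
  have "copU (Bt q t) + copU (sc d * Kk) = copU (sc c * (Ee - Ff * Kk))"
    by (simp only: copU_hom(1) [symmetric] B diff_add_cancel)
  then have cB: "copU (Bt q t) = sc c * (copU Ee - copU (Ff * Kk)) - sc d * copU Kk"
    by (simp only: eq_diff_eq copU_hom(2,3) 1)
  have FK: "copU (Ff * Kk) = tens (Ff * Kk) (Ki * Kk) + tens Kk (Ff * Kk)"
    by (simp only: copU_hom copU_gen.simps distrib_right tens_mult mult_1_left)
  have "Ki * Kk - 1 \<in> ideal_U q" unfolding ideal_U_def
    by (rule ideal_gen_base) (simp add: rels_U_def)
  then have k: "g (Ki * Kk) = g 1"
    using tau_ideal_U[of "Ki * Kk - 1" x] G(5) by (simp add: g_def)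
  have g1: "g 1 = counA x" by (simp add: g_def tau_one)
  have sb: "slice_both f g (copU (Bt q t)) = c * (f Ee - f (Ff * Kk)) * g 1 + f Kk * g (Bt q t)"
    unfolding cB slice_both_diff[OF g] slice_both_scale[OF g] FK slice_both_add[OF g] slice_both_tens[OF f g] k
    unfolding B G copU_hom copU_gen.simps slice_both_add[OF g] slice_both_tens[OF f g]
    by (simp add: algebra_simps)
  have fFK: "f (Ff * Kk) = (\<Sum>k\<in>UNIV. \<tau> (u i k) Ff * \<tau> (u k j) Kk)"
    unfolding f_def tau_mult_right by (rule conv_u) (rule tau_linear_left)+
  have pw: "c * complex_of_real (q powr (1 / 2)) = 1" "c * (c * complex_of_real q) = 1"
  proof -
    have a: "q powr (- 1 / 2) * q powr (1 / 2) = 1" "q powr (- 1 / 2) * q powr (- 1 / 2) = 1 / q"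
      using q by (simp_all flip: powr_add add: powr_minus_divide)
    have "complex_of_real (q powr (- 1 / 2) * q powr (1 / 2)) = 1" unfolding a by simp
    then show "c * complex_of_real (q powr (1 / 2)) = 1" by (simp add: c_def)
    have "complex_of_real (q powr (- 1 / 2) * q powr (- 1 / 2)) = 1 / complex_of_real q"
      unfolding a by simp
    then have "c * c = 1 / complex_of_real q" by (simp add: c_def)
    then show "c * (c * complex_of_real q) = 1" by (simp add: mult.assoc [symmetric])
  qed
  have fFK': "f (Ff * Kk) = (if i \<and> \<not> j then c * q else 0)"
    unfolding fFK tau_u_gens sum_bool c_def by simp
  have fE: "f Ee = (if \<not> i \<and> j then complex_of_real (q powr (1 / 2)) else 0)"
    unfolding f_def tau_u_gens ..
  have N: "\<i> * (c * (f Ee - f (Ff * Kk))) = Nm i j"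
    unfolding fFK' fE using pw by (cases i; cases j; simp add: Nm_def)
  have K: "f Kk = Km i j" by (simp add: f_def tau_u_gens Km_def)
  have "\<tau> (u i j * x) iB = \<i> * slice_both f g (copU (Bt q t))"
    unfolding iB_def linear_functionalD(2)[OF tau_linear_right] tau_mult_left f_def g_def ..
  also have "\<dots> = (\<i> * (c * (f Ee - f (Ff * Kk)))) * g 1 + f Kk * (\<i> * g (Bt q t))"
    unfolding sb by (simp only: distrib_left mult.assoc mult.left_commute)
  also have "\<i> * g (Bt q t) = \<tau> x iB"
    unfolding iB_def linear_functionalD(2)[OF tau_linear_right] g_def ..
  finally show ?thesis by (simp only: N K g1)
qed

lemma counU_iB: "counU iB = eigval 0"
proof -
  have B: "Bt q t = sc (q powr (- 1 / 2)) * (Ee - Ff * Kk) - sc (\<i> * (1 / (q - 1 / q)) * t) * Kk"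
    by (simp add: Bt_def)
  have "counU iB = \<i> * - (\<i> * (1 / (q - 1 / q)) * t)"
    unfolding iB_def B counU_hom(2) linear_functionalD(5)[OF counU_linear]
    by (simp add: counU_hom)
  also have "\<dots> = complex_of_real (t / (q - 1 / q))" by simp
  also have "t / (q - 1 / q) = qnum q (a + of_int 0)" by (simp add: qnum_def t)
  finally have "counU iB = complex_of_real (qnum q (a + of_int 0))" .
  then show ?thesis by (simp only: eigval_def)
qed

text \<open>The spectral decomposition of the matrix \<open>Nm + [a + n] Km\<close>: the left hand side is the sum of its
  spectral projections weighted with the eigenvalues \<open>[a + n + 1]\<close> and \<open>[a + n - 1]\<close>.\<close>

lemma act_eigval: "act (ug i j) eigval n = Nm i j + Km i j * eigval n"
proof -
  define \<nu> Q e W where "\<nu> = nu n" and "Q = complex_of_real q" and "e = \<nu> * \<nu> - 1" and "W = Q * Q - 1"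
  have nz: "\<nu> \<noteq> 0" "Q \<noteq> 0" by (simp_all add: \<nu>_def Q_def)
  have e: "e \<noteq> 0" using imaginary_denominator(1)[OF nu_nz nu_cnj, of n] by (simp add: e_def \<nu>_def)
  have w: "complex_of_real (q - 1 / q) = W / Q" using nz by (simp add: W_def Q_def field_simps)
  have W: "W \<noteq> 0" using q_diff w nz by (auto simp: Q_def)
  have f0: "eigval n = \<i> * Q * (\<nu> * \<nu> + 1) / (\<nu> * W)"
    using nz W unfolding eigval_nu w \<nu>_def [symmetric] by (simp add: field_simps)
  have f1: "eigval (n + 1) = \<i> * (Q * Q * \<nu> * \<nu> + 1) / (\<nu> * W)"
    using nz W unfolding eigval_nu w nu_suc \<nu>_def [symmetric] Q_def [symmetric] by (simp add: field_simps)
  have f2: "eigval (n - 1) = \<i> * (\<nu> * \<nu> + Q * Q) / (\<nu> * W)"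
    using nz W unfolding eigval_nu w nu_pred \<nu>_def [symmetric] Q_def [symmetric] by (simp add: field_simps)
  note M = prj_values[OF nz(1) e_def [symmetric] e]
  show ?thesis unfolding act_def f0 f1 f2 \<nu>_def [symmetric]
    using nz e W
    by (cases i; cases j; simp add: M Nm_def Km_def del: prj.simps flip: Q_def; simp add: field_simps;
        simp add: e_def W_def algebra_simps)
qed

text \<open>Both sides satisfy the same recursion when a generator is split off on the left.\<close>

lemma tau_iB: "\<tau> x iB = om eigval x"
proof (induction x rule: falgA_induct_left)
  case one
  then show ?case by (simp add: tau_one counU_iB om_one)
next
  case (add x y)
  then show ?case
    by (simp add: linear_functionalD(1)[OF tau_linear_left] linear_functionalD(1)[OF om_linear])
next
  case (scale c x)
  then show ?case
    by (simp add: linear_functionalD(2)[OF tau_linear_left] linear_functionalD(2)[OF om_linear])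
next
  case (gen i j x)
  have "act (ug i j) eigval = (\<lambda>n. Nm i j * 1 + Km i j * eigval n)"
    by (simp add: fun_eq_iff act_eigval)
  then have "om eigval (u i j * x) = om (\<lambda>n. Nm i j * 1 + Km i j * eigval n) x"
    by (simp only: om_ract acts_gen)
  also have "\<dots> = Nm i j * counA x + Km i j * om eigval x"
    by (simp only: om_fun_linear om_counA)
  finally show ?case by (simp only: tau_iB_u gen)
qed

subsection \<open>Membership in the Podles sphere\<close>

text \<open>By non-degeneracy the invariance of \<open>b\<close> may be tested against \<open>U\<close>, where the coproduct of \<open>A\<close>
  becomes the product of \<open>U\<close>.\<close>

lemma podles_iff:
  "b \<in> podles q \<tau> t \<longleftrightarrow> (\<forall>h\<in>coideal_I q t. \<forall>y. \<tau> b (h * y) = counU h * \<tau> b y)"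
proof -
  have "eqA q (slice_left (\<lambda>c. \<tau> c h) (copA b)) (sc (counU h) * b)
      \<longleftrightarrow> (\<forall>y. \<tau> b (h * y) = counU h * \<tau> b y)" for h
  proof
    assume *: "eqA q (slice_left (\<lambda>c. \<tau> c h) (copA b)) (sc (counU h) * b)"
    show "\<forall>y. \<tau> b (h * y) = counU h * \<tau> b y"
    proof
      fix y
      show "\<tau> b (h * y) = counU h * \<tau> b y"
        using tau_eqA[OF *, of y] unfolding tau_slice linear_functionalD(2)[OF tau_linear_left] .
    qed
  next
    assume *: "\<forall>y. \<tau> b (h * y) = counU h * \<tau> b y"
    show "eqA q (slice_left (\<lambda>c. \<tau> c h) (copA b)) (sc (counU h) * b)"
      by (rule tau_nondegenerate)
        (simp only: tau_slice linear_functionalD(2)[OF tau_linear_left] *[rule_format])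
  qed
  then show ?thesis by (simp add: podles_def)
qed

lemma iB_coideal: "iB \<in> coideal_I q t"
  unfolding iB_def coideal_I_def by (intro subalgebra_gen.intros) simp

text \<open>Invariance is multiplicative in \<open>h\<close>, and the coideal is generated by \<open>i B\<^sub>t\<close>, whose counit is \<open>[a]\<close>.\<close>

lemma podles_I:
  assumes "\<And>y. \<tau> b (iB * y) = eigval 0 * \<tau> b y"
  shows "b \<in> podles q \<tau> t"
proof -
  note L = linear_functionalD[OF tau_linear_right]
  have B: "Bt q t = sc (- \<i>) * iB" by (simp add: iB_def sc_mult_assoc)
  have "\<forall>y. \<tau> b (h * y) = counU h * \<tau> b y" if "h \<in> coideal_I q t" for h
    using that unfolding coideal_I_def
  proof (induction rule: subalgebra_gen.induct)
    case (scalar c)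
    then show ?case by (simp add: L counU_hom)
  next
    case (base x)
    then have x: "x = sc (- \<i>) * iB" by (simp add: B)
    show ?case unfolding x mult.assoc L(2) counU_hom(2) counU_hom(3) counU_iB using assms by simp
  next
    case (add x y)
    then show ?case by (simp add: distrib_right L counU_hom)
  next
    case (mult x y)
    then show ?case by (simp add: mult.assoc counU_hom)
  qed
  then show ?thesis by (simp add: podles_iff)
qed

text \<open>Multiplying \<open>f\<close> by \<open>n \<mapsto> [a + n]\<close> is convolution with \<open>i B\<^sub>t\<close>, which on an element of the sphere
  acts by the scalar \<open>[a]\<close>.  So \<open>om\<close> kills \<open>b\<close> for every function in the range of multiplication by
  \<open>[a + n] - [a]\<close>; as the eigenvalues are distinct, these are the functions that vanish at 0.\<close>

lemma om_podles:
  assumes "b \<in> podles q \<tau> t"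
  shows "om f b = f 0 * counA b"
proof -
  have e: "eqA q (slice_left (\<lambda>c. \<tau> c iB) (copA b)) (sc (eigval 0) * b)"
    using assms iB_coideal counU_iB by (auto simp: podles_def)
  have z: "om (\<lambda>n. eigval n * g n) b = eigval 0 * om g b" for g
  proof -
    have "om (\<lambda>n. eigval n * g n) b = conv (om eigval) (om g) b" by (simp only: om_conv)
    also have "\<dots> = om g (slice_left (om eigval) (copA b))" by (rule conv_eval_left) (rule om_linear)
    also have "om eigval = (\<lambda>c. \<tau> c iB)" by (simp add: fun_eq_iff tau_iB)
    also have "om g (slice_left (\<lambda>c. \<tau> c iB) (copA b)) = om g (sc (eigval 0) * b)"
      by (rule dualA_eqA[OF om_dualA e])
    finally show ?thesis by (simp only: linear_functionalD(2)[OF om_linear])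
  qed
  \<comment> \<open>the quotient is 0 at \<open>n = 0\<close>, where numerator and denominator vanish\<close>
  define g where "g n = (f n - f 0) / (eigval n - eigval 0)" for n
  have "f = (\<lambda>n. (eigval n * g n + - eigval 0 * g n) + f 0 * 1)"
  proof
    fix n
    have "eigval n * g n + - eigval 0 * g n = (eigval n - eigval 0) * g n" by (simp add: algebra_simps)
    also have "\<dots> = f n - f 0"
      using eigval_inj[of n 0] by (cases "n = 0") (auto simp: g_def)
    finally show "f n = (eigval n * g n + - eigval 0 * g n) + f 0 * 1" by simp
  qed
  then have "om f b = om (\<lambda>n. (eigval n * g n + - eigval 0 * g n) + f 0 * 1) b" by (rule arg_cong)
  also have "\<dots> = (om (\<lambda>n. eigval n * g n) b + - eigval 0 * om g b) + f 0 * counA b"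
    by (simp only: om_fun_linear om_counA)
  finally show ?thesis by (simp add: z)
qed

lemma om_dualC: "om f \<in> dualC q \<tau> t"
proof -
  have "om f x = 0" if "x \<in> left_ideal_AB q \<tau> t" for x
  proof -
    from that obtain n :: nat and c b where b: "\<And>i. i < n \<Longrightarrow> b i \<in> podles_plus q \<tau> t"
      and x: "x = (\<Sum>i<n. c i * b i)" unfolding left_ideal_AB_def by blast
    have "om f (c i * b i) = 0" if "i < n" for i
      using b[OF that] by (simp add: om_ract om_podles podles_plus_def)
    then show ?thesis unfolding x linear_functional_sum[OF om_linear] by simp
  qed
  then show ?thesis by (simp add: dualC_def om_dualA)
qed

text \<open>Subtracting its counit from an element of \<open>B\<close> leaves an element of \<open>B\<^sub>+\<close>.\<close>

lemma dualC_podles: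
  assumes "\<omega> \<in> dualC q \<tau> t" "b \<in> podles q \<tau> t"
  shows "\<omega> (c * b) = counA b * \<omega> c"
proof -
  note C = linear_functionalD[OF linear_functional_counA]
  have w: "linear_functional \<omega>" using assms by (simp add: dualC_def dualA_def)
  define b' where "b' = b - sc (counA b)"
  have "b' \<in> podles q \<tau> t"
    unfolding podles_iff
  proof (intro ballI allI)
    fix h y assume h: "h \<in> coideal_I q t"
    have b: "\<tau> b (h * y) = counU h * \<tau> b y" using assms(2) h by (simp add: podles_iff)
    show "\<tau> b' (h * y) = counU h * \<tau> b' y"
      unfolding b'_def linear_functionalD(5)[OF tau_linear_left] linear_functionalD(6)[OF tau_linear_left] b tau_one
      by (simp add: counU_hom algebra_simps)
  qed
  moreover have "counA b' = 0" unfolding b'_def C(5) by (simp add: counA_hom)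
  ultimately have p: "b' \<in> podles_plus q \<tau> t" by (simp add: podles_plus_def)
  have "c * b' \<in> left_ideal_AB q \<tau> t"
    unfolding left_ideal_AB_def mem_Collect_eq
    by (rule exI[of _ "1::nat"], rule exI[of _ "\<lambda>_. c"], rule exI[of _ "\<lambda>_. b'"]) (simp add: p)
  then have "\<omega> (c * b') = 0" using assms(1) by (simp add: dualC_def)
  then show ?thesis
    by (simp add: b'_def right_diff_distrib linear_functionalD[OF w])
qed

text \<open>The row vector \<open>(\<mu>, 1)\<close> applied to the columns of \<open>u\<close>.  For \<open>\<mu> = \<nu>\<close> and \<open>\<mu> = 1 / \<nu>\<close> this row is a
  left eigenvector of the matrix \<open>Nm + [a + n] Km\<close>, for \<open>[a + n + 1]\<close> and \<open>[a + n - 1]\<close>.\<close>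

definition row_elt :: "complex \<Rightarrow> bool \<Rightarrow> genA falg" where
  "row_elt \<mu> j = sc \<mu> * u False j + u True j"

text \<open>The right factor moves the eigenvalue \<open>[a]\<close> to a neighbour and the left factor moves it back, so
  the product is an eigenvector of \<open>i B\<^sub>t\<close> for \<open>[a]\<close>.  The two choices \<open>\<nu> = - i q\<^bsup>a\<^esup>\<close> and its inverse
  correspond to the two neighbours.\<close>

lemma row_product_podles:
  fixes \<nu> :: complex
  assumes nu: "\<nu> \<noteq> 0" and l: "eigval 0 = \<i> * (\<nu> + 1 / \<nu>) / (q - 1 / q)"
  shows "row_elt (1 / (q * \<nu>)) j * row_elt \<nu> k \<in> podles q \<tau> t"
proof (rule podles_I)
  fix y
  define f g where "f = (\<lambda>c. \<tau> c iB)" and "g = (\<lambda>c. \<tau> c y)"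
  have f: "linear_functional f" and g: "linear_functional g"
    by (simp_all only: f_def g_def tau_linear_left)
  note G = linear_functionalD[OF g]
  define Q lam where "Q = complex_of_real q" and "lam = eigval 0"
  have Q: "Q \<noteq> 0" by (simp add: Q_def)
  have W: "Q * Q - 1 \<noteq> 0" using q_diff Q by (auto simp: Q_def field_simps)
  have "complex_of_real (q - 1 / q) = (Q * Q - 1) / Q" using Q by (simp add: Q_def field_simps)
  then have lam': "lam * (\<nu> * (Q * Q - 1)) = \<i> * Q * (\<nu> * \<nu> + 1)"
    using nu Q W unfolding lam_def l \<open>complex_of_real (q - 1 / q) = (Q * Q - 1) / Q\<close>
    by (simp add: field_simps)
  define c where "c i k' = (if i then 1 else 1 / (Q * \<nu>)) * (if k' then 1 else \<nu>)" for i k' :: bool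
  define b where "b = row_elt (1 / (q * \<nu>)) j * row_elt \<nu> k"
  have b: "b = sc (c False False) * (u False j * u False k) + sc (c False True) * (u False j * u True k)
      + (sc (c True False) * (u True j * u False k) + sc (c True True) * (u True j * u True k))"
    by (simp add: b_def row_elt_def c_def Q_def [symmetric] distrib_left distrib_right mult.assoc
        sc_mult_assoc sc_left_commute[of "gen z" for z] nu Q)
  have fuu: "f (u i s * u k' r) = Nm i s * (if k' = r then 1 else 0) + Km i s * (Nm k' r + Km k' r * lam)" for i s k' r
  proof -
    have "f (u k' r) = Nm k' r + Km k' r * lam"
      using tau_iB_u[of k' r 1] by (simp add: f_def counA_hom tau_one counU_iB lam_def)
    then show ?thesis using tau_iB_u[of i s "u k' r"] by (simp add: f_def counA_hom)
  qed
  \<comment> \<open>\<open>c\<close> is a left eigenvector of the matrix of \<open>i B\<^sub>t\<close> on the tensor square of \<open>V\<^bsub>1/2\<^esub>\<close>\<close>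
  have eig: "(\<Sum>i\<in>UNIV. \<Sum>k'\<in>UNIV. c i k' * f (u i s * u k' r)) = lam * c s r" for s r
  proof -
    have "lam = \<i> * Q * (\<nu> * \<nu> + 1) / (\<nu> * (Q * Q - 1))"
      using lam' nu W by (simp add: field_simps)
    then show ?thesis unfolding fuu sum_bool c_def
      using nu Q W by (cases s; cases r; simp add: Nm_def Km_def flip: Q_def; simp add: field_simps)
  qed
  have "\<tau> b (iB * y) = conv f g b" by (simp only: tau_mult_right f_def g_def)
  also have "\<dots> = (\<Sum>s\<in>UNIV. \<Sum>r\<in>UNIV. (\<Sum>i\<in>UNIV. \<Sum>k'\<in>UNIV. c i k' * f (u i s * u k' r)) * g (u s j * u r k))"
    unfolding b conv_add[OF g] conv_scale[OF g] conv_u_u[OF f g] sum_bool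
    by (simp only: algebra_simps)
  also have "\<dots> = lam * (\<Sum>s\<in>UNIV. \<Sum>r\<in>UNIV. c s r * g (u s j * u r k))"
    unfolding eig by (simp only: sum_distrib_left mult.assoc)
  also have "\<dots> = lam * g b"
    unfolding b G sum_bool by (simp only: add.assoc)
  finally show "\<tau> (row_elt (1 / (q * \<nu>)) j * row_elt \<nu> k) (iB * y) = eigval 0 * \<tau> (row_elt (1 / (q * \<nu>)) j * row_elt \<nu> k) y"
    by (simp only: b_def g_def lam_def)
qed

subsection \<open>Ladder elements\<close>

text \<open>Relations between row elements at neighbouring parameters: the first is the q-commutation of the
  two columns; the next two compare stepping up and then down with stepping down and then up, the
  difference being a multiple of the quantum determinant; the last one recovers an element from
  its products with the two entries of a row, again by the quantum determinant.\<close>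

lemma row_identities:
  fixes \<omega> :: "genA falg \<Rightarrow> complex" and n :: complex
  assumes w: "\<omega> \<in> dualA q" and n: "n \<noteq> 0"
  shows "\<omega> (c * (row_elt (q * n) False * (row_elt n True * z))) = q * \<omega> (c * (row_elt (q * n) True * (row_elt n False * z)))"
    and "\<omega> (c * (row_elt (1 / (q * n)) True * (row_elt n False * z)))
      = \<omega> (c * (row_elt (n / q) True * (row_elt (1 / n) False * z))) + (n - 1 / n) * \<omega> (c * z)"
    and "\<omega> (c * (row_elt (1 / (q * n)) False * (row_elt n True * z)))
      = \<omega> (c * (row_elt (n / q) False * (row_elt (1 / n) True * z))) - (n - 1 / n) / q * \<omega> (c * z)"
    and "\<omega> (c * al * (row_elt (1 / (q * n)) True * row_elt n j)) - q * \<omega> (c * be * (row_elt (1 / (q * n)) False * row_elt n j))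
      = \<omega> (c * row_elt n j)"
proof -
  have lin: "linear_functional \<omega>" using w by (rule dualA_linear)
  note L = linear_functionalD[OF lin]
  note R = dualA_rules[OF w]
  have Q: "complex_of_real q \<noteq> 0" by simp
  define Q where "Q = complex_of_real q"
  have Q0: "Q \<noteq> 0" by (simp add: Q_def)
  note E = row_elt_def ug.simps distrib_left distrib_right mult.assoc L sc_left_commute[of "gen g" for g]
  note R' = R(1-3) R(4,5)[OF q_nz] R(6,7)
  show "\<omega> (c * (row_elt (q * n) False * (row_elt n True * z))) = q * \<omega> (c * (row_elt (q * n) True * (row_elt n False * z)))"
    by (simp add: E R' flip: Q_def; use Q0 n in \<open>simp add: field_simps\<close>)
  show "\<omega> (c * (row_elt (1 / (q * n)) True * (row_elt n False * z)))
      = \<omega> (c * (row_elt (n / q) True * (row_elt (1 / n) False * z))) + (n - 1 / n) * \<omega> (c * z)"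
    by (simp add: E R' flip: Q_def; use Q0 n in \<open>simp add: field_simps\<close>)
  show "\<omega> (c * (row_elt (1 / (q * n)) False * (row_elt n True * z)))
      = \<omega> (c * (row_elt (n / q) False * (row_elt (1 / n) True * z))) - (n - 1 / n) / q * \<omega> (c * z)"
    by (simp add: E R' flip: Q_def; use Q0 n in \<open>simp add: field_simps\<close>)
  have R1: "\<omega> (c * (al * (be * row_elt n j))) = Q * \<omega> (c * (be * (al * row_elt n j)))"
    "\<omega> (c * (al * (de * row_elt n j))) = Q * \<omega> (c * (be * (ga * row_elt n j))) + \<omega> (c * row_elt n j)"
    using R by (simp_all add: Q_def)
  show "\<omega> (c * al * (row_elt (1 / (q * n)) True * row_elt n j)) - q * \<omega> (c * be * (row_elt (1 / (q * n)) False * row_elt n j))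
      = \<omega> (c * row_elt n j)"
    unfolding row_elt_def[of "1 / (complex_of_real q * n)"] unfolding Q_def [symmetric]
    by (simp add: ug.simps distrib_left distrib_right mult.assoc L sc_left_commute[of "gen g" for g] R1;
        use Q0 n in \<open>simp add: field_simps\<close>)
qed

text \<open>The second entries of the rows are used since their counit is 1.\<close>

primrec chain :: "complex \<Rightarrow> nat \<Rightarrow> genA falg" where
  "chain \<nu> 0 = 1"
| "chain \<nu> (Suc k) = row_elt (\<nu> * q ^ k) True * chain \<nu> k"

text \<open>Modulo \<open>A B\<^sub>+\<close>, either entry of the row of the next or the previous step turns a chain into its
  neighbour, multiplied with the counit of the entry.  The first step down is membership of \<open>row_product_podles\<close> in the sphere, and inverting the row
  gives the first step up.  Later steps follow by induction: up by q-commutation, down by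
  exchanging the order of a step up and a step down.\<close>

lemma chain_relations:
  fixes \<omega> :: "genA falg \<Rightarrow> complex" and \<nu> :: complex
  assumes w: "\<omega> \<in> dualC q \<tau> t" and nz: "\<nu> \<noteq> 0"
    and l: "eigval 0 = \<i> * (\<nu> + 1 / \<nu>) / (q - 1 / q)"
  shows chain_up: "\<omega> (c * (row_elt (\<nu> * q ^ k) False * chain \<nu> k)) = \<nu> * q ^ k * \<omega> (c * chain \<nu> (Suc k))"
    and chain_down: "\<omega> (c * (row_elt (1 / (\<nu> * q ^ Suc k)) j * chain \<nu> (Suc k)))
        = (if j then 1 else 1 / (\<nu> * q ^ Suc k)) * \<omega> (c * chain \<nu> k)"
proof -
  have wA: "\<omega> \<in> dualA q" using w by (simp add: dualC_def)
  note L = linear_functionalD[OF dualA_linear[OF wA]]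
  define Q where "Q = complex_of_real q"
  have Q: "Q \<noteq> 0" by (simp add: Q_def)
  have row_counit: "counA (row_elt \<mu> j) = (if j then 1 else \<mu>)" for \<mu> j
    by (cases j; simp add: row_elt_def counA_hom del: ug.simps)
  have base: "\<omega> (c * (row_elt (1 / (q * \<nu>)) i * row_elt \<nu> j)) = (if i then 1 else 1 / (q * \<nu>)) * (if j then 1 else \<nu>) * \<omega> c" for c i j
    using dualC_podles[OF w row_product_podles[OF nz l]] by (simp add: counA_hom(2) row_counit)
  have up0: "\<omega> (c * row_elt \<nu> False) = \<nu> * \<omega> (c * row_elt \<nu> True)" for c
  proof -
    have "\<omega> (c * row_elt \<nu> j) = (if j then 1 else \<nu>) * (\<omega> (c * al) - \<omega> (c * be) / \<nu>)" for j
      using row_identities(4)[OF wA nz, of c j] nz unfolding base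
      by (cases j) (simp_all only: if_True if_False, simp_all add: field_simps)
    then show ?thesis by simp
  qed
  have up: "\<omega> (c * (row_elt (\<nu> * Q ^ k) False * chain \<nu> k)) = \<nu> * Q ^ k * \<omega> (c * (row_elt (\<nu> * Q ^ k) True * chain \<nu> k))" for c k
  proof (induction k arbitrary: c)
    case 0
    then show ?case using up0 by simp
  next
    case (Suc k)
    define n where "n = \<nu> * Q ^ k"
    have n: "n \<noteq> 0" using nz Q by (simp add: n_def)
    have s: "\<nu> * Q ^ Suc k = Q * n" by (simp add: n_def)
    have ch: "chain \<nu> (Suc k) = row_elt n True * chain \<nu> k" by (simp add: n_def Q_def)
    have "\<omega> (c * (row_elt (Q * n) False * (row_elt n True * chain \<nu> k)))
        = Q * \<omega> ((c * row_elt (Q * n) True) * (row_elt n False * chain \<nu> k))"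
      using row_identities(1)[OF wA n, of c "chain \<nu> k"] by (simp only: Q_def mult.assoc)
    also have "\<dots> = Q * (n * \<omega> ((c * row_elt (Q * n) True) * (row_elt n True * chain \<nu> k)))"
      using Suc.IH by (simp only: n_def)
    finally show ?case unfolding s ch by (simp only: mult.assoc)
  qed
  show "\<omega> (c * (row_elt (\<nu> * q ^ k) False * chain \<nu> k)) = \<nu> * q ^ k * \<omega> (c * chain \<nu> (Suc k))"
    using up[of c k] by (simp only: chain.simps Q_def of_real_power)
  have down: "\<omega> (c * (row_elt (1 / (\<nu> * Q ^ Suc k)) j * chain \<nu> (Suc k)))
        = (if j then 1 else 1 / (\<nu> * Q ^ Suc k)) * \<omega> (c * chain \<nu> k)" for c j k
  proof (induction k arbitrary: c j)
    case 0
    show ?case using base[of c j True] by (simp add: Q_def mult.commute)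
  next
    case (Suc k)
    define n where "n = \<nu> * Q ^ Suc k"
    have n: "n \<noteq> 0" using nz Q by (simp add: n_def)
    have s: "\<nu> * Q ^ Suc (Suc k) = Q * n" by (simp add: n_def)
    have nQ: "n / Q = \<nu> * Q ^ k" using Q by (simp add: n_def)
    define Z where "Z = chain \<nu> (Suc k)"
    have ch: "chain \<nu> (Suc (Suc k)) = row_elt n True * Z" by (simp add: n_def Q_def Z_def)
    have Z: "Z = row_elt (n / Q) True * chain \<nu> k" unfolding nQ by (simp add: Z_def Q_def)
    have IH: "\<omega> (c * (row_elt (1 / n) j * Z)) = (if j then 1 else 1 / n) * \<omega> (c * chain \<nu> k)" for c j
      using Suc.IH by (simp only: n_def Z_def)
    have upn: "\<omega> (c * (row_elt n False * Z)) = n * \<omega> (c * (row_elt n True * Z))" for c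
      using up[of c "Suc k"] by (simp only: n_def Z_def)
    have upk: "\<omega> (c * (row_elt (n / Q) False * chain \<nu> k)) = n / Q * \<omega> (c * Z)" for c
      using up[of c k] unfolding Z nQ .
    show ?case
    proof (cases j)
      case True
      have "n * \<omega> (c * (row_elt (1 / (Q * n)) True * (row_elt n True * Z)))
          = n * \<omega> ((c * row_elt (1 / (Q * n)) True) * (row_elt n True * Z))"
        by (simp only: mult.assoc)
      also have "\<dots> = \<omega> ((c * row_elt (1 / (Q * n)) True) * (row_elt n False * Z))"
        by (rule upn [symmetric])
      also have "\<dots> = \<omega> ((c * row_elt (n / Q) True) * (row_elt (1 / n) False * Z)) + (n - 1 / n) * \<omega> (c * Z)"
        using row_identities(2)[OF wA n, of c Z] by (simp only: Q_def mult.assoc)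
      also have "\<omega> ((c * row_elt (n / Q) True) * (row_elt (1 / n) False * Z)) = 1 / n * \<omega> (c * Z)"
        unfolding IH using Z by (simp only: mult.assoc if_False)
      also have "1 / n * \<omega> (c * Z) + (n - 1 / n) * \<omega> (c * Z) = n * \<omega> (c * Z)"
        by (simp only: distrib_right [symmetric]) simp
      finally have "\<omega> (c * (row_elt (1 / (Q * n)) True * (row_elt n True * Z))) = \<omega> (c * Z)" using n by simp
      then show ?thesis unfolding s ch Z_def using True by simp
    next
      case False
      have "\<omega> (c * (row_elt (1 / (Q * n)) False * (row_elt n True * Z)))
          = \<omega> ((c * row_elt (n / Q) False) * (row_elt (1 / n) True * Z)) - (n - 1 / n) / Q * \<omega> (c * Z)"
        using row_identities(3)[OF wA n, of c Z] by (simp only: Q_def mult.assoc)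
      also have "\<omega> ((c * row_elt (n / Q) False) * (row_elt (1 / n) True * Z)) = n / Q * \<omega> (c * Z)"
        unfolding IH using upk by (simp only: mult.assoc if_True mult_1_left)
      also have "n / Q * \<omega> (c * Z) - (n - 1 / n) / Q * \<omega> (c * Z) = 1 / (Q * n) * \<omega> (c * Z)"
        using n Q by (simp add: field_simps)
      finally show ?thesis unfolding s ch Z_def using False by simp
    qed
  qed
  show "\<omega> (c * (row_elt (1 / (\<nu> * q ^ Suc k)) j * chain \<nu> (Suc k)))
        = (if j then 1 else 1 / (\<nu> * q ^ Suc k)) * \<omega> (c * chain \<nu> k)"
    using down[where c = c and j = j and k = k] by (simp only: Q_def of_real_power)
qed

text \<open>Chains started at \<open>- i q\<^bsup>a\<^esup>\<close> climb to positive \<open>n\<close>, those started at its inverse descend to negative \<open>n\<close>.\<close>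

definition ladder :: "int \<Rightarrow> genA falg" where
  "ladder n = (if 0 \<le> n then chain (nu 0) (nat n) else chain (1 / nu 0) (nat (- n)))"

lemma ladder_0: "ladder 0 = 1" by (simp add: ladder_def)

lemma ladder_nonneg: "ladder (int k) = chain (nu 0) k" by (simp add: ladder_def)
lemma ladder_nonpos: "ladder (- int k) = chain (1 / nu 0) k" by (cases "k = 0") (simp_all add: ladder_def)

lemma nu_nonneg: "nu (int k) = nu 0 * q ^ k"
  by (induction k) (simp_all add: nu_suc add.commute[of 1])

lemma nu_nonpos: "1 / nu (- int k) = 1 / nu 0 * q ^ k"
proof (induction k)
  case (Suc k)
  have "- int (Suc k) = - int k - 1" by simp
  then have "1 / nu (- int (Suc k)) = q * (1 / nu (- int k))"
    by (simp only: nu_pred) simp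
  then show ?case unfolding Suc by simp
qed simp

text \<open>A step down in one chain is, with \<open>\<nu>\<close> inverted, a step up in the other; both chains satisfy the
  same two relations, glued at \<open>n = 0\<close>.\<close>

lemma ladder_relations:
  assumes w: "\<omega> \<in> dualC q \<tau> t"
  shows "\<omega> (c * (row_elt (nu n) j * ladder n)) = (if j then 1 else nu n) * \<omega> (c * ladder (n + 1))"
    and "\<omega> (c * (row_elt (1 / nu n) j * ladder n)) = (if j then 1 else 1 / nu n) * \<omega> (c * ladder (n - 1))"
proof -
  have nz: "nu 0 \<noteq> 0" "1 / nu 0 \<noteq> 0" by simp_all
  have l: "eigval 0 = \<i> * (nu 0 + 1 / nu 0) / (q - 1 / q)" by (rule eigval_nu)
  have l': "eigval 0 = \<i> * (1 / nu 0 + 1 / (1 / nu 0)) / (q - 1 / q)" unfolding l by (simp add: add.commute)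
  note u = chain_relations[OF w nz(1) l] and d = chain_relations[OF w nz(2) l']
  have U: "\<omega> (c * (row_elt (nu (int k)) j * ladder (int k))) = (if j then 1 else nu (int k)) * \<omega> (c * ladder (int k + 1))" for k j
  proof -
    have "int k + 1 = int (Suc k)" by simp
    then show ?thesis using u(1)[of c k]
      by (cases j) (simp_all only: ladder_nonneg nu_nonneg if_True if_False chain.simps mult_1_left)
  qed
  have D: "\<omega> (c * (row_elt (1 / nu (- int k)) j * ladder (- int k))) = (if j then 1 else 1 / nu (- int k)) * \<omega> (c * ladder (- int k - 1))" for k j
  proof -
    have "- int k - 1 = - int (Suc k)" by simp
    then show ?thesis using d(1)[of c k]
      by (cases j) (simp_all only: ladder_nonpos nu_nonpos if_True if_False chain.simps mult_1_left)
  qed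
  have U': "\<omega> (c * (row_elt (1 / nu (int (Suc k))) j * ladder (int (Suc k))))
      = (if j then 1 else 1 / nu (int (Suc k))) * \<omega> (c * ladder (int (Suc k) - 1))" for k j
  proof -
    have "int (Suc k) - 1 = int k" by simp
    then show ?thesis using u(2)[of c k j] by (simp only: ladder_nonneg nu_nonneg)
  qed
  have D': "\<omega> (c * (row_elt (nu (- int (Suc k))) j * ladder (- int (Suc k))))
      = (if j then 1 else nu (- int (Suc k))) * \<omega> (c * ladder (- int (Suc k) + 1))" for k j
  proof -
    have e: "- int (Suc k) + 1 = - int k" by simp
    have i: "1 / (1 / y) = y" for y :: complex by simp
    have "1 / (1 / nu 0 * complex_of_real (q ^ Suc k)) = nu (- int (Suc k))"
      unfolding nu_nonpos [symmetric] by (rule i)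
    then show ?thesis using d(2)[of c k j] unfolding e by (simp only: ladder_nonpos)
  qed
  show "\<omega> (c * (row_elt (nu n) j * ladder n)) = (if j then 1 else nu n) * \<omega> (c * ladder (n + 1))"
  proof (cases "0 \<le> n")
    case True
    then show ?thesis using U[of "nat n" j] by simp
  next
    case False
    then have "n = - int (Suc (nat (- n - 1)))" by simp
    then show ?thesis using D'[of "nat (- n - 1)" j] by (simp only:)
  qed
  show "\<omega> (c * (row_elt (1 / nu n) j * ladder n)) = (if j then 1 else 1 / nu n) * \<omega> (c * ladder (n - 1))"
  proof (cases "n \<le> 0")
    case True
    then show ?thesis using D[of "nat (- n)" j] by simp
  next
    case False
    then have "n = int (Suc (nat (n - 1)))" by simp
    then show ?thesis using U'[of "nat (n - 1)" j] by (simp only:)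
  qed
qed

text \<open>The products of the rows \<open>(\<nu>, 1)\<close> and \<open>(1 / \<nu>, 1)\<close> with \<open>u\<close> are known by \<open>ladder_relations\<close>; since the
  two rows are independent, this determines \<open>u\<close> itself, and solving the linear system produces the
  projections.\<close>

lemma ladder_module:
  assumes w: "\<omega> \<in> dualC q \<tau> t"
  shows "\<omega> (c * (u i j * ladder n)) = prj (nu n) (ug i j) * \<omega> (c * ladder (n + 1)) + prj (1 / nu n) (ug i j) * \<omega> (c * ladder (n - 1))"
proof -
  have "linear_functional \<omega>" using w by (simp add: dualC_def dualA_def)
  note L = linear_functionalD[OF this]
  define \<nu> e where "\<nu> = nu n" and "e = \<nu> * \<nu> - 1"
  have nz: "\<nu> \<noteq> 0" by (simp add: \<nu>_def)
  have e: "e \<noteq> 0" using imaginary_denominator(1)[OF nu_nz nu_cnj, of n] by (simp add: e_def \<nu>_def)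
  define F G where "F j = \<omega> (c * (u False j * ladder n))" and "G j = \<omega> (c * (u True j * ladder n))" for j
  have r: "\<omega> (c * (row_elt \<mu> j * ladder n)) = \<mu> * F j + G j" for \<mu> j
    by (simp only: row_elt_def distrib_left distrib_right mult.assoc L F_def G_def)
  have 1: "\<nu> * F j + G j = (if j then 1 else \<nu>) * \<omega> (c * ladder (n + 1))" for j
    using ladder_relations(1)[OF w, of c n j] by (simp only: r \<nu>_def)
  have 2: "1 / \<nu> * F j + G j = (if j then 1 else 1 / \<nu>) * \<omega> (c * ladder (n - 1))" for j
    using ladder_relations(2)[OF w, of c n j] by (simp only: r \<nu>_def)
  note M = prj_values[OF nz e_def [symmetric] e]
  have eF: "e * F j = \<nu> * (\<nu> * F j + G j) - \<nu> * (1 / \<nu> * F j + G j)" for j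
    using nz by (simp add: e_def algebra_simps)
  have eG: "e * G j = \<nu> * \<nu> * (1 / \<nu> * F j + G j) - (\<nu> * F j + G j)" for j
    using nz by (simp add: e_def algebra_simps)
  have "F j = (\<nu> * ((if j then 1 else \<nu>) * \<omega> (c * ladder (n + 1))) - \<nu> * ((if j then 1 else 1 / \<nu>) * \<omega> (c * ladder (n - 1)))) / e" for j
    using eF[of j] e unfolding 1 2 by (simp add: nonzero_eq_divide_eq mult.commute)
  moreover have "G j = (\<nu> * \<nu> * ((if j then 1 else 1 / \<nu>) * \<omega> (c * ladder (n - 1))) - (if j then 1 else \<nu>) * \<omega> (c * ladder (n + 1))) / e" for j
    using eG[of j] e unfolding 1 2 by (simp add: nonzero_eq_divide_eq mult.commute)
  moreover have "\<omega> (c * (u i j * ladder n)) = (if i then G j else F j)"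
    by (cases i) (simp_all only: F_def G_def if_True if_False)
  ultimately show ?thesis unfolding \<nu>_def [symmetric]
    using nz e by (cases i; cases j; simp add: M del: prj.simps; simp add: field_simps)
qed

text \<open>By \<open>ladder_module\<close> the values of \<open>\<omega>\<close> on the left translates of the ladder elements satisfy the
  recursion that defines \<open>acts\<close>, and the ladder element at 0 is 1.\<close>

lemma dualC_om:
  assumes w: "\<omega> \<in> dualC q \<tau> t"
  shows "\<omega> = om (\<lambda>n. \<omega> (ladder n))"
proof
  fix x
  have "linear_functional \<omega>" using w by (simp add: dualC_def dualA_def)
  note L = linear_functionalD[OF this]
  have "acts x (\<lambda>n. \<omega> (ladder n)) n = \<omega> (x * ladder n)" for n
  proof (induction x arbitrary: n rule: falgA_induct_right)
    case (gen i j x)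
    then show ?case unfolding acts_mult acts_gen act_def mult.assoc ladder_module[OF w] by simp
  qed (simp_all add: acts_add acts_scale distrib_right mult.assoc L)
  then show "\<omega> x = om (\<lambda>n. \<omega> (ladder n)) x" by (simp add: om_def ladder_0)
qed

lemma dualC_eq: "dualC q \<tau> t = range om"
  using dualC_om om_dualC by blast

text \<open>The second entry of the row for \<open>[a + n + 1]\<close> reproduces the projection \<open>P\<^sup>+\<close> and annihilates \<open>P\<^sup>-\<close>,
  so it acts at \<open>n\<close> as the shift to \<open>n + 1\<close>; the other row is the opposite shift.\<close>

lemma om_ladder: "om f (ladder n) = f n"
proof -
  have up: "acts (row_elt (nu n) True) f n = f (n + 1)" for f n
  proof -
    define \<nu> e where "\<nu> = nu n" and "e = \<nu> * \<nu> - 1"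
    have nz: "\<nu> \<noteq> 0" by (simp add: \<nu>_def)
    have e: "e \<noteq> 0" using imaginary_denominator(1)[OF nu_nz nu_cnj, of n] by (simp add: e_def \<nu>_def)
    show ?thesis unfolding row_elt_def acts_add acts_scale acts_gen act_def \<nu>_def [symmetric] ug.simps prj_values[OF nz e_def [symmetric] e]
      using nz e by (simp add: field_simps, simp add: e_def algebra_simps)
  qed
  have down: "acts (row_elt (1 / nu n) True) f n = f (n - 1)" for f n
  proof -
    define \<nu> e where "\<nu> = nu n" and "e = \<nu> * \<nu> - 1"
    have nz: "\<nu> \<noteq> 0" by (simp add: \<nu>_def)
    have e: "e \<noteq> 0" using imaginary_denominator(1)[OF nu_nz nu_cnj, of n] by (simp add: e_def \<nu>_def)
    show ?thesis unfolding row_elt_def acts_add acts_scale acts_gen act_def \<nu>_def [symmetric] ug.simps prj_values[OF nz e_def [symmetric] e]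
      using nz e by (simp add: field_simps, simp add: e_def algebra_simps)
  qed
  have U: "om f (chain (nu 0) k) = f (int k)" for k f
  proof (induction k arbitrary: f)
    case (Suc k)
    show ?case unfolding chain.simps om_ract Suc nu_nonneg [symmetric] of_real_power [symmetric] up
      by (simp add: add.commute)
  qed (simp add: om_one)
  have D: "om f (chain (1 / nu 0) k) = f (- int k)" for k f
  proof (induction k arbitrary: f)
    case (Suc k)
    have e: "- int k - 1 = - int (Suc k)" by simp
    show ?case unfolding chain.simps om_ract Suc nu_nonpos [symmetric] of_real_power [symmetric] down
      by (simp only: e)
  qed (simp add: om_one)
  show ?thesis using U D by (simp add: ladder_def)
qed

lemma om_inj: "om f = om g \<longleftrightarrow> f = g"
  by (metis om_ladder ext)

end

section \<open>The algebra of finitely supported functions\<close>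

lemma sum_fun_apply: "(\<Sum>s\<in>S. f s) x = (\<Sum>s\<in>S. f s x)"
  for f :: "'s \<Rightarrow> 'a \<Rightarrow> 'c::comm_monoid_add"
  by (induction S rule: infinite_finite_induct) simp_all

text \<open>Functions with dual points are linearly independent, so only finitely many of them fit into a
  finite-dimensional space.\<close>

lemma finite_dual_family:
  fixes e :: "'i \<Rightarrow> 'a \<Rightarrow> complex" and x :: "'i \<Rightarrow> 'a"
  assumes S: "finite S" and span: "\<And>i. i \<in> I \<Longrightarrow> \<exists>c. e i = (\<lambda>a. \<Sum>s\<in>S. c s * s a)"
    and dual: "\<And>i j. e i (x j) = (if i = j then 1 else 0)"
  shows "finite I"
proof -
  interpret fs: vector_space "\<lambda>(c::complex) (f::'a \<Rightarrow> complex) a. c * f a"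
    by unfold_locales (simp_all add: fun_eq_iff algebra_simps)
  have inj: "inj e"
  proof (rule injI)
    fix i j assume "e i = e j"
    then have "e i (x i) = e j (x i)" by simp
    then show "i = j" by (simp add: dual split: if_splits)
  qed
  have "fs.independent (e ` I)"
    unfolding fs.dependent_explicit
  proof (rule notI, elim exE conjE bexE)
    fix U c v assume U: "finite U" "U \<subseteq> e ` I" "v \<in> U" "c v \<noteq> 0"
      and z: "(\<Sum>v\<in>U. (\<lambda>a. c v * v a)) = 0"
    obtain i where i: "v = e i" using U by blast
    have "0 = (\<Sum>v\<in>U. (\<lambda>a. c v * v a)) (x i)" unfolding z by simp
    also have "\<dots> = (\<Sum>w\<in>U. c w * w (x i))" by (rule sum_fun_apply)
    also have "\<dots> = (\<Sum>w\<in>U. if w = v then c v else 0)"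
    proof (rule sum.cong [OF refl])
      fix w assume "w \<in> U"
      then obtain j where j: "w = e j" using U by blast
      have "e j = e i \<longleftrightarrow> j = i" using inj by (simp add: inj_eq)
      then show "c w * w (x i) = (if w = v then c v else 0)" by (simp add: i j dual)
    qed
    also have "\<dots> = c v" using U by simp
    finally show False using U by simp
  qed
  moreover have "e ` I \<subseteq> fs.span S"
  proof
    fix f assume "f \<in> e ` I"
    then obtain i where i: "i \<in> I" "f = e i" by blast
    from span[OF i(1)] obtain c where c: "e i = (\<lambda>a. \<Sum>s\<in>S. c s * s a)" by blast
    have "f = (\<Sum>s\<in>S. (\<lambda>a. c s * s a))" by (simp add: i c fun_eq_iff sum_fun_apply)
    then show "f \<in> fs.span S"
      by (simp add: fs.span_sum fs.span_scale fs.span_base)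
  qed
  ultimately have "finite (e ` I)" using fs.independent_span_bound[OF S] by blast
  then show ?thesis using inj by (meson finite_imageD inj_on_subset subset_UNIV)
qed

context qsphere
begin

definition delta :: "int \<Rightarrow> int \<Rightarrow> complex" where "delta n m = (if m = n then 1 else 0)"

abbreviation fsupp :: "(int \<Rightarrow> complex) \<Rightarrow> bool" where "fsupp f \<equiv> finite {n. f n \<noteq> 0}"

lemma om_scale: "(\<lambda>x. c * om f x) = om (\<lambda>n. c * f n)"
  and om_plus: "(\<lambda>x. om f x + om g x) = om (\<lambda>n. f n + g n)"
  by (simp_all add: fun_eq_iff om_fun_linear)

lemma om_sum: "om (\<lambda>n. \<Sum>m\<in>F. c m * h m n) x = (\<Sum>m\<in>F. c m * om (h m) x)"
proof (induction F rule: infinite_finite_induct)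
  case (insert m F)
  then show ?case by (simp add: om_fun_linear)
qed (use om_fun_linear(2)[of 0 "\<lambda>_. 0"] in simp_all)

lemma delta_expansion:
  assumes "finite F" "\<And>n. n \<notin> F \<Longrightarrow> f n = 0"
  shows "f = (\<lambda>n. \<Sum>m\<in>F. f m * delta m n)"
proof
  fix n
  have "(\<Sum>m\<in>F. f m * delta m n) = (\<Sum>m\<in>F. if m = n then f n else 0)"
    by (intro sum.cong) (auto simp: delta_def)
  then show "f n = (\<Sum>m\<in>F. f m * delta m n)" using assms by simp
qed

text \<open>An ideal that contains \<open>om f\<close> contains the indicator functions of all points of the support of
  \<open>f\<close>, and these are dual to ladder elements.\<close>

lemma Uqkt_fin_dim:
  assumes J: "fin_dim_ideal (dualC q \<tau> t) J" and f: "om f \<in> J"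
  shows "fsupp f"
proof -
  have J1: "\<And>c x. x \<in> J \<Longrightarrow> (\<lambda>a. c * x a) \<in> J" and J2: "\<And>x y. x \<in> J \<Longrightarrow> y \<in> dualC q \<tau> t \<Longrightarrow> conv x y \<in> J"
    using J unfolding fin_dim_ideal_def by blast+
  obtain S where S: "finite S" "\<And>x. x \<in> J \<Longrightarrow> \<exists>c. x = (\<lambda>a. \<Sum>s\<in>S. c s * s a)"
    using J unfolding fin_dim_ideal_def by blast
  show ?thesis
  proof (rule finite_dual_family[OF S(1), where e = "\<lambda>n. om (delta n)" and x = ladder])
    fix n assume n: "n \<in> {n. f n \<noteq> 0}"
    have "(\<lambda>a. 1 / f n * conv (om f) (om (delta n)) a) \<in> J"
      by (intro J1 J2 f om_dualC)
    also have "(\<lambda>a. 1 / f n * conv (om f) (om (delta n)) a) = om (delta n)"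
      using n unfolding om_conv om_scale om_inj by (auto simp: fun_eq_iff delta_def)
    finally show "\<exists>c. om (delta n) = (\<lambda>a. \<Sum>s\<in>S. c s * s a)" by (rule S(2))
  next
    show "om (delta i) (ladder j) = (if i = j then 1 else 0)" for i j
      by (simp add: om_ladder delta_def)
  qed
qed

text \<open>Conversely the functions supported in a fixed finite set form a finite-dimensional ideal.\<close>

lemma Uqkt_eq: "Uqkt q \<tau> t = {om f | f. fsupp f}"
proof (intro equalityI subsetI)
  fix x assume "x \<in> Uqkt q \<tau> t"
  then obtain J where J: "fin_dim_ideal (dualC q \<tau> t) J" "x \<in> J" by (auto simp: Uqkt_def)
  then have "x \<in> dualC q \<tau> t" unfolding fin_dim_ideal_def by blast
  then obtain f where f: "x = om f" unfolding dualC_eq by blast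
  then show "x \<in> {om f | f. fsupp f}" using Uqkt_fin_dim J by blast
next
  fix x assume "x \<in> {om f | f. fsupp f}"
  then obtain f where x: "x = om f" and fin: "fsupp f" by blast
  define F where "F = {n. f n \<noteq> 0}"
  define J where "J = {om g | g. \<forall>n. n \<notin> F \<longrightarrow> g n = 0}"
  have F: "finite F" using fin by (simp add: F_def)
  have "fin_dim_ideal (dualC q \<tau> t) J"
    unfolding fin_dim_ideal_def
  proof (intro conjI ballI allI)
    show "J \<subseteq> dualC q \<tau> t" using om_dualC by (auto simp: J_def)
    have "(\<lambda>a. 0) = om (\<lambda>n. 0)" using om_scale[of 0 "\<lambda>_. 0"] by simp
    then show "(\<lambda>a. 0) \<in> J" by (auto simp: J_def)
  next
    fix x y assume "x \<in> J" "y \<in> J"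
    then obtain g h where "x = om g" "y = om h" "\<forall>n. n \<notin> F \<longrightarrow> g n = 0" "\<forall>n. n \<notin> F \<longrightarrow> h n = 0"
      by (auto simp: J_def)
    then have "(\<lambda>a. x a + y a) = om (\<lambda>n. g n + h n)" "\<forall>n. n \<notin> F \<longrightarrow> g n + h n = 0"
      by (simp_all add: om_plus)
    then show "(\<lambda>a. x a + y a) \<in> J" unfolding J_def by blast
  next
    fix c x assume "x \<in> J"
    then obtain g where "x = om g" "\<forall>n. n \<notin> F \<longrightarrow> g n = 0" by (auto simp: J_def)
    then have "(\<lambda>a. c * x a) = om (\<lambda>n. c * g n)" "\<forall>n. n \<notin> F \<longrightarrow> c * g n = 0"
      by (simp_all add: om_scale)
    then show "(\<lambda>a. c * x a) \<in> J" unfolding J_def by blast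
  next
    fix x y assume "x \<in> J" "y \<in> dualC q \<tau> t"
    then obtain g h where *: "x = om g" "y = om h" "\<forall>n. n \<notin> F \<longrightarrow> g n = 0"
      unfolding dualC_eq by (auto simp: J_def)
    then have "conv x y = om (\<lambda>n. g n * h n)" "\<forall>n. n \<notin> F \<longrightarrow> g n * h n = 0" by (simp_all add: om_conv)
    then show "conv x y \<in> J" unfolding J_def by blast
    from * have "conv y x = om (\<lambda>n. h n * g n)" "\<forall>n. n \<notin> F \<longrightarrow> h n * g n = 0" by (simp_all add: om_conv)
    then show "conv y x \<in> J" unfolding J_def by blast
  next
    define e where "e n = om (delta n)" for n
    have inj: "inj e"
    proof (rule injI)
      fix m n assume "e m = e n"
      then have "delta m m = delta n m" by (simp add: e_def om_inj)
      then show "m = n" by (simp add: delta_def split: if_splits)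
    qed
    show "\<exists>S. finite S \<and> (\<forall>x\<in>J. \<exists>c. x = (\<lambda>a. \<Sum>s\<in>S. c s * s a))"
    proof (intro exI[of _ "e ` F"] conjI ballI)
      show "finite (e ` F)" using F by simp
      fix x assume "x \<in> J"
      then obtain g where g: "x = om g" "\<And>n. n \<notin> F \<Longrightarrow> g n = 0" by (auto simp: J_def)
      define c where "c s = g (inv_into UNIV e s)" for s
      have ce: "c (e n) = g n" for n by (simp add: c_def inj)
      have "x a = (\<Sum>s\<in>e ` F. c s * s a)" for a
      proof -
        have "om g a = om (\<lambda>n. \<Sum>m\<in>F. g m * delta m n) a"
          by (rule arg_cong[where f = "\<lambda>h. om h a"]) (rule delta_expansion[OF F g(2)])
        also have "\<dots> = (\<Sum>n\<in>F. c (e n) * e n a)" by (simp only: om_sum ce) (simp only: e_def)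
        also have "\<dots> = (\<Sum>s\<in>e ` F. c s * s a)"
          by (rule sum.reindex_cong [symmetric, OF inj_on_subset[OF inj subset_UNIV] refl]) simp
        finally show ?thesis by (simp only: g)
      qed
      then show "\<exists>c. x = (\<lambda>a. \<Sum>s\<in>e ` F. c s * s a)" by (intro exI[of _ c]) (simp add: fun_eq_iff)
    qed
  qed
  moreover have "x \<in> J" using x by (auto simp: J_def F_def)
  ultimately show "x \<in> Uqkt q \<tau> t" by (auto simp: Uqkt_def)
qed

lemma fsupp_delta: "fsupp (delta n)" by (simp add: delta_def)

text \<open>The product of two candidates for the support projection is equal to each of them.\<close>

lemma PhiC_eq: "PhiC q \<tau> t = om (delta 0)"
  unfolding PhiC_def
proof (rule the_equality)
  have dd: "delta 0 n * delta 0 n = delta 0 n" for n by (simp add: delta_def)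
  have c: "conv x (om (delta 0)) = (\<lambda>a. x 1 * om (delta 0) a)" "conv (om (delta 0)) x = (\<lambda>a. x 1 * om (delta 0) a)"
    if "x \<in> dualC q \<tau> t" for x
  proof -
    obtain f where f: "x = om f" using \<open>x \<in> dualC q \<tau> t\<close> unfolding dualC_eq by blast
    show "conv x (om (delta 0)) = (\<lambda>a. x 1 * om (delta 0) a)" "conv (om (delta 0)) x = (\<lambda>a. x 1 * om (delta 0) a)"
      unfolding f om_conv om_one om_scale om_inj by (simp_all add: fun_eq_iff delta_def)
  qed
  show "om (delta 0) \<in> Uqkt q \<tau> t \<and> conv (om (delta 0)) (om (delta 0)) = om (delta 0) \<and>
    dual_star q (om (delta 0)) = om (delta 0) \<and> om (delta 0) 1 = 1 \<and>
    (\<forall>x\<in>dualC q \<tau> t. conv x (om (delta 0)) = (\<lambda>a. x 1 * om (delta 0) a) \<and> conv (om (delta 0)) x = (\<lambda>a. x 1 * om (delta 0) a))"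
  proof (intro conjI ballI)
    show "om (delta 0) \<in> Uqkt q \<tau> t" unfolding Uqkt_eq using fsupp_delta by blast
    show "conv (om (delta 0)) (om (delta 0)) = om (delta 0)" by (simp only: om_conv dd)
    show "dual_star q (om (delta 0)) = om (delta 0)"
      unfolding om_star om_inj by (simp add: fun_eq_iff delta_def)
    show "om (delta 0) 1 = 1" by (simp add: om_one delta_def)
  qed (fact c)+
  fix p
  assume p: "p \<in> Uqkt q \<tau> t \<and> conv p p = p \<and> dual_star q p = p \<and> p 1 = 1 \<and>
     (\<forall>x\<in>dualC q \<tau> t. conv x p = (\<lambda>a. x 1 * p a) \<and> conv p x = (\<lambda>a. x 1 * p a))"
  then have p1: "p 1 = 1" and pU: "p \<in> Uqkt q \<tau> t"
    and pc: "\<And>x. x \<in> dualC q \<tau> t \<Longrightarrow> conv x p = (\<lambda>a. x 1 * p a)" by blast+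
  have "p \<in> dualC q \<tau> t" using pU om_dualC unfolding Uqkt_eq by blast
  from c(2)[OF this] have "conv (om (delta 0)) p = om (delta 0)" by (simp only: p1 mult_1_left)
  moreover have "conv (om (delta 0)) p = p"
    unfolding pc[OF om_dualC] om_one by (simp add: delta_def)
  ultimately show "p = om (delta 0)" by simp
qed

subsection \<open>The integral\<close>

definition weight :: "int \<Rightarrow> complex" where
  "weight n = (q powr (a + n) + q powr (- a - n)) / (q powr a + q powr (- a))"

definition wsum :: "(int \<Rightarrow> complex) \<Rightarrow> complex" where
  "wsum f = Sum_any (\<lambda>n. f n * weight n)"

text \<open>Evaluation at the ladder elements inverts \<open>om\<close>.\<close>

definition psi :: "(genA falg \<Rightarrow> complex) \<Rightarrow> complex" where
  "psi x = wsum (\<lambda>n. x (ladder n))"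

lemma psi_om: "psi (om f) = wsum f" by (simp add: psi_def om_ladder)

lemma finite_mult_weight: "fsupp f \<Longrightarrow> finite {n. f n * weight n \<noteq> 0}"
  by (rule finite_subset[of _ "{n. f n \<noteq> 0}"]) auto

lemma wsum_add: "fsupp f \<Longrightarrow> fsupp g \<Longrightarrow> wsum (\<lambda>n. f n + g n) = wsum f + wsum g"
  unfolding wsum_def distrib_right by (rule Sum_any.distrib) (rule finite_mult_weight; assumption)+

lemma wsum_scale: "fsupp f \<Longrightarrow> wsum (\<lambda>n. c * f n) = c * wsum f"
  unfolding wsum_def mult.assoc by (rule Sum_any_right_distrib [symmetric]) (rule finite_mult_weight)

lemma wsum_delta: "wsum (delta n) = weight n"
proof -
  have "(\<lambda>m. delta n m * weight m) = (\<lambda>m. if m = n then weight m else 0)" by (auto simp: delta_def)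
  then show ?thesis by (simp only: wsum_def Sum_any.delta)
qed

lemma weight_pos: "0 < Re (weight n)" "Im (weight n) = 0"
proof -
  have "weight n = complex_of_real ((q powr (a + n) + q powr (- a - n)) / (q powr a + q powr (- a)))"
    by (simp add: weight_def)
  moreover have "0 < (q powr (a + n) + q powr (- a - n)) / (q powr a + q powr (- a))"
    using q by (intro divide_pos_pos add_pos_pos) simp_all
  ultimately show "0 < Re (weight n)" "Im (weight n) = 0" by simp_all
qed

text \<open>The weight is a multiple of the denominator of the projections at \<open>n\<close>.\<close>

lemma weight_nu: "\<exists>k. \<forall>n. weight n = k * (nu n - 1 / nu n)"
proof (intro exI allI)
  fix n :: int
  define x where "x = q powr (a + n)"
  have x: "x > 0" using q by (simp add: x_def)
  have "- a - real_of_int n = - (a + n)" by simp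
  then have "q powr (- a - n) = 1 / x" using q by (simp only: x_def powr_minus_divide)
  define S D where "S = complex_of_real x + 1 / complex_of_real x" and "D = complex_of_real (q powr a + q powr (- a))"
  have "weight n = S / D"
    using \<open>q powr (- a - n) = 1 / x\<close> by (simp add: weight_def S_def D_def flip: x_def)
  moreover have "nu n - 1 / nu n = - \<i> * S"
    using x by (simp add: nu_def S_def flip: x_def, simp add: field_simps)
  ultimately show "weight n = \<i> / complex_of_real (q powr a + q powr (- a)) * (nu n - 1 / nu n)"
    unfolding D_def [symmetric] by simp
qed

text \<open>Multiplied with the weights the projections have polynomial entries in \<open>\<nu>\<close> and \<open>1 / \<nu>\<close>.  The off-diagonal
  entries cancel and the diagonal ones add up to multiples of \<open>\<nu> - 1 / \<nu>\<close>.\<close>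

lemma weight_act:
  "weight (n - 1) * prj (nu (n - 1)) (ug i j) + weight (n + 1) * prj (1 / nu (n + 1)) (ug i j)
    = (if i = j then if i then q else 1 / q else 0) * weight n"
proof -
  obtain k where k: "\<And>n. weight n = k * (nu n - 1 / nu n)" using weight_nu by blast
  define \<nu> Q where "\<nu> = nu n" and "Q = complex_of_real q"
  have nz: "\<nu> \<noteq> 0" "Q \<noteq> 0" by (simp_all add: \<nu>_def Q_def)
  have P: "(\<mu> - 1 / \<mu>) * prj \<mu> (ug i j) = (if i then if j then - 1 / \<mu> else - 1 else if j then 1 else \<mu>)"
    if "\<mu> - 1 / \<mu> \<noteq> 0" for \<mu>
    by (cases i; cases j; simp only: ug.simps prj.simps times_divide_eq_right if_True if_False
        nonzero_mult_div_cancel_left[OF that] divide_self[OF that] not_True_eq_False mult_1_right; simp)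
  have m: "nu (n - 1) = \<nu> / Q" "nu (n + 1) = Q * \<nu>" by (simp_all add: nu_pred nu_suc \<nu>_def Q_def)
  have d1: "nu (n - 1) - 1 / nu (n - 1) \<noteq> 0" by (rule nu_den)
  have d2: "1 / nu (n + 1) - 1 / (1 / nu (n + 1)) \<noteq> 0" using nu_den[of "n + 1"] by auto
  have "weight (n - 1) * prj (nu (n - 1)) (ug i j) = k * ((nu (n - 1) - 1 / nu (n - 1)) * prj (nu (n - 1)) (ug i j))"
    by (simp only: k mult.assoc)
  also have "\<dots> = k * (if i then if j then - 1 / nu (n - 1) else - 1 else if j then 1 else nu (n - 1))"
    unfolding P[OF d1] ..
  finally have A: "weight (n - 1) * prj (nu (n - 1)) (ug i j)
      = k * (if i then if j then - 1 / nu (n - 1) else - 1 else if j then 1 else nu (n - 1))" .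
  have "weight (n + 1) * prj (1 / nu (n + 1)) (ug i j)
      = - k * ((1 / nu (n + 1) - 1 / (1 / nu (n + 1))) * prj (1 / nu (n + 1)) (ug i j))"
  proof -
    have "1 / nu (n + 1) - 1 / (1 / nu (n + 1)) = - (nu (n + 1) - 1 / nu (n + 1))" by simp
    then show ?thesis by (simp only: k mult_minus_left mult_minus_right minus_minus mult.assoc)
  qed
  also have "\<dots> = - k * (if i then if j then - 1 / (1 / nu (n + 1)) else - 1 else if j then 1 else 1 / nu (n + 1))"
    unfolding P[OF d2] ..
  finally have B: "weight (n + 1) * prj (1 / nu (n + 1)) (ug i j)
      = - k * (if i then if j then - 1 / (1 / nu (n + 1)) else - 1 else if j then 1 else 1 / nu (n + 1))" .
  have Wn: "weight n = k * (\<nu> - 1 / \<nu>)" by (simp add: k \<nu>_def)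
  show ?thesis unfolding A B unfolding m Wn using nz
    by (cases i; cases j; simp flip: Q_def; simp add: field_simps)
qed

lemma fsupp_shift: "fsupp f \<Longrightarrow> finite {n. f (n + k) \<noteq> 0}"
proof -
  assume "fsupp f"
  then have "finite ((\<lambda>n. n - k) ` {n. f n \<noteq> 0})" by simp
  moreover have "{n. f (n + k) \<noteq> 0} \<subseteq> (\<lambda>n. n - k) ` {n. f n \<noteq> 0}" by force
  ultimately show ?thesis by (rule rev_finite_subset)
qed

lemma Sum_any_shift: "Sum_any (\<lambda>n. g n * f (n + k)) = Sum_any (\<lambda>n. g (n - k) * f n)"
  for f g :: "int \<Rightarrow> complex"
  by (rule Sum_any.reindex_cong[of "\<lambda>n. n - k"])
    (auto simp: fun_eq_iff bij_def inj_def surj_def intro: exI[of _ "x + k" for x])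

lemma fsupp_act: "fsupp f \<Longrightarrow> fsupp (act g f)"
proof -
  assume f: "fsupp f"
  have "finite ({n. f (n + 1) \<noteq> 0} \<union> {n. f (n + -1) \<noteq> 0})"
    using fsupp_shift[OF f, of 1] fsupp_shift[OF f, of "- 1"] by simp
  moreover have "{n. act g f n \<noteq> 0} \<subseteq> {n. f (n + 1) \<noteq> 0} \<union> {n. f (n + -1) \<noteq> 0}"
    by (auto simp: act_def)
  ultimately show ?thesis by (rule rev_finite_subset)
qed

text \<open>Summation by parts: shifting the index moves the action from \<open>f\<close> to the weight.\<close>

lemma wsum_act:
  assumes f: "fsupp f"
  shows "wsum (act (ug i j) f) = (if i = j then if i then q else 1 / q else 0) * wsum f"
proof -
  let ?g = "ug i j"
  have fin: "finite {n. h n * f (n + k) \<noteq> 0}" for h k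
    by (rule finite_subset[OF _ fsupp_shift[OF f, of k]]) auto
  have "wsum (act ?g f) = Sum_any (\<lambda>n. (weight n * prj (nu n) ?g) * f (n + 1) + (weight n * prj (1 / nu n) ?g) * f (n + -1))"
    unfolding wsum_def act_def by (rule arg_cong[of _ _ Sum_any]) (simp add: fun_eq_iff algebra_simps)
  also have "\<dots> = Sum_any (\<lambda>n. (weight n * prj (nu n) ?g) * f (n + 1)) + Sum_any (\<lambda>n. (weight n * prj (1 / nu n) ?g) * f (n + -1))"
    by (rule Sum_any.distrib) (rule fin)+
  also have "\<dots> = Sum_any (\<lambda>n. (weight (n - 1) * prj (nu (n - 1)) ?g) * f (n + 0)) + Sum_any (\<lambda>n. (weight (n - -1) * prj (1 / nu (n - -1)) ?g) * f (n + 0))"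
    unfolding Sum_any_shift[of "\<lambda>n. weight n * prj (nu n) ?g"] Sum_any_shift[of "\<lambda>n. weight n * prj (1 / nu n) ?g"] by simp
  also have "\<dots> = Sum_any (\<lambda>n. (weight (n - 1) * prj (nu (n - 1)) ?g) * f (n + 0) + (weight (n - -1) * prj (1 / nu (n - -1)) ?g) * f (n + 0))"
    by (rule Sum_any.distrib [symmetric]) (rule fin)+
  also have "\<dots> = Sum_any (\<lambda>n. (if i = j then if i then q else 1 / q else 0) * (f n * weight n))"
  proof (rule arg_cong[of _ _ Sum_any], rule ext)
    fix n
    have "weight (n - 1) * prj (nu (n - 1)) ?g * f (n + 0) + weight (n - -1) * prj (1 / nu (n - -1)) ?g * f (n + 0)
      = (weight (n - 1) * prj (nu (n - 1)) ?g + weight (n + 1) * prj (1 / nu (n + 1)) ?g) * f n"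
      by (simp only: distrib_right add_0_right diff_minus_eq_add)
    also have "\<dots> = (if i = j then if i then q else 1 / q else 0) * (f n * weight n)"
      unfolding weight_act by (simp only: ac_simps)
    finally show "weight (n - 1) * prj (nu (n - 1)) ?g * f (n + 0) + weight (n - -1) * prj (1 / nu (n - -1)) ?g * f (n + 0)
      = (if i = j then if i then q else 1 / q else 0) * (f n * weight n)" .
  qed
  also have "\<dots> = (if i = j then if i then q else 1 / q else 0) * wsum f"
    unfolding wsum_def by (rule Sum_any_right_distrib [symmetric]) (rule finite_mult_weight[OF f])
  finally show ?thesis .
qed

end

section \<open>Diagonal characters of $O_q(SU(2))$\<close>

text \<open>For \<open>z = q\<^sup>m\<close> this is the pairing with \<open>k\<^sup>m\<close>.\<close>

definition chi :: "complex \<Rightarrow> genA falg \<Rightarrow> complex" where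
  "chi z = free_hom id (case_genA z 0 0 (1 / z))"

lemma chi_hom:
  "chi z (x + y) = chi z x + chi z y" "chi z (x * y) = chi z x * chi z y" "chi z (sc c) = c"
  "chi z 1 = 1" "chi z (u i j) = (if i = j then if i then 1 / z else z else 0)"
proof -
  show "chi z (x * y) = chi z x * chi z y"
    unfolding chi_def by (rule free_hom_mult) simp_all
  show "chi z 1 = 1" using free_hom_sc[of id "case_genA z 0 0 (1 / z)" 1] by (simp add: chi_def)
  show "chi z (u i j) = (if i = j then if i then 1 / z else z else 0)"
    by (cases i; cases j) (simp_all add: chi_def free_hom_gen)
qed (simp_all add: chi_def free_hom_add free_hom_sc)

lemma chi_linear: "linear_functional (chi z)"
  by (simp add: linear_functional_def chi_hom)

context qsphere
begin

lemma wsum_acts: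
  assumes "fsupp f"
  shows "fsupp (acts x f) \<and> wsum (acts x f) = chi (1 / q) x * wsum f"
  using assms
proof (induction x arbitrary: f rule: falgA_induct_left)
  case one
  then show ?case by (simp add: chi_hom)
next
  case (add x y)
  have "{n. acts x f n + acts y f n \<noteq> 0} \<subseteq> {n. acts x f n \<noteq> 0} \<union> {n. acts y f n \<noteq> 0}" by auto
  then have "fsupp (\<lambda>n. acts x f n + acts y f n)" using add by (meson finite_Un finite_subset)
  moreover have "acts (x + y) f = (\<lambda>n. acts x f n + acts y f n)" by (simp add: fun_eq_iff acts_add)
  ultimately show ?case using add by (simp add: wsum_add chi_hom distrib_right)
next
  case (scale c x)
  have "fsupp (\<lambda>n. c * acts x f n)"
    by (rule finite_subset[of _ "{n. acts x f n \<noteq> 0}"]) (use scale in auto)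
  moreover have "acts (sc c * x) f = (\<lambda>n. c * acts x f n)" by (simp add: fun_eq_iff acts_scale)
  ultimately show ?case using scale by (simp add: wsum_scale chi_hom mult.assoc)
next
  case (gen i j x)
  have "acts (u i j * x) f = acts x (act (ug i j) f)" by (simp only: acts_mult acts_gen)
  then show ?case using gen.IH[OF fsupp_act[OF gen.prems]] wsum_act[OF gen.prems, of i j]
    by (simp add: chi_hom)
qed

text \<open>Under \<open>om\<close> the positivity of \<open>x\<^sup>* x\<close> is that of \<open>|f|\<^sup>2\<close>, tested with a positive weight.\<close>

lemma psi_invariant_integral: "invariant_integral q \<tau> t (chi (1 / q)) psi"
  unfolding invariant_integral_def
proof (intro conjI ballI allI)
  show "linear_on_Uqkt q \<tau> t psi"
    unfolding linear_on_Uqkt_def Uqkt_eq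
    by (auto simp: om_plus om_scale psi_om wsum_add wsum_scale)
  show "psi (PhiC q \<tau> t) = 1"
  proof -
    have "q powr a + q powr (- a) > 0" using q by (intro add_pos_pos) simp_all
    then have "(q powr a + q powr (- a)) / (q powr a + q powr (- a)) = 1" by simp
    moreover have "weight 0 = complex_of_real ((q powr a + q powr (- a)) / (q powr a + q powr (- a)))"
      by (simp add: weight_def)
    ultimately show ?thesis by (simp only: PhiC_eq psi_om wsum_delta of_real_1)
  qed
next
  fix x c assume "x \<in> Uqkt q \<tau> t"
  then obtain f where f: "x = om f" "fsupp f" unfolding Uqkt_eq by blast
  have "ract x c = om (acts c f)" by (simp add: ract_def f om_ract fun_eq_iff)
  then show "psi (ract x c) = chi (1 / q) c * psi x"
    using wsum_acts[OF f(2), of c] by (simp add: psi_om f)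
next
  fix x assume "x \<in> Uqkt q \<tau> t"
  then obtain f where f: "x = om f" "fsupp f" unfolding Uqkt_eq by blast
  have "psi (conv (dual_star q x) x) = wsum (\<lambda>n. cnj (f n) * f n)"
    unfolding f om_star om_conv psi_om ..
  also have "\<dots> = (\<Sum>n\<in>{n. f n \<noteq> 0}. cnj (f n) * f n * weight n)"
    unfolding wsum_def using f(2) by (intro Sum_any.expand_superset) auto
  also have "\<dots> \<ge> 0"
  proof -
    have *: "0 \<le> Re (cnj (f n) * f n * weight n) \<and> Im (cnj (f n) * f n * weight n) = 0" for n
    proof -
      have e: "cnj (f n) * f n = complex_of_real ((cmod (f n))\<^sup>2)"
        by (subst complex_norm_square) (rule mult.commute)
      show ?thesis unfolding e using weight_pos[of n] by simp
    qed
    then show ?thesis by (simp add: less_eq_complex_def sum_nonneg)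
  qed
  finally show "0 \<le> psi (conv (dual_star q x) x)" .
qed

end

section \<open>Matrix coefficients of the spin representations\<close>

lemma sum_rotate: "(\<Sum>a\<in>A. \<Sum>b\<in>B. \<Sum>c\<in>C. f a b c) = (\<Sum>c\<in>C. \<Sum>a\<in>A. \<Sum>b\<in>B. f a b c)"
proof -
  have "(\<Sum>a\<in>A. \<Sum>b\<in>B. \<Sum>c\<in>C. f a b c) = (\<Sum>a\<in>A. \<Sum>c\<in>C. \<Sum>b\<in>B. f a b c)"
    by (intro sum.cong refl sum.swap)
  also have "\<dots> = (\<Sum>c\<in>C. \<Sum>a\<in>A. \<Sum>b\<in>B. f a b c)" by (rule sum.swap)
  finally show ?thesis .
qed

lemma sum_swap_pairs:
  "(\<Sum>a\<in>A. \<Sum>b\<in>B. \<Sum>c\<in>C. \<Sum>d\<in>D. f a b c d) = (\<Sum>c\<in>C. \<Sum>d\<in>D. \<Sum>a\<in>A. \<Sum>b\<in>B. f a b c d)"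
proof -
  have "(\<Sum>a\<in>A. \<Sum>b\<in>B. \<Sum>c\<in>C. \<Sum>d\<in>D. f a b c d) = (\<Sum>c\<in>C. \<Sum>a\<in>A. \<Sum>b\<in>B. \<Sum>d\<in>D. f a b c d)"
    by (rule sum_rotate)
  also have "\<dots> = (\<Sum>c\<in>C. \<Sum>d\<in>D. \<Sum>a\<in>A. \<Sum>b\<in>B. f a b c d)"
    by (intro sum.cong refl sum_rotate)
  finally show ?thesis .
qed

text \<open>The quantum integers, written with a numerator and a denominator that are nonnegative for \<open>0 < q < 1\<close>.\<close>

definition qint :: "real \<Rightarrow> nat \<Rightarrow> real" where
  "qint q m = (q powr (- real m) - q powr (real m)) / (1 / q - q)"

context pairing
begin

lemma qint_0: "qint q 0 = 0" using q01 by (simp add: qint_def)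

lemma qint_nonneg: "0 \<le> qint q m"
proof -
  have "q powr (real m) \<le> q powr (- real m)" using q01 by (intro powr_mono') simp_all
  then show ?thesis using q_gap by (simp add: qint_def)
qed

lemma qint_add: "q powr (- real m) * qint q p + q powr (real p) * qint q m = qint q (m + p)"
proof -
  define x y where "x = q powr (real m)" and "y = q powr (real p)"
  have xy: "x > 0" "y > 0" using q01 by (simp_all add: x_def y_def)
  have e: "q powr (- real m) = 1 / x" "q powr (- real p) = 1 / y" "q powr (real (m + p)) = x * y"
    "q powr (- real (m + p)) = 1 / (x * y)"
    by (simp_all only: x_def y_def powr_minus_divide powr_add of_nat_add)
  define D where "D = 1 / q - q"
  have D: "D > 0" using q_gap by (simp add: D_def)
  show ?thesis unfolding qint_def e x_def [symmetric] y_def [symmetric] D_def [symmetric]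
    using xy D by (simp add: field_simps)
qed

lemma qint_1: "qint q 1 = 1"
  using q01 q_gap by (simp add: qint_def powr_minus_divide)

lemma qint_Suc: "qint q (Suc m) = q * qint q m + q powr (- real m)" "qint q (Suc m) = qint q m / q + q powr (real m)"
  using qint_add[of m 1] qint_add[of 1 m] q01 by (simp_all add: qint_1[simplified] powr_minus_divide)

lemma qint_pos: "0 < qint q (Suc m)"
  using qint_nonneg[of m] q01 by (simp add: qint_Suc(1) add_nonneg_pos)

lemma rep_entry_EF:
  assumes "p \<le> n"
  shows "rep_gen_entry q n GE p (Suc p) = sqrt (qint q (n - p)) * sqrt (qint q (Suc p)) * q powr (real n / 2 - real p)"
    and "rep_gen_entry q n GF (Suc p) p = sqrt (qint q (n - p)) * sqrt (qint q (Suc p)) * q powr (real p - real n / 2)"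
proof -
  define D where "D = 1 / q - q"
  have D: "D > 0" using q_gap by (simp add: D_def)
  have np: "real (n - p) = real n - real p" using assms by simp
  have x: "q powr (- (real n - real p)) - q powr (real n - real p) = D * qint q (n - p)"
    using D by (simp add: qint_def D_def np)
  have y: "q powr (- real (Suc p)) - q powr (real (Suc p)) = D * qint q (Suc p)"
    using D by (simp only: qint_def D_def) simp
  have s: "sqrt (D * qint q (n - p) * (D * qint q (Suc p))) = D * (sqrt (qint q (n - p)) * sqrt (qint q (Suc p)))"
  proof -
    have "D * qint q (n - p) * (D * qint q (Suc p)) = D\<^sup>2 * (qint q (n - p) * qint q (Suc p))"
      by (simp only: power2_eq_square ac_simps)
    then show ?thesis using D by (simp add: real_sqrt_mult)
  qed
  have a: "- real n + real (Suc p) - 1 = - (real n - real p)" "real n - real (Suc p) + 1 = real n - real p"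
    "real n / 2 - real (Suc p) + 1 = real n / 2 - real p"
    by simp_all
  have "rep_gen_entry q n GE p (Suc p) = sqrt ((q powr (- real n + real (Suc p) - 1) - q powr (real n - real (Suc p) + 1))
           * (q powr (- real (Suc p)) - q powr (real (Suc p))))
     * q powr (real n / 2 - real (Suc p) + 1) / D"
    by (simp only: rep_gen_entry.simps D_def Suc_eq_plus1 if_True refl)
  also have "\<dots> = D * (sqrt (qint q (n - p)) * sqrt (qint q (Suc p))) * q powr (real n / 2 - real p) / D"
    unfolding a x y s ..
  also have "\<dots> = sqrt (qint q (n - p)) * sqrt (qint q (Suc p)) * q powr (real n / 2 - real p)"
    using D by simp
  finally show "rep_gen_entry q n GE p (Suc p) = sqrt (qint q (n - p)) * sqrt (qint q (Suc p)) * q powr (real n / 2 - real p)" .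
  have b: "- real n + real p = - (real n - real p)" "- real p - 1 = - real (Suc p)" "real p + 1 = real (Suc p)"
    "- real n / 2 + real p = real p - real n / 2"
    by simp_all
  have "rep_gen_entry q n GF (Suc p) p = sqrt ((q powr (- real n + real p) - q powr (real n - real p))
           * (q powr (- real p - 1) - q powr (real p + 1)))
     * q powr (- real n / 2 + real p) / D"
    by (simp only: rep_gen_entry.simps D_def Suc_eq_plus1 if_True refl)
  also have "\<dots> = D * (sqrt (qint q (n - p)) * sqrt (qint q (Suc p))) * q powr (real p - real n / 2) / D"
    unfolding b x y s ..
  also have "\<dots> = sqrt (qint q (n - p)) * sqrt (qint q (Suc p)) * q powr (real p - real n / 2)"
    using D by simp
  finally show "rep_gen_entry q n GF (Suc p) p = sqrt (qint q (n - p)) * sqrt (qint q (Suc p)) * q powr (real p - real n / 2)" .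
qed

text \<open>\<open>emb0\<close> and \<open>emb1\<close> are the Clebsch-Gordan coefficients of the embedding of the representation of spin
  \<open>(n + 1) / 2\<close> into the tensor product of those of spin \<open>1 / 2\<close> and \<open>n / 2\<close>, scaled by the square root
  of \<open>qint q (n + 1)\<close>: the vector \<open>\<xi>\<^sub>p\<close> goes to \<open>emb0 n p\<close> times \<open>\<xi>\<^sub>0 \<otimes> \<xi>\<^sub>p\<close> plus \<open>emb1 n p\<close> times
  \<open>\<xi>\<^sub>1 \<otimes> \<xi>\<^bsub>p - 1\<^esub>\<close>.  Their zeros at \<open>p = n + 1\<close> and \<open>p = 0\<close> make up for the missing vectors
  \<open>\<xi>\<^bsub>n + 1\<^esub>\<close> and \<open>\<xi>\<^bsub>-1\<^esub>\<close>.\<close>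

definition emb0 :: "nat \<Rightarrow> nat \<Rightarrow> real" where
  "emb0 n p = q powr (real p / 2) * sqrt (qint q (Suc n - p))"

definition emb1 :: "nat \<Rightarrow> nat \<Rightarrow> real" where
  "emb1 n p = q powr ((real p - real n - 1) / 2) * sqrt (qint q p)"

definition emb :: "nat \<Rightarrow> bool \<Rightarrow> nat \<Rightarrow> nat \<Rightarrow> complex" where
  "emb n i s p = (if i then if p = Suc s then emb1 n p else 0 else if p = s then emb0 n p else 0)"

lemma emb1_0: "emb1 n 0 = 0" by (simp add: emb1_def qint_0)
lemma emb0_top: "emb0 n (Suc n) = 0" by (simp add: emb0_def qint_0)

lemma emb_norm:
  assumes "p \<le> Suc n"
  shows "(emb0 n p)\<^sup>2 + (emb1 n p)\<^sup>2 = qint q (Suc n)"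
proof -
  have "(q powr (real p / 2))\<^sup>2 = q powr (real p)" "(q powr ((real p - real n - 1) / 2))\<^sup>2 = q powr (- real (Suc n - p))"
    using q01 assms by (simp_all add: power2_eq_square of_nat_diff flip: powr_add, simp add: field_simps)
  then show ?thesis using qint_add[of "Suc n - p" p] assms qint_nonneg
    by (simp add: emb0_def emb1_def power_mult_distrib)
qed

lemma sum_emb_column:
  assumes "p < n + 2"
  shows "(\<Sum>k\<in>UNIV. \<Sum>t<n + 1. h k t * emb n k t p) = h False p * emb0 n p + h True (p - 1) * emb1 n p"
proof -
  have "(\<Sum>t<n + 1. h False t * emb n False t p) = (\<Sum>t<n + 1. if t = p then h False p * emb0 n p else 0)"
    by (intro sum.cong) (auto simp: emb_def)
  also have "\<dots> = h False p * emb0 n p" using assms emb0_top[of n] by (cases "p = Suc n") auto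
  finally have 1: "(\<Sum>t<n + 1. h False t * emb n False t p) = h False p * emb0 n p" .
  have "(\<Sum>t<n + 1. h True t * emb n True t p) = h True (p - 1) * emb1 n p"
  proof (cases p)
    case 0
    then show ?thesis by (simp add: emb_def emb1_0)
  next
    case (Suc r)
    have "(\<Sum>t<n + 1. h True t * emb n True t p) = (\<Sum>t<n + 1. if t = r then h True r * emb1 n p else 0)"
      by (intro sum.cong) (auto simp: emb_def Suc)
    then show ?thesis using assms Suc by simp
  qed
  then show ?thesis using 1 by (simp only: sum_bool)
qed

lemma sum_emb_row:
  fixes h :: "nat \<Rightarrow> complex"
  assumes "s < n + 1"
  shows "(\<Sum>r<n + 2. emb n i s r * h r) = (if i then emb1 n (Suc s) * h (Suc s) else emb0 n s * h s)"
proof -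
  have "(\<Sum>r<n + 2. emb n i s r * h r)
      = (\<Sum>r<n + 2. if r = (if i then Suc s else s) then (if i then emb1 n (Suc s) * h (Suc s) else emb0 n s * h s) else 0)"
    by (intro sum.cong) (auto simp: emb_def)
  then show ?thesis using assms by simp
qed

lemma emb_isometry:
  assumes "r < n + 2" "p < n + 2"
  shows "(\<Sum>i\<in>UNIV. \<Sum>s<n + 1. emb n i s r * emb n i s p) = (if r = p then qint q (Suc n) else 0)"
proof -
  have "emb0 n r * emb0 n r + emb1 n r * emb1 n r = qint q (Suc n)"
    using emb_norm[of r n] assms by (simp add: power2_eq_square)
  then have "complex_of_real (emb0 n r * emb0 n r + emb1 n r * emb1 n r) = complex_of_real (qint q (Suc n))"
    by (rule arg_cong)
  then show ?thesis unfolding sum_emb_column[OF assms(2)]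
    using assms emb1_0[of n] emb0_top[of n]
    by (cases "r = p"; cases p; cases r; auto simp: emb_def)
qed

text \<open>The matrix of the coproduct of a generator on the tensor product of the representations of spin
  \<open>1 / 2\<close> and \<open>n / 2\<close>, with row \<open>(i, s)\<close> and column \<open>(k, t)\<close>.\<close>

definition tgen :: "nat \<Rightarrow> genU \<Rightarrow> bool \<Rightarrow> nat \<Rightarrow> bool \<Rightarrow> nat \<Rightarrow> complex" where
  "tgen n g i s k t = (let e1 = (\<lambda>h. \<tau> (u i k) (gen h)); d1 = (if i = k then 1 else 0);
       en = (\<lambda>h. complex_of_real (rep_gen_entry q n h s t)); dn = (if s = t then 1 else 0) in
     case g of GE \<Rightarrow> e1 GE * dn + e1 GK * en GE
     | GF \<Rightarrow> e1 GF * en GKinv + d1 * en GF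
     | GK \<Rightarrow> e1 GK * en GK
     | GKinv \<Rightarrow> e1 GKinv * en GKinv)"

lemma tau_u_Kinv: "\<tau> (u i j) Ki = (if i = j then (if i then q else 1 / q) else 0)"
proof -
  have g: "\<tau> (u i j) (gen g) = complex_of_real (rep_gen_entry q 1 g (of_bool i) (of_bool j))" for g
    unfolding tau_u by (rule rep_entry_gen) simp_all
  have p: "q powr (- 1) = 1 / q" using q01 by (simp add: powr_minus_divide)
  show ?thesis unfolding g using q01 p by (cases i; cases j) simp_all
qed

lemmas tau_gen_values =
  tau_u_gens[of False False, simplified] tau_u_gens[of False True, simplified]
  tau_u_gens[of True False, simplified] tau_u_gens[of True True, simplified]
  tau_u_Kinv[of False False, simplified] tau_u_Kinv[of False True, simplified]
  tau_u_Kinv[of True False, simplified] tau_u_Kinv[of True True, simplified]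

lemma tau_tens_action:
  assumes c: "\<And>s s' x. s < n + 1 \<Longrightarrow> s' < n + 1 \<Longrightarrow> \<tau> (c s s') x = rep q n x $$ (s, s')"
    and s: "s < n + 1" "s' < n + 1"
  shows "slice_both (\<tau> (u i j)) (\<tau> (c s s')) (tens y z * copU x)
    = (\<Sum>k\<in>UNIV. \<Sum>t<n + 1. \<tau> (u i k) y * rep q n z $$ (s, t) * \<tau> (u k j * c t s') x)"
proof -
  have 1: "\<tau> (u i j) (y * v) = (\<Sum>k\<in>UNIV. \<tau> (u i k) y * \<tau> (u k j) v)" for v
    unfolding tau_mult_right by (rule conv_u) (rule tau_linear_left)+
  have 2: "\<tau> (c s s') (z * v) = (\<Sum>t<n + 1. rep q n z $$ (s, t) * \<tau> (c t s') v)" for v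
    unfolding c[OF s] rep_entry_mult[OF s] using s by (intro sum.cong refl, simp add: c)
  have 3: "slice_both (\<lambda>v. \<Sum>k\<in>UNIV. \<tau> (u i k) y * \<tau> (u k j) v) g w
      = (\<Sum>k\<in>UNIV. \<tau> (u i k) y * slice_both (\<tau> (u k j)) g w)" for g w
    by (simp only: sum_bool slice_both_fun_add_left slice_both_fun_scale_left)
  have 4: "slice_both f (\<lambda>v. \<Sum>t\<in>S. rep q n z $$ (s, t) * \<tau> (c t s') v) w
      = (\<Sum>t\<in>S. rep q n z $$ (s, t) * slice_both f (\<tau> (c t s')) w)" for f w and S :: "nat set"
  proof (induction S rule: infinite_finite_induct)
    case (insert t S)
    then show ?case by (simp add: slice_both_fun_add_right slice_both_fun_scale_right)
  qed (simp_all add: slice_both_def)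
  have "slice_both (\<tau> (u i j)) (\<tau> (c s s')) (tens y z * copU x)
      = slice_both (\<lambda>v. \<tau> (u i j) (y * v)) (\<lambda>v. \<tau> (c s s') (z * v)) (copU x)"
    by (rule slice_both_tens_mult) (rule tau_linear_right)+
  also have "\<dots> = (\<Sum>k\<in>UNIV. \<tau> (u i k) y * (\<Sum>t<n + 1. rep q n z $$ (s, t) * \<tau> (u k j * c t s') x))"
    unfolding 1 2 3 4 tau_mult_left ..
  finally show ?thesis by (simp only: sum_distrib_left mult.assoc)
qed

text \<open>A product in \<open>A\<close> of two matrix coefficients is a matrix coefficient of the tensor product.\<close>

lemma tau_tgen:
  assumes c: "\<And>s s' x. s < n + 1 \<Longrightarrow> s' < n + 1 \<Longrightarrow> \<tau> (c s s') x = rep q n x $$ (s, s')"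
    and s: "s < n + 1" "s' < n + 1"
  shows "\<tau> (u i j * c s s') (gen g * x) = (\<Sum>k\<in>UNIV. \<Sum>t<n + 1. tgen n g i s k t * \<tau> (u k j * c t s') x)"
proof -
  have r: "rep q n (gen h) $$ (s, t) = complex_of_real (rep_gen_entry q n h s t)"
    "rep q n 1 $$ (s, t) = (if s = t then 1 else 0)" if "t < n + 1" for h t
    using that s by (simp_all only: rep_entry_gen rep_entry_one)
  have o: "\<tau> (u i k) 1 = (if i = k then 1 else 0)" for k by (simp add: tau_one counA_hom)
  have act: "slice_both (\<tau> (u i j)) (\<tau> (c s s')) (tens y z * copU x)
    = (\<Sum>k\<in>UNIV. \<Sum>t<n + 1. \<tau> (u i k) y * rep q n z $$ (s, t) * \<tau> (u k j * c t s') x)" for y z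
    by (rule tau_tens_action) (erule (1) c, (rule s)+)
  have add: "slice_both (\<tau> (u i j)) (\<tau> (c s s')) ((z + z') * w)
      = slice_both (\<tau> (u i j)) (\<tau> (c s s')) (z * w) + slice_both (\<tau> (u i j)) (\<tau> (c s s')) (z' * w)" for z z' w
    unfolding distrib_right by (rule slice_both_add) (rule tau_linear_right)
  have "\<tau> (u i j * c s s') (gen g * x) = slice_both (\<tau> (u i j)) (\<tau> (c s s')) (copU_gen g * copU x)"
    by (simp only: tau_mult_left copU_hom)
  also have "\<dots> = (\<Sum>k\<in>UNIV. \<Sum>t<n + 1. tgen n g i s k t * \<tau> (u k j * c t s') x)"
  proof (cases g)
    case GE
    show ?thesis unfolding GE copU_gen.simps add act sum.distrib [symmetric]
      by (intro sum.cong refl) (simp add: tgen_def r o distrib_right)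
  next
    case GF
    show ?thesis unfolding GF copU_gen.simps add act sum.distrib [symmetric]
      by (intro sum.cong refl) (simp add: tgen_def r o distrib_right)
  next
    case GK
    show ?thesis unfolding GK copU_gen.simps act
      by (intro sum.cong refl) (simp add: tgen_def r o)
  next
    case GKinv
    show ?thesis unfolding GKinv copU_gen.simps act
      by (intro sum.cong refl) (simp add: tgen_def r o)
  qed
  finally show ?thesis .
qed

lemma powr_eqI: "x + y = z \<Longrightarrow> q powr x * q powr y = q powr z"
  using q01 by (simp flip: powr_add)

text \<open>The four identities from here on are the entries of the intertwining relation for \<open>e\<close> and \<open>f\<close>.  Up to
  comparing exponents, those with a sum on the left are the recursions \<open>qint_Suc\<close>.\<close>

lemma emb_E0:
  assumes "s \<le> n"
  shows "q * rep_gen_entry q n GE s (Suc s) * emb0 n (Suc s) + q powr (1 / 2) * emb1 n (Suc s)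
    = emb0 n s * rep_gen_entry q (Suc n) GE s (Suc s)"
proof -
  define A B C where "A = sqrt (qint q (n - s))" and "B = sqrt (qint q (Suc s))" and "C = sqrt (qint q (Suc (n - s)))"
  have AA: "A * A = qint q (n - s)" and CC: "C * C = q * qint q (n - s) + q powr (- real (n - s))"
    unfolding qint_Suc(1)[symmetric] by (simp_all only: A_def C_def real_sqrt_mult_self abs_of_nonneg[OF qint_nonneg])
  have S: "Suc n - s = Suc (n - s)" "Suc n - Suc s = n - s" using assms by simp_all
  define K where "K = q powr (real (Suc n) / 2 - real s / 2)"
  have k1: "q powr (real n / 2 - real s) * q powr (real (Suc s) / 2) = K"
    unfolding K_def by (rule powr_eqI) (simp add: field_simps)
  have k2: "q powr (real s / 2) * q powr (real (Suc n) / 2 - real s) = K"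
    unfolding K_def by (rule powr_eqI) (simp add: field_simps)
  have k3: "q powr (1 / 2) * q powr ((real (Suc s) - real n - 1) / 2) = q powr (- real (n - s)) * K"
    unfolding K_def powr_add [symmetric] using assms by (intro arg_cong[where f = "\<lambda>e. q powr e"]) (simp add: of_nat_diff field_simps)
  have "q * rep_gen_entry q n GE s (Suc s) * emb0 n (Suc s) + q powr (1 / 2) * emb1 n (Suc s)
      = q * (A * A) * B * (q powr (real n / 2 - real s) * q powr (real (Suc s) / 2))
        + B * (q powr (1 / 2) * q powr ((real (Suc s) - real n - 1) / 2))"
    unfolding rep_entry_EF(1)[OF assms] emb0_def emb1_def S A_def B_def by (simp only: ac_simps)
  also have "\<dots> = B * (C * C) * K" unfolding k1 k3 AA CC by (simp add: algebra_simps)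
  also have "\<dots> = B * (C * C) * (q powr (real s / 2) * q powr (real (Suc n) / 2 - real s))" unfolding k2 ..
  also have "\<dots> = emb0 n s * rep_gen_entry q (Suc n) GE s (Suc s)"
    unfolding rep_entry_EF(1)[OF le_SucI[OF assms]] emb0_def S B_def C_def by (simp only: ac_simps)
  finally show ?thesis .
qed

lemma emb_E1:
  assumes "s < n"
  shows "rep_gen_entry q n GE s (Suc s) / q * emb1 n (Suc (Suc s))
    = emb1 n (Suc s) * rep_gen_entry q (Suc n) GE (Suc s) (Suc (Suc s))"
proof -
  define A B C where "A = sqrt (qint q (n - s))" and "B = sqrt (qint q (Suc s))" and "C = sqrt (qint q (Suc (Suc s)))"
  have le: "s \<le> n" "Suc s \<le> Suc n" using assms by simp_all
  have S: "Suc n - Suc s = n - s" by simp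
  have k: "1 / q * (q powr (real n / 2 - real s) * q powr ((real (Suc (Suc s)) - real n - 1) / 2))
      = q powr ((real (Suc s) - real n - 1) / 2) * q powr (real (Suc n) / 2 - real (Suc s))"
  proof -
    have "1 / q = q powr (- 1)" using q01 by (simp add: powr_minus_divide)
    then show ?thesis unfolding powr_add [symmetric]
      by (simp only: powr_add [symmetric]) (intro arg_cong[where f = "\<lambda>e. q powr e"], simp add: field_simps)
  qed
  have "rep_gen_entry q n GE s (Suc s) / q * emb1 n (Suc (Suc s))
      = A * B * C * (1 / q * (q powr (real n / 2 - real s) * q powr ((real (Suc (Suc s)) - real n - 1) / 2)))"
    unfolding rep_entry_EF(1)[OF le(1)] emb1_def A_def B_def C_def by simp
  also have "\<dots> = emb1 n (Suc s) * rep_gen_entry q (Suc n) GE (Suc s) (Suc (Suc s))"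
    unfolding k rep_entry_EF(1)[OF le(2)] emb1_def S A_def B_def C_def by (simp only: ac_simps)
  finally show ?thesis .
qed

lemma emb_F0:
  assumes "p < n"
  shows "rep_gen_entry q n GF (Suc p) p * emb0 n p = emb0 n (Suc p) * rep_gen_entry q (Suc n) GF (Suc p) p"
proof -
  have le: "p \<le> n" "p \<le> Suc n" using assms by simp_all
  have S: "Suc n - Suc p = n - p" by simp
  have k: "q powr (real p - real n / 2) * q powr (real p / 2) = q powr (real (Suc p) / 2) * q powr (real p - real (Suc n) / 2)"
    unfolding powr_add [symmetric] by (intro arg_cong[where f = "\<lambda>e. q powr e"]) (simp add: field_simps)
  have "rep_gen_entry q n GF (Suc p) p * emb0 n p = sqrt (qint q (n - p)) * sqrt (qint q (Suc p)) * sqrt (qint q (Suc n - p))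
      * (q powr (real p - real n / 2) * q powr (real p / 2))"
    unfolding rep_entry_EF(2)[OF le(1)] emb0_def by (simp only: ac_simps)
  also have "\<dots> = emb0 n (Suc p) * rep_gen_entry q (Suc n) GF (Suc p) p"
    unfolding k rep_entry_EF(2)[OF le(2)] emb0_def S by (simp only: ac_simps)
  finally show ?thesis .
qed

lemma emb_F1:
  assumes "s \<le> n"
  shows "q powr (- 1 / 2) * q powr (2 * real s - real n) * emb0 n s + rep_gen_entry q n GF s (s - 1) * emb1 n s
    = emb1 n (Suc s) * rep_gen_entry q (Suc n) GF (Suc s) s"
proof -
  define C D B where "C = sqrt (qint q (Suc n - s))" and "D = sqrt (qint q s)" and "B = sqrt (qint q (Suc s))"
  have DD: "D * D = qint q s" and BB: "B * B = qint q s / q + q powr (real s)"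
    unfolding qint_Suc(2)[symmetric] by (simp_all only: D_def B_def real_sqrt_mult_self abs_of_nonneg[OF qint_nonneg])
  define K where "K = q powr (3 * real s / 2 - real n - 1 / 2)"
  have F: "rep_gen_entry q n GF s (s - 1) * emb1 n s
      = C * (D * D) * (q powr (real s - 1 - real n / 2) * q powr ((real s - real n - 1) / 2))"
  proof (cases s)
    case 0
    then show ?thesis by (simp add: D_def qint_0)
  next
    case (Suc r)
    have r: "r \<le> n" "n - r = Suc n - s" "real r = real s - 1" using Suc assms by simp_all
    have "rep_gen_entry q n GF (Suc r) r = C * D * q powr (real s - 1 - real n / 2)"
      unfolding rep_entry_EF(2)[OF r(1)] r(2,3) C_def D_def Suc by simp
    then show ?thesis unfolding emb1_def D_def [symmetric] by (simp add: Suc)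
  qed
  have k1: "q powr (- 1 / 2) * q powr (2 * real s - real n) * q powr (real s / 2) = q powr (real s) * K"
    unfolding K_def powr_add [symmetric] by (intro arg_cong[where f = "\<lambda>e. q powr e"]) (simp add: field_simps)
  have k2: "q powr (real s - 1 - real n / 2) * q powr ((real s - real n - 1) / 2) = K / q"
  proof -
    have "K / q = K * q powr (- 1)" using q01 by (simp add: powr_minus_divide)
    then show ?thesis unfolding K_def powr_add [symmetric]
      by (simp only:) (intro arg_cong[where f = "\<lambda>e. q powr e"], simp add: field_simps)
  qed
  have k3: "q powr ((real (Suc s) - real n - 1) / 2) * q powr (real s - real (Suc n) / 2) = K"
    unfolding K_def by (rule powr_eqI) (simp add: field_simps)
  have "q powr (- 1 / 2) * q powr (2 * real s - real n) * emb0 n s + rep_gen_entry q n GF s (s - 1) * emb1 n s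
      = C * (q powr (real s) * K) + C * (D * D) * (K / q)"
    unfolding F k2 emb0_def C_def [symmetric] k1 [symmetric] by (simp only: ac_simps)
  also have "\<dots> = C * (B * B) * K" unfolding BB DD by (simp add: algebra_simps)
  also have "\<dots> = C * (B * B) * (q powr ((real (Suc s) - real n - 1) / 2) * q powr (real s - real (Suc n) / 2))"
    unfolding k3 ..
  also have "\<dots> = emb1 n (Suc s) * rep_gen_entry q (Suc n) GF (Suc s) s"
    unfolding rep_entry_EF(2)[OF le_SucI[OF assms]] emb1_def C_def B_def by (simp only: ac_simps)
  finally show ?thesis .
qed

text \<open>Both sides have at most two nonzero terms; where a shifted index leaves the range, \<open>emb0\<close> or \<open>emb1\<close>
  vanishes.\<close>

lemma emb_intertwines:
  assumes s: "s < n + 1" and p: "p < n + 2"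
  shows "(\<Sum>k\<in>UNIV. \<Sum>t<n + 1. tgen n g i s k t * emb n k t p)
    = (\<Sum>r<n + 2. emb n i s r * complex_of_real (rep_gen_entry q (Suc n) g r p))"
proof -
  have sn: "s \<le> n" using s by simp
  note R = sum_emb_column[OF p] sum_emb_row[OF s]
  have eq: "(\<Sum>k\<in>UNIV. \<Sum>t<n + 1. tgen n g i s k t * emb n k t p)
      = tgen n g i s False p * emb0 n p + tgen n g i s True (p - 1) * emb1 n p"
    by (rule R(1))
  show ?thesis
  proof (cases g)
    case GE
    show ?thesis
    proof (cases i)
      case False
      have "tgen n GE False s False p * emb0 n p + tgen n GE False s True (p - 1) * emb1 n p
          = emb0 n s * rep_gen_entry q (Suc n) GE s p"
      proof (cases "p = Suc s")
        case True
        have "tgen n GE False s False p * emb0 n p + tgen n GE False s True (p - 1) * emb1 n p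
           = complex_of_real (q * rep_gen_entry q n GE s (Suc s) * emb0 n (Suc s) + q powr (1 / 2) * emb1 n (Suc s))"
          unfolding True tgen_def by (simp add: tau_gen_values del: rep_gen_entry.simps)
        then show ?thesis unfolding emb_E0[OF sn] True by (simp del: rep_gen_entry.simps)
      next
        case False
        then have z: "rep_gen_entry q m GE s p = 0" for m by simp
        have "p = 0 \<or> p - 1 \<noteq> s" using False by auto
        then show ?thesis unfolding z using emb1_0[of n]
          by (auto simp: tgen_def tau_gen_values z simp del: rep_gen_entry.simps)
      qed
      then show ?thesis unfolding eq unfolding GE R(2) using False by simp
    next
      case True
      have "tgen n GE True s False p * emb0 n p + tgen n GE True s True (p - 1) * emb1 n p
          = emb1 n (Suc s) * rep_gen_entry q (Suc n) GE (Suc s) p"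
      proof (cases "p = Suc (Suc s)")
        case True
        have sl: "s < n" using True p by simp
        have "tgen n GE True s False p * emb0 n p + tgen n GE True s True (p - 1) * emb1 n p
           = complex_of_real (rep_gen_entry q n GE s (Suc s) / q * emb1 n (Suc (Suc s)))"
          unfolding True tgen_def by (simp add: tau_gen_values del: rep_gen_entry.simps)
        then show ?thesis unfolding emb_E1[OF sl] True by (simp del: rep_gen_entry.simps)
      next
        case False
        then have z: "rep_gen_entry q m GE (Suc s) p = 0" for m by simp
        have "p = 0 \<or> rep_gen_entry q n GE s (p - 1) = 0" using False by (cases p) auto
        then show ?thesis unfolding z using emb1_0[of n]
          by (auto simp: tgen_def tau_gen_values simp del: rep_gen_entry.simps)
      qed
      then show ?thesis unfolding eq unfolding GE R(2) using True by simp
    qed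
  next
    case GF
    show ?thesis
    proof (cases i)
      case False
      have "tgen n GF False s False p * emb0 n p + tgen n GF False s True (p - 1) * emb1 n p
          = emb0 n s * rep_gen_entry q (Suc n) GF s p"
      proof (cases "s = Suc p")
        case True
        have pl: "p < n" using True s by simp
        have "tgen n GF False s False p * emb0 n p + tgen n GF False s True (p - 1) * emb1 n p
           = complex_of_real (rep_gen_entry q n GF (Suc p) p * emb0 n p)"
          unfolding True tgen_def by (simp add: tau_gen_values del: rep_gen_entry.simps)
        then show ?thesis unfolding emb_F0[OF pl] True by (simp del: rep_gen_entry.simps)
      next
        case False
        then have z: "rep_gen_entry q m GF s p = 0" for m by simp
        show ?thesis unfolding z
          by (simp add: tgen_def tau_gen_values z del: rep_gen_entry.simps)
      qed
      then show ?thesis unfolding eq unfolding GF R(2) using False by simp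
    next
      case True
      have "tgen n GF True s False p * emb0 n p + tgen n GF True s True (p - 1) * emb1 n p
          = emb1 n (Suc s) * rep_gen_entry q (Suc n) GF (Suc s) p"
      proof (cases "s = p")
        case True
        have kk: "rep_gen_entry q n GKinv p p = q powr (2 * real p - real n)" by simp
        have "tgen n GF True s False p * emb0 n p + tgen n GF True s True (p - 1) * emb1 n p
           = complex_of_real (q powr (- 1 / 2) * q powr (2 * real s - real n) * emb0 n s + rep_gen_entry q n GF s (s - 1) * emb1 n s)"
          unfolding True tgen_def by (simp add: tau_gen_values kk del: rep_gen_entry.simps)
        then show ?thesis unfolding emb_F1[OF sn] unfolding True by (simp del: rep_gen_entry.simps)
      next
        case False
        then have z: "rep_gen_entry q m GF (Suc s) p = 0" "rep_gen_entry q m GKinv s p = 0" for m by simp_all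
        have "p = 0 \<or> rep_gen_entry q n GF s (p - 1) = 0" using False by (cases p) auto
        then show ?thesis unfolding z using emb1_0[of n]
          by (auto simp: tgen_def tau_gen_values z simp del: rep_gen_entry.simps)
      qed
      then show ?thesis unfolding eq unfolding GF R(2) using True by simp
    qed
  next
    case GK
    have k: "q * q powr (real n - 2 * real s) = q powr (real (Suc n) - 2 * real s)"
      "q powr (real n - 2 * real s) / q = q powr (real (Suc n) - 2 * real (Suc s))"
      using powr_eqI[of 1 "real n - 2 * real s" "real (Suc n) - 2 * real s"]
        powr_eqI[of "- 1" "real n - 2 * real s" "real (Suc n) - 2 * real (Suc s)"] q01
      by (simp_all add: powr_minus_divide)
    have k': "complex_of_real q * q powr (real n - 2 * real s) = q powr (real (Suc n) - 2 * real s)"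
      "complex_of_real (q powr (real n - 2 * real s)) / q = q powr (real (Suc n) - 2 * real (Suc s))"
      unfolding k [symmetric] by simp_all
    show ?thesis
    proof (cases i)
      case True
      then show ?thesis unfolding eq unfolding GK R(2) using emb1_0[of n]
        by (cases p; auto simp: tgen_def tau_gen_values k' [symmetric] simp del: of_nat_Suc)
    next
      case False
      then show ?thesis unfolding eq unfolding GK R(2)
        by (cases "p = s"; simp add: tgen_def tau_gen_values k' [symmetric] del: of_nat_Suc)
    qed
  next
    case GKinv
    have k: "q powr (2 * real s - real n) / q = q powr (2 * real s - real (Suc n))"
      "q * q powr (2 * real s - real n) = q powr (2 * real (Suc s) - real (Suc n))"
      using powr_eqI[of 1 "2 * real s - real n" "2 * real (Suc s) - real (Suc n)"]
        powr_eqI[of "- 1" "2 * real s - real n" "2 * real s - real (Suc n)"] q01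
      by (simp_all add: powr_minus_divide)
    have k': "complex_of_real (q powr (2 * real s - real n)) / q = q powr (2 * real s - real (Suc n))"
      "complex_of_real q * q powr (2 * real s - real n) = q powr (2 * real (Suc s) - real (Suc n))"
      unfolding k [symmetric] by simp_all
    show ?thesis
    proof (cases i)
      case True
      then show ?thesis unfolding eq unfolding GKinv R(2) using emb1_0[of n]
        by (cases p; auto simp: tgen_def tau_gen_values k' [symmetric] simp del: of_nat_Suc)
    next
      case False
      then show ?thesis unfolding eq unfolding GKinv R(2)
        by (cases "p = s"; simp add: tgen_def tau_gen_values k' [symmetric] del: of_nat_Suc)
    qed
  qed
qed

text \<open>The intertwining relation for generators is multiplicative, hence holds on all of \<open>U\<close>.\<close>

lemma tensor_embedding:
  assumes c: "\<And>s s' x. s < n + 1 \<Longrightarrow> s' < n + 1 \<Longrightarrow> \<tau> (c s s') x = rep q n x $$ (s, s')"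
    and s: "s < n + 1" and p: "p < n + 2"
  shows "(\<Sum>j\<in>UNIV. \<Sum>s'<n + 1. \<tau> (u i j * c s s') x * emb n j s' p)
    = (\<Sum>r<n + 2. emb n i s r * rep q (Suc n) x $$ (r, p))"
  using s
proof (induction x arbitrary: i s rule: falg_induct_left)
  case one
  have "(\<Sum>j\<in>UNIV. \<Sum>s'<n + 1. \<tau> (u i j * c s s') 1 * emb n j s' p)
      = (\<Sum>j\<in>UNIV. \<Sum>s'<n + 1. (if i = j \<and> s = s' then 1 else 0) * emb n j s' p)"
  proof (intro sum.cong refl)
    fix j s' assume "s' \<in> {..<n + 1}"
    then have "counA (c s s') = (if s = s' then 1 else 0)"
      using c[of s s' 1] one by (simp add: tau_one rep_entry_one)
    then show "\<tau> (u i j * c s s') 1 * emb n j s' p = (if i = j \<and> s = s' then 1 else 0) * emb n j s' p"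
      by (simp add: tau_one counA_hom)
  qed
  also have "\<dots> = emb n i s p"
  proof -
    have "(\<Sum>s'<n + 1. (if i = j \<and> s = s' then 1 else 0) * emb n j s' p) = (if i = j then emb n i s p else 0)" for j
    proof -
      have "(\<Sum>s'<n + 1. (if i = j \<and> s = s' then 1 else 0) * emb n j s' p)
          = (\<Sum>s'<n + 1. if s' = s then (if i = j then emb n i s p else 0) else 0)"
        by (intro sum.cong) auto
      then show ?thesis using one by simp
    qed
    then show ?thesis by (cases i) (simp_all only: sum_bool, simp_all)
  qed
  also have "\<dots> = (\<Sum>r<n + 2. emb n i s r * rep q (Suc n) 1 $$ (r, p))"
  proof -
    have "(\<Sum>r<n + 2. emb n i s r * rep q (Suc n) 1 $$ (r, p)) = (\<Sum>r<n + 2. if r = p then emb n i s p else 0)"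
      using p by (intro sum.cong) (auto simp: rep_entry_one)
    then show ?thesis using p by simp
  qed
  finally show ?case .
next
  case (add x y)
  have l: "rep q (Suc n) (x + y) $$ (r, p) = rep q (Suc n) x $$ (r, p) + rep q (Suc n) y $$ (r, p)" if "r < n + 2" for r
    by (rule linear_functionalD(1)[OF falgU_linear_entry]) (use that p in simp_all)
  have "(\<Sum>r<n + 2. emb n i s r * rep q (Suc n) (x + y) $$ (r, p))
     = (\<Sum>r<n + 2. emb n i s r * rep q (Suc n) x $$ (r, p)) + (\<Sum>r<n + 2. emb n i s r * rep q (Suc n) y $$ (r, p))"
    unfolding sum.distrib [symmetric] by (intro sum.cong) (simp_all add: l distrib_left)
  then show ?case using add
    by (simp only: linear_functionalD(1)[OF tau_linear_right] distrib_right sum.distrib)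
next
  case (scale k x)
  have l: "rep q (Suc n) (sc k * x) $$ (r, p) = k * rep q (Suc n) x $$ (r, p)" if "r < n + 2" for r
    by (rule rep_scale_entry) (use that p in simp_all)
  have "(\<Sum>r<n + 2. emb n i s r * rep q (Suc n) (sc k * x) $$ (r, p))
     = k * (\<Sum>r<n + 2. emb n i s r * rep q (Suc n) x $$ (r, p))"
    unfolding sum_distrib_left by (intro sum.cong) (simp_all add: l)
  then show ?case using scale
    by (simp only: linear_functionalD(2)[OF tau_linear_right] mult.assoc sum_distrib_left [symmetric])
next
  case (gen g x)
  have "(\<Sum>j\<in>UNIV. \<Sum>s'<n + 1. \<tau> (u i j * c s s') (gen g * x) * emb n j s' p)
      = (\<Sum>j\<in>UNIV. \<Sum>s'<n + 1. (\<Sum>k\<in>UNIV. \<Sum>t<n + 1. tgen n g i s k t * (\<tau> (u k j * c t s') x * emb n j s' p)))"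
    by (intro sum.cong refl)
      (simp only: tau_tgen[of n c, OF c gen.prems] lessThan_iff sum_distrib_right mult.assoc)
  also have "\<dots> = (\<Sum>k\<in>UNIV. \<Sum>t<n + 1. tgen n g i s k t * (\<Sum>j\<in>UNIV. \<Sum>s'<n + 1. \<tau> (u k j * c t s') x * emb n j s' p))"
    unfolding sum_distrib_left by (rule sum_swap_pairs)
  also have "\<dots> = (\<Sum>k\<in>UNIV. \<Sum>t<n + 1. tgen n g i s k t * (\<Sum>r<n + 2. emb n k t r * rep q (Suc n) x $$ (r, p)))"
    by (intro sum.cong refl) (simp only: gen.IH lessThan_iff)
  also have "\<dots> = (\<Sum>r<n + 2. (\<Sum>k\<in>UNIV. \<Sum>t<n + 1. tgen n g i s k t * emb n k t r) * rep q (Suc n) x $$ (r, p))"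
    unfolding sum_distrib_left sum_distrib_right mult.assoc by (rule sum_rotate)
  also have "\<dots> = (\<Sum>r<n + 2. (\<Sum>r'<n + 2. emb n i s r' * complex_of_real (rep_gen_entry q (Suc n) g r' r)) * rep q (Suc n) x $$ (r, p))"
    by (intro sum.cong refl) (simp only: emb_intertwines[OF gen.prems] lessThan_iff)
  also have "\<dots> = (\<Sum>r'<n + 2. emb n i s r' * (\<Sum>r<n + 2. complex_of_real (rep_gen_entry q (Suc n) g r' r) * rep q (Suc n) x $$ (r, p)))"
    unfolding sum_distrib_left sum_distrib_right mult.assoc by (rule sum.swap)
  also have "\<dots> = (\<Sum>r'<n + 2. emb n i s r' * rep q (Suc n) (gen g * x) $$ (r', p))"
  proof (intro sum.cong refl)
    fix r' assume "r' \<in> {..<n + 2}"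
    then have "r' < Suc n + 1" "p < Suc n + 1" using p by simp_all
    from rep_entry_gen_mult[OF this, of q g x]
    show "emb n i s r' * (\<Sum>r<n + 2. complex_of_real (rep_gen_entry q (Suc n) g r' r) * rep q (Suc n) x $$ (r, p))
        = emb n i s r' * rep q (Suc n) (gen g * x) $$ (r', p)"
      by (simp only: Suc_eq_plus1 add.assoc one_add_one)
  qed
  finally show ?case .
qed

text \<open>Induction on the spin: compressing the products of matrix coefficients of spin \<open>1 / 2\<close> and \<open>n / 2\<close>
  with the embedding gives those of spin \<open>(n + 1) / 2\<close>.  As the embedding preserves highest weight
  vectors, the coefficient of the highest weight vector can be followed along: it is \<open>\<alpha>\<^sup>n\<close>.\<close>

lemma matrix_coeff_exists:
  "(\<exists>c. \<forall>s<n + 1. \<forall>s'<n + 1. \<forall>x. \<tau> (c s s') x = rep q n x $$ (s, s'))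
    \<and> (\<forall>x. \<tau> (al ^ n) x = rep q n x $$ (0, 0))"
proof (induction n)
  case 0
  have "counU x = rep q 0 x $$ (0, 0)" for x
  proof (induction x rule: falg_induct_left)
    case one
    then show ?case by (simp add: counU_hom rep_entry_one)
  next
    case (add x y)
    then show ?case using linear_functionalD(1)[OF falgU_linear_entry, of 0 0 0 q x y] by (simp add: counU_hom)
  next
    case (scale c x)
    then show ?case using rep_scale_entry[of 0 0 0 q c x] by (simp add: counU_hom)
  next
    case (gen g x)
    have "complex_of_real (rep_gen_entry q 0 g 0 0) = counU_gen g" using q01 by (cases g) simp_all
    then show ?case using rep_entry_gen_mult[of 0 0 0 q g x] gen by (simp add: counU_hom)
  qed
  then show ?case by (auto intro!: exI[of _ "\<lambda>_ _. 1"] simp: tau_one)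
next
  case (Suc n)
  then obtain c0 where c0: "\<And>s s' x. s < n + 1 \<Longrightarrow> s' < n + 1 \<Longrightarrow> \<tau> (c0 s s') x = rep q n x $$ (s, s')"
    and a: "\<And>x. \<tau> (al ^ n) x = rep q n x $$ (0, 0)" by blast
  \<comment> \<open>choosing \<open>\<alpha>\<^sup>n\<close> as the coefficient at the highest weight vector lets it be followed\<close>
  define c where "c s s' = (if s = 0 \<and> s' = 0 then al ^ n else c0 s s')" for s s'
  have c: "\<tau> (c s s') x = rep q n x $$ (s, s')" if "s < n + 1" "s' < n + 1" for s s' x
    using c0[OF that] a by (auto simp: c_def)
  note emb = tensor_embedding[of n c, OF c]
  define N where "N = complex_of_real (qint q (Suc n))"
  have N: "N \<noteq> 0" using qint_pos[of n] by (simp add: N_def)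
  define c' where "c' r p = (\<Sum>i\<in>UNIV. \<Sum>s<n + 1. \<Sum>j\<in>UNIV. \<Sum>s'<n + 1.
      sc (1 / N * emb n i s r * emb n j s' p) * (u i j * c s s'))" for r p
  have "\<tau> (c' r p) x = rep q (Suc n) x $$ (r, p)" if r: "r < n + 2" and p: "p < n + 2" for r p x
  proof -
    have "\<tau> (c' r p) x = (\<Sum>i\<in>UNIV. \<Sum>s<n + 1. \<Sum>j\<in>UNIV. \<Sum>s'<n + 1.
        1 / N * (emb n i s r * (\<tau> (u i j * c s s') x * emb n j s' p)))"
      unfolding c'_def linear_functional_sum[OF tau_linear_left] linear_functionalD(2)[OF tau_linear_left]
      by (simp only: ac_simps)
    also have "\<dots> = 1 / N * (\<Sum>i\<in>UNIV. \<Sum>s<n + 1. emb n i s r * (\<Sum>j\<in>UNIV. \<Sum>s'<n + 1. \<tau> (u i j * c s s') x * emb n j s' p))"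
      by (simp only: sum_distrib_left)
    also have "\<dots> = 1 / N * (\<Sum>i\<in>UNIV. \<Sum>s<n + 1. emb n i s r * (\<Sum>k<n + 2. emb n i s k * rep q (Suc n) x $$ (k, p)))"
    proof -
      have "(\<Sum>i\<in>UNIV. \<Sum>s<n + 1. emb n i s r * (\<Sum>j\<in>UNIV. \<Sum>s'<n + 1. \<tau> (u i j * c s s') x * emb n j s' p))
          = (\<Sum>i\<in>UNIV. \<Sum>s<n + 1. emb n i s r * (\<Sum>k<n + 2. emb n i s k * rep q (Suc n) x $$ (k, p)))"
        by (intro sum.cong refl) (simp only: emb p lessThan_iff)
      then show ?thesis by (simp only:)
    qed
    also have "\<dots> = 1 / N * (\<Sum>k<n + 2. (\<Sum>i\<in>UNIV. \<Sum>s<n + 1. emb n i s r * emb n i s k) * rep q (Suc n) x $$ (k, p))"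
    proof -
      have "(\<Sum>i\<in>UNIV. \<Sum>s<n + 1. emb n i s r * (\<Sum>k<n + 2. emb n i s k * rep q (Suc n) x $$ (k, p)))
          = (\<Sum>k<n + 2. (\<Sum>i\<in>UNIV. \<Sum>s<n + 1. emb n i s r * emb n i s k) * rep q (Suc n) x $$ (k, p))"
        unfolding sum_distrib_left sum_distrib_right mult.assoc by (rule sum_rotate)
      then show ?thesis by (simp only:)
    qed
    also have "(\<Sum>k<n + 2. (\<Sum>i\<in>UNIV. \<Sum>s<n + 1. emb n i s r * emb n i s k) * rep q (Suc n) x $$ (k, p))
        = (\<Sum>k<n + 2. (if r = k then complex_of_real (qint q (Suc n)) else 0) * rep q (Suc n) x $$ (k, p))"
      by (intro sum.cong refl) (simp only: emb_isometry r lessThan_iff, simp)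
    also have "\<dots> = (\<Sum>k<n + 2. if k = r then N * rep q (Suc n) x $$ (r, p) else 0)"
      by (intro sum.cong) (auto simp: N_def)
    also have "\<dots> = N * rep q (Suc n) x $$ (r, p)" using r by simp
    finally show ?thesis using N by simp
  qed
  moreover have "\<tau> (al ^ Suc n) x = rep q (Suc n) x $$ (0, 0)" for x
  proof -
    have e1: "emb1 n 0 = 0" by (rule emb1_0)
    have e0: "complex_of_real (emb0 n 0) \<noteq> 0" using qint_pos[of n] q01 by (simp add: emb0_def)
    have "(\<Sum>j\<in>UNIV. \<Sum>s'<n + 1. \<tau> (u False j * c 0 s') x * emb n j s' 0)
        = (\<Sum>r<n + 2. emb n False 0 r * rep q (Suc n) x $$ (r, 0))"
      by (rule emb) simp_all
    moreover have "(\<Sum>j\<in>UNIV. \<Sum>s'<n + 1. \<tau> (u False j * c 0 s') x * emb n j s' 0) = \<tau> (u False False * c 0 0) x * emb0 n 0"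
      using sum_emb_column[of 0 n "\<lambda>j s'. \<tau> (u False j * c 0 s') x"] e1 by simp
    moreover have "(\<Sum>r<n + 2. emb n False 0 r * rep q (Suc n) x $$ (r, 0)) = emb0 n 0 * rep q (Suc n) x $$ (0, 0)"
      using sum_emb_row[of 0 n False "\<lambda>r. rep q (Suc n) x $$ (r, 0)"] by simp
    ultimately have "\<tau> (u False False * c 0 0) x = rep q (Suc n) x $$ (0, 0)" using e0 by simp
    then show ?thesis by (simp add: c_def)
  qed
  ultimately show ?case by (intro conjI exI[of _ c']) simp_all
qed

end

section \<open>The Dirac functions\<close>

context pairing
begin

lemma tau_matrix_coeff:
  assumes "r < n + 1" "p < n + 1"
  shows "\<tau> (matrix_coeff q \<tau> n r p) x = rep q n x $$ (r, p)"
proof -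
  have "\<exists>c. \<forall>x. \<tau> c x = rep q n x $$ (r, p)" using matrix_coeff_exists[of n] assms by blast
  then have "\<forall>x. \<tau> (matrix_coeff q \<tau> n r p) x = rep q n x $$ (r, p)"
    unfolding matrix_coeff_def by (rule someI_ex)
  then show ?thesis by blast
qed

text \<open>The coproduct of a matrix coefficient is known only through the pairing, that is, when both legs
  are tested against \<open>U\<close>.  Non-degeneracy is applied twice to replace these tests by arbitrary
  functionals, one leg at a time.\<close>

lemma dual_matrix_coeff_conv:
  assumes w: "\<omega> \<in> dualA q" and c: "\<chi> \<in> dualA q" and rp: "r < n + 1" "p < n + 1"
  shows "conv \<omega> \<chi> (matrix_coeff q \<tau> n r p)
    = (\<Sum>s<n + 1. \<omega> (matrix_coeff q \<tau> n r s) * \<chi> (matrix_coeff q \<tau> n s p))"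
proof -
  let ?m = "matrix_coeff q \<tau> n"
  note W = dualA_linear[OF w] and C = dualA_linear[OF c]
  have e1: "eqA q (slice_left (\<lambda>v. \<tau> v x) (copA (?m r p))) (\<Sum>s<n + 1. sc (\<tau> (?m r s) x) * ?m s p)" for x
  proof (rule tau_nondegenerate)
    fix y
    have "(\<Sum>s<n + 1. \<tau> (?m r s) x * \<tau> (?m s p) y) = (\<Sum>s<n + 1. rep q n x $$ (r, s) * rep q n y $$ (s, p))"
      by (intro sum.cong refl) (simp only: tau_matrix_coeff rp lessThan_iff)
    then show "\<tau> (slice_left (\<lambda>v. \<tau> v x) (copA (?m r p))) y = \<tau> (\<Sum>s<n + 1. sc (\<tau> (?m r s) x) * ?m s p) y"
      unfolding tau_slice linear_functional_sum[OF tau_linear_left] linear_functionalD(2)[OF tau_linear_left]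
        tau_matrix_coeff[OF rp] rep_entry_mult[OF rp] by simp
  qed
  have e2: "eqA q (slice_right \<chi> (copA (?m r p))) (\<Sum>s<n + 1. sc (\<chi> (?m s p)) * ?m r s)"
  proof (rule tau_nondegenerate)
    fix x
    have "\<tau> (slice_right \<chi> (copA (?m r p))) x = conv (\<lambda>v. \<tau> v x) \<chi> (?m r p)"
      by (rule conv_eval_right [symmetric]) (rule tau_linear_left)
    also have "\<dots> = \<chi> (slice_left (\<lambda>v. \<tau> v x) (copA (?m r p)))"
      by (rule conv_eval_left) (rule C)
    also have "\<dots> = \<chi> (\<Sum>s<n + 1. sc (\<tau> (?m r s) x) * ?m s p)"
      by (rule dualA_eqA[OF c e1])
    also have "\<dots> = \<tau> (\<Sum>s<n + 1. sc (\<chi> (?m s p)) * ?m r s) x"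
      unfolding linear_functional_sum[OF C] linear_functional_sum[OF tau_linear_left]
        linear_functionalD(2)[OF C] linear_functionalD(2)[OF tau_linear_left] by (simp only: mult.commute)
    finally show "\<tau> (slice_right \<chi> (copA (?m r p))) x = \<tau> (\<Sum>s<n + 1. sc (\<chi> (?m s p)) * ?m r s) x" .
  qed
  have "conv \<omega> \<chi> (?m r p) = \<omega> (slice_right \<chi> (copA (?m r p)))" by (rule conv_eval_right) (rule W)
  also have "\<dots> = \<omega> (\<Sum>s<n + 1. sc (\<chi> (?m s p)) * ?m r s)" by (rule dualA_eqA[OF w e2])
  finally show ?thesis
    unfolding linear_functional_sum[OF W] linear_functionalD(2)[OF W] by (simp only: mult.commute)
qed

lemma dual_star_matrix_coeff:
  assumes w: "\<omega> \<in> dualA q" and rp: "r < n + 1" "p < n + 1"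
  shows "dual_star q \<omega> (matrix_coeff q \<tau> n r p) = cnj (\<omega> (matrix_coeff q \<tau> n p r))"
proof -
  let ?m = "matrix_coeff q \<tau> n"
  have "eqA q (starA q (antA q (?m r p))) (?m p r)"
  proof (rule tau_nondegenerate)
    fix x
    have "cnj (\<tau> (starA q (antA q (?m r p))) x) = cnj (\<tau> (?m p r) x)"
      unfolding tau_star_right [symmetric] tau_matrix_coeff[OF rp] tau_matrix_coeff[OF rp(2,1)]
        rep_star[OF q01(1) rp] ..
    then show "\<tau> (starA q (antA q (?m r p))) x = \<tau> (?m p r) x" by simp
  qed
  then show ?thesis unfolding dual_star_def by (simp only: dualA_eqA[OF w])
qed

end

context qsphere
begin

text \<open>Acting with \<open>\<alpha>\<close> moves the extreme point of the support one step towards 0, multiplying the value there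
  by a diagonal entry of a projection, and these are nonzero.\<close>

lemma om_al_power:
  shows "f (int k) \<noteq> 0 \<Longrightarrow> (\<And>m. m < int k \<Longrightarrow> f m = 0) \<Longrightarrow> om f (al ^ k) \<noteq> 0"
    and "f (- int k) \<noteq> 0 \<Longrightarrow> (\<And>m. m > - int k \<Longrightarrow> f m = 0) \<Longrightarrow> om f (al ^ k) \<noteq> 0"
proof -
  have nz: "prj (nu n) GAlpha \<noteq> 0" "prj (1 / nu n) GAlpha \<noteq> 0" for n
    using nu_den[of n] by auto
  show "f (int k) \<noteq> 0 \<Longrightarrow> (\<And>m. m < int k \<Longrightarrow> f m = 0) \<Longrightarrow> om f (al ^ k) \<noteq> 0"
  proof (induction k arbitrary: f)
    case (Suc k)
    have "om (act GAlpha f) (al ^ k) \<noteq> 0"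
    proof (rule Suc.IH)
      have "f (int k - 1) = 0" by (rule Suc.prems(2)) simp
      moreover have "f (int k + 1) \<noteq> 0" using Suc.prems(1) by (simp add: add.commute)
      ultimately show "act GAlpha f (int k) \<noteq> 0" unfolding act_def using nz by simp
      fix m assume "m < int k"
      then have "f (m + 1) = 0" "f (m - 1) = 0" by (auto intro!: Suc.prems(2))
      then show "act GAlpha f m = 0" by (simp add: act_def)
    qed
    then show ?case by (simp only: power_Suc om_ract acts_gen not_False_eq_True)
  qed (simp add: om_one)
  show "f (- int k) \<noteq> 0 \<Longrightarrow> (\<And>m. m > - int k \<Longrightarrow> f m = 0) \<Longrightarrow> om f (al ^ k) \<noteq> 0"
  proof (induction k arbitrary: f)
    case (Suc k)
    have "om (act GAlpha f) (al ^ k) \<noteq> 0"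
    proof (rule Suc.IH)
      have "f (- int k + 1) = 0" by (rule Suc.prems(2)) simp
      moreover have "- int (Suc k) = - int k - 1" by simp
      with Suc.prems(1) have "f (- int k - 1) \<noteq> 0" by metis
      ultimately show "act GAlpha f (- int k) \<noteq> 0" unfolding act_def using nz by simp
      fix m assume "m > - int k"
      then have "f (m + 1) = 0" "f (m - 1) = 0" by (auto intro!: Suc.prems(2))
      then show "act GAlpha f m = 0" by (simp add: act_def)
    qed
    then show ?case by (simp only: power_Suc om_ract acts_gen not_False_eq_True)
  qed (simp add: om_one)
qed

text \<open>The function \<open>f\<close> of the operator \<open>i B\<^sub>t\<close> in the representation of spin \<open>m / 2\<close>; the next lemmas say
  that \<open>om_rep m\<close> is a functional calculus.\<close>

definition om_rep :: "nat \<Rightarrow> (int \<Rightarrow> complex) \<Rightarrow> complex mat" where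
  "om_rep m f = dual_rep q \<tau> m (om f)"

lemma om_rep_carrier [simp]: "om_rep m f \<in> carrier_mat (m + 1) (m + 1)"
  by (simp add: om_rep_def dual_rep_def)

lemma om_rep_dim [simp]: "dim_row (om_rep m f) = m + 1" "dim_col (om_rep m f) = m + 1"
  by (simp_all add: om_rep_def dual_rep_def)

lemma om_rep_entry: "r < m + 1 \<Longrightarrow> p < m + 1 \<Longrightarrow> om_rep m f $$ (r, p) = om f (matrix_coeff q \<tau> m r p)"
  by (simp add: om_rep_def dual_rep_def)

lemma om_rep_mult: "om_rep m (\<lambda>n. f n * g n) = om_rep m f * om_rep m g"
proof (rule eq_matI)
  fix i j assume "i < dim_row (om_rep m f * om_rep m g)" "j < dim_col (om_rep m f * om_rep m g)"
  then have ij: "i < m + 1" "j < m + 1" by simp_all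
  have "(om_rep m f * om_rep m g) $$ (i, j) = (\<Sum>s<m + 1. Matrix.row (om_rep m f) i $ s * col (om_rep m g) j $ s)"
    using ij by (simp add: scalar_prod_def atLeast0LessThan del: sum.lessThan_Suc)
  also have "\<dots> = (\<Sum>s<m + 1. om f (matrix_coeff q \<tau> m i s) * om g (matrix_coeff q \<tau> m s j))"
    using ij by (intro sum.cong) (simp_all add: om_rep_entry)
  also have "\<dots> = om_rep m (\<lambda>n. f n * g n) $$ (i, j)"
    unfolding om_rep_entry[OF ij] om_conv [symmetric] dual_matrix_coeff_conv[OF om_dualA om_dualA ij] ..
  finally show "om_rep m (\<lambda>n. f n * g n) $$ (i, j) = (om_rep m f * om_rep m g) $$ (i, j)" ..
qed simp_all

lemma om_rep_one: "om_rep m (\<lambda>n. 1) = 1\<^sub>m (m + 1)"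
proof (rule eq_matI)
  fix i j assume "i < dim_row (1\<^sub>m (m + 1))" "j < dim_col (1\<^sub>m (m + 1))"
  then have ij: "i < m + 1" "j < m + 1" by simp_all
  show "om_rep m (\<lambda>n. 1) $$ (i, j) = 1\<^sub>m (m + 1) $$ (i, j)"
    unfolding om_rep_entry[OF ij] om_counA tau_one(2)[symmetric] tau_matrix_coeff[OF ij] rep_one ..
qed simp_all

lemma om_rep_eigval: "om_rep m eigval = rep q m iB"
proof (rule eq_matI)
  fix i j assume "i < dim_row (rep q m iB)" "j < dim_col (rep q m iB)"
  then have ij: "i < m + 1" "j < m + 1" by simp_all
  show "om_rep m eigval $$ (i, j) = rep q m iB $$ (i, j)"
    unfolding om_rep_entry[OF ij] tau_iB [symmetric] tau_matrix_coeff[OF ij] ..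
qed simp_all

lemma om_rep_add: "om_rep m (\<lambda>n. f n + g n) = om_rep m f + om_rep m g"
  by (rule eq_matI) (simp_all add: om_rep_entry om_fun_linear)

lemma om_rep_scale: "om_rep m (\<lambda>n. c * f n) = c \<cdot>\<^sub>m om_rep m f"
  by (rule eq_matI) (simp_all add: om_rep_entry om_fun_linear)

lemma om_rep_adjoint: "mat_adjoint (om_rep m f) = om_rep m (\<lambda>n. cnj (f n))"
proof (rule eq_matI)
  fix i j assume "i < dim_row (om_rep m (\<lambda>n. cnj (f n)))" "j < dim_col (om_rep m (\<lambda>n. cnj (f n)))"
  then have ij: "i < m + 1" "j < m + 1" by simp_all
  have "mat_adjoint (om_rep m f) $$ (i, j) = cnj (om f (matrix_coeff q \<tau> m j i))"
    using ij by (simp add: mat_adjoint_def mat_of_rows_def om_rep_entry)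
  also have "\<dots> = om_rep m (\<lambda>n. cnj (f n)) $$ (i, j)"
    unfolding om_rep_entry[OF ij] om_star [symmetric] dual_star_matrix_coeff[OF om_dualA ij] ..
  finally show "mat_adjoint (om_rep m f) $$ (i, j) = om_rep m (\<lambda>n. cnj (f n)) $$ (i, j)" .
qed (simp_all add: mat_adjoint_def)

lemma om_vec:
  assumes v: "v \<in> carrier_vec (m + 1)"
  shows om_vec_mult: "om_rep m f *\<^sub>v (om_rep m g *\<^sub>v v) = om_rep m (\<lambda>n. f n * g n) *\<^sub>v v"
    and om_vec_one: "om_rep m (\<lambda>n. 1) *\<^sub>v v = v"
    and om_vec_add: "om_rep m (\<lambda>n. f n + g n) *\<^sub>v v = om_rep m f *\<^sub>v v + om_rep m g *\<^sub>v v"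
    and om_vec_scale: "om_rep m (\<lambda>n. c * f n) *\<^sub>v v = c \<cdot>\<^sub>v (om_rep m f *\<^sub>v v)"
    and om_vec_smult: "om_rep m f *\<^sub>v (c \<cdot>\<^sub>v v) = c \<cdot>\<^sub>v (om_rep m f *\<^sub>v v)"
    and om_vec_carrier: "om_rep m f *\<^sub>v v \<in> carrier_vec (m + 1)"
proof -
  show "om_rep m f *\<^sub>v (om_rep m g *\<^sub>v v) = om_rep m (\<lambda>n. f n * g n) *\<^sub>v v"
    unfolding om_rep_mult by (rule assoc_mult_mat_vec [symmetric, OF om_rep_carrier om_rep_carrier v])
  show "om_rep m (\<lambda>n. 1) *\<^sub>v v = v" unfolding om_rep_one using v by (rule one_mult_mat_vec)
  show "om_rep m (\<lambda>n. f n + g n) *\<^sub>v v = om_rep m f *\<^sub>v v + om_rep m g *\<^sub>v v"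
    unfolding om_rep_add by (rule add_mult_distrib_mat_vec[OF om_rep_carrier om_rep_carrier v])
  show "om_rep m (\<lambda>n. c * f n) *\<^sub>v v = c \<cdot>\<^sub>v (om_rep m f *\<^sub>v v)"
    unfolding om_rep_scale using v by (intro eq_vecI) simp_all
  show "om_rep m f *\<^sub>v (c \<cdot>\<^sub>v v) = c \<cdot>\<^sub>v (om_rep m f *\<^sub>v v)"
    by (rule mult_mat_vec[OF om_rep_carrier v])
  show "om_rep m f *\<^sub>v v \<in> carrier_vec (m + 1)" by (rule mult_mat_vec_carrier[OF om_rep_carrier v])
qed

text \<open>The functional calculus turns the indicator function of \<open>n\<close> into a projection, and
  \<open>([a + k] - [a + n]) \<delta>\<^sub>n(k) = 0\<close> puts its range into the eigenspace.  For the reverse inclusion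
  the reduced resolvent \<open>g\<close> of \<open>i B\<^sub>t\<close> at \<open>[a + n]\<close> shows that an eigenvector has no component in the
  complementary range.\<close>

lemma om_rep_delta_projection: "orth_eigenprojection (m + 1) (rep q m iB) (eigval n) (om_rep m (delta n))"
  unfolding orth_eigenprojection_def
proof (intro conjI equalityI subsetI)
  show "om_rep m (delta n) \<in> carrier_mat (m + 1) (m + 1)" by (rule om_rep_carrier)
  have "(\<lambda>k. delta n k * delta n k) = delta n" by (auto simp: delta_def)
  then show "om_rep m (delta n) * om_rep m (delta n) = om_rep m (delta n)" unfolding om_rep_mult [symmetric] by simp
  have "(\<lambda>k. cnj (delta n k)) = delta n" by (auto simp: delta_def)
  then show "mat_adjoint (om_rep m (delta n)) = om_rep m (delta n)" unfolding om_rep_adjoint by simp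
next
  fix v assume "v \<in> {v \<in> carrier_vec (m + 1). om_rep m (delta n) *\<^sub>v v = v}"
  then have v: "v \<in> carrier_vec (m + 1)" and e: "om_rep m (delta n) *\<^sub>v v = v" by simp_all
  have qd: "(\<lambda>k. eigval k * delta n k) = (\<lambda>k. eigval n * delta n k)" by (auto simp: delta_def)
  have "rep q m iB *\<^sub>v v = om_rep m eigval *\<^sub>v (om_rep m (delta n) *\<^sub>v v)" by (simp only: e om_rep_eigval)
  also have "\<dots> = eigval n \<cdot>\<^sub>v (om_rep m (delta n) *\<^sub>v v)" unfolding om_vec_mult[OF v] qd om_vec_scale[OF v] ..
  finally have "rep q m iB *\<^sub>v v = eigval n \<cdot>\<^sub>v v" by (simp only: e)
  with v show "v \<in> {v \<in> carrier_vec (m + 1). rep q m iB *\<^sub>v v = eigval n \<cdot>\<^sub>v v}" by simp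
next
  fix v assume "v \<in> {v \<in> carrier_vec (m + 1). rep q m iB *\<^sub>v v = eigval n \<cdot>\<^sub>v v}"
  then have v: "v \<in> carrier_vec (m + 1)" and e: "om_rep m eigval *\<^sub>v v = eigval n \<cdot>\<^sub>v v" by (simp_all add: om_rep_eigval)
  \<comment> \<open>the reduced resolvent of \<open>i B\<^sub>t\<close> at \<open>[a + n]\<close>\<close>
  define g where "g k = (if k = n then 0 else 1 / (eigval k - eigval n))" for k
  have g: "(\<lambda>k. g k * eigval k) = (\<lambda>k. eigval n * g k + (1 - delta n k))"
  proof
    fix k
    show "g k * eigval k = eigval n * g k + (1 - delta n k)"
      using eigval_inj[of k n] by (cases "k = n") (auto simp: g_def delta_def divide_simps)
  qed
  let ?w = "om_rep m (\<lambda>k. 1 - delta n k) *\<^sub>v v"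
  have gv: "om_rep m g *\<^sub>v v \<in> carrier_vec (m + 1)" and w: "?w \<in> carrier_vec (m + 1)"
    by (rule om_vec_carrier[OF v])+
  have "eigval n \<cdot>\<^sub>v (om_rep m g *\<^sub>v v) = om_rep m g *\<^sub>v (om_rep m eigval *\<^sub>v v)" unfolding e om_vec_smult[OF v] ..
  also have "\<dots> = eigval n \<cdot>\<^sub>v (om_rep m g *\<^sub>v v) + ?w"
    unfolding om_vec_mult[OF v] g om_vec_add[OF v] om_vec_scale[OF v] ..
  finally have eq: "eigval n \<cdot>\<^sub>v (om_rep m g *\<^sub>v v) = eigval n \<cdot>\<^sub>v (om_rep m g *\<^sub>v v) + ?w" .
  have w0: "?w = 0\<^sub>v (m + 1)"
  proof (rule eq_vecI)
    fix i assume i: "i < dim_vec (0\<^sub>v (m + 1) :: complex vec)"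
    have "(eigval n \<cdot>\<^sub>v (om_rep m g *\<^sub>v v)) $ i = (eigval n \<cdot>\<^sub>v (om_rep m g *\<^sub>v v) + ?w) $ i" using eq by simp
    also have "\<dots> = (eigval n \<cdot>\<^sub>v (om_rep m g *\<^sub>v v)) $ i + ?w $ i" using i w by (intro index_add_vec) simp
    finally show "?w $ i = 0\<^sub>v (m + 1) $ i" using i by simp
  qed (use w in simp)
  have "(\<lambda>k. delta n k + (1 - delta n k)) = (\<lambda>k. 1)" by simp
  then have "v = om_rep m (\<lambda>k. delta n k + (1 - delta n k)) *\<^sub>v v" using om_vec_one[OF v] by simp
  also have "\<dots> = om_rep m (delta n) *\<^sub>v v + 0\<^sub>v (m + 1)" unfolding om_vec_add[OF v] w0 ..
  also have "\<dots> = om_rep m (delta n) *\<^sub>v v" using om_vec_carrier[OF v, of "delta n"] by simp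
  finally show "v \<in> {v \<in> carrier_vec (m + 1). om_rep m (delta n) *\<^sub>v v = v}" using v by simp
qed

text \<open>In the representation of spin \<open>|j| / 2\<close> the projection for \<open>j\<close> does not kill the highest weight
  vector, since its diagonal coefficient is the value of \<open>om (delta j)\<close> at a power of \<open>\<alpha>\<close>.\<close>

lemma eigenvector_exists:
  defines "m \<equiv> \<lambda>j. nat \<bar>j\<bar>"
  shows "\<exists>v\<in>carrier_vec (m j + 1). v \<noteq> 0\<^sub>v (m j + 1) \<and> (\<forall>f. om_rep (m j) f *\<^sub>v v = f j \<cdot>\<^sub>v v)"
proof -
  define e where "e = (unit_vec (m j + 1) 0 :: complex vec)"
  define v where "v = om_rep (m j) (delta j) *\<^sub>v e"
  have ec: "e \<in> carrier_vec (m j + 1)" by (simp add: e_def)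
  have vc: "v \<in> carrier_vec (m j + 1)" unfolding v_def by (rule om_vec_carrier[OF ec])
  have "v $ 0 = om_rep (m j) (delta j) $$ (0, 0)"
    by (simp add: v_def e_def)
  also have "\<dots> = om (delta j) (matrix_coeff q \<tau> (m j) 0 0)" by (simp add: om_rep_entry)
  also have "\<dots> = om (delta j) (al ^ m j)"
  proof (rule dualA_eqA[OF om_dualA], rule tau_nondegenerate)
    fix x
    show "\<tau> (matrix_coeff q \<tau> (m j) 0 0) x = \<tau> (al ^ m j) x"
      using matrix_coeff_exists[of "m j"] tau_matrix_coeff[of 0 "m j" 0 x] by simp
  qed
  also have "\<dots> \<noteq> 0"
  proof (cases "j \<ge> 0")
    case True
    then have "int (m j) = j" by (simp add: m_def)
    then show ?thesis by (intro om_al_power(1)) (simp_all add: delta_def)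
  next
    case False
    then have "- int (m j) = j" by (simp add: m_def)
    then show ?thesis by (intro om_al_power(2)) (simp_all add: delta_def)
  qed
  finally have "v \<noteq> 0\<^sub>v (m j + 1)" by auto
  moreover have "om_rep (m j) f *\<^sub>v v = f j \<cdot>\<^sub>v v" for f
  proof -
    have "(\<lambda>k. f k * delta j k) = (\<lambda>k. f j * delta j k)" by (auto simp: delta_def)
    then show ?thesis unfolding v_def om_vec_mult[OF ec] om_vec_scale[OF ec, symmetric] by simp
  qed
  ultimately show ?thesis using vc by blast
qed

text \<open>At an eigenvector for \<open>[a + j]\<close> a candidate \<open>om f\<close> acts by the scalar \<open>f(j)\<close>, which must be 1 for
  \<open>j = n\<close> and an idempotent different from 1 otherwise.\<close>

lemma dirac_eq: "dirac q \<tau> t (qnum q (a + n)) = om (delta n)"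
  unfolding dirac_def iB_def [symmetric]
proof (rule the_equality)
  show "om (delta n) \<in> Uqkt q \<tau> t \<and> (\<forall>m. orth_eigenprojection (m + 1) (rep q m iB)
      (complex_of_real (qnum q (a + n))) (dual_rep q \<tau> m (om (delta n))))"
    using om_rep_delta_projection fsupp_delta unfolding Uqkt_eq om_rep_def eigval_def by blast
next
  fix \<omega> assume w: "\<omega> \<in> Uqkt q \<tau> t \<and> (\<forall>m. orth_eigenprojection (m + 1) (rep q m iB)
      (complex_of_real (qnum q (a + n))) (dual_rep q \<tau> m \<omega>))"
  then obtain f where f: "\<omega> = om f" unfolding Uqkt_eq by blast
  have o: "orth_eigenprojection (m + 1) (rep q m iB) (eigval n) (om_rep m f)" for m
    using w unfolding f om_rep_def eigval_def by blast
  have "f j = delta n j" for j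
  proof -
    define m where "m = nat \<bar>j\<bar>"
    obtain v where v: "v \<in> carrier_vec (m + 1)" "v \<noteq> 0\<^sub>v (m + 1)" and D: "\<And>f. om_rep m f *\<^sub>v v = f j \<cdot>\<^sub>v v"
      using eigenvector_exists[of j] unfolding m_def by blast
    have inj: "c = d" if "c \<cdot>\<^sub>v v = d \<cdot>\<^sub>v v" for c d
    proof -
      obtain i where i: "i < m + 1" "v $ i \<noteq> 0"
        using v by (metis carrier_vecD eq_vecI index_zero_vec(1) index_zero_vec(2))
      have "(c \<cdot>\<^sub>v v) $ i = (d \<cdot>\<^sub>v v) $ i" using that by simp
      then show ?thesis using i v(1) by simp
    qed
    have P: "om_rep m f * om_rep m f = om_rep m f"
      and S: "{v \<in> carrier_vec (m + 1). om_rep m f *\<^sub>v v = v} = {v \<in> carrier_vec (m + 1). rep q m iB *\<^sub>v v = eigval n \<cdot>\<^sub>v v}"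
      using o[of m] unfolding orth_eigenprojection_def by blast+
    have B: "rep q m iB *\<^sub>v v = eigval j \<cdot>\<^sub>v v" using D[of eigval] by (simp only: om_rep_eigval)
    have one: "v = 1 \<cdot>\<^sub>v v" by simp
    show ?thesis
    proof (cases "j = n")
      case True
      then have "v \<in> {v \<in> carrier_vec (m + 1). om_rep m f *\<^sub>v v = v}" unfolding S using v B by simp
      then have "f j \<cdot>\<^sub>v v = 1 \<cdot>\<^sub>v v" using D[of f] by simp
      then show ?thesis using inj[of "f j" 1] True by (simp add: delta_def)
    next
      case False
      have "(f j * f j) \<cdot>\<^sub>v v = f j \<cdot>\<^sub>v v"
        using D[of "\<lambda>n. f n * f n"] D[of f] P by (simp add: om_rep_mult)
      then have "f j * f j = f j" by (rule inj)
      moreover have "f j \<noteq> 1"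
      proof
        assume "f j = 1"
        then have "v \<in> {v \<in> carrier_vec (m + 1). om_rep m f *\<^sub>v v = v}" using D[of f] v by simp
        then have "eigval j \<cdot>\<^sub>v v = eigval n \<cdot>\<^sub>v v" unfolding S using B by simp
        then have "eigval j = eigval n" by (rule inj)
        then show False using eigval_inj False by blast
      qed
      ultimately have "f j = 0" by simp
      then show ?thesis using False by (simp add: delta_def)
    qed
  qed
  then show "\<omega> = om (delta n)" unfolding f om_inj by (simp add: fun_eq_iff)
qed

lemma psi_dirac:
  fixes n :: int
  shows
  "psi (dirac q \<tau> t (qnum q (a + n))) = (q powr (a + n) + q powr (- a - n)) / (q powr a + q powr (- a))"
  unfolding dirac_eq psi_om wsum_delta weight_def ..

lemma psi_unique:
  assumes lin: "linear_on_Uqkt q \<tau> t \<psi>"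
    and val: "\<And>n::int. \<psi> (dirac q \<tau> t (qnum q (a + n))) = psi (dirac q \<tau> t (qnum q (a + n)))"
    and x: "x \<in> Uqkt q \<tau> t"
  shows "\<psi> x = psi x"
proof -
  have lin': "linear_on_Uqkt q \<tau> t psi"
    using psi_invariant_integral by (simp add: invariant_integral_def)
  obtain f where f: "x = om f" "fsupp f" using x unfolding Uqkt_eq by blast
  have ind: "fsupp (\<lambda>n. \<Sum>m\<in>F. f m * delta m n) \<and> \<psi> (om (\<lambda>n. \<Sum>m\<in>F. f m * delta m n)) = psi (om (\<lambda>n. \<Sum>m\<in>F. f m * delta m n))"
    if "finite F" for F
    using that
  proof (induction F)
    case empty
    have "fsupp (\<lambda>n. 0)" by simp
    then have "om (\<lambda>n. 0) \<in> Uqkt q \<tau> t" unfolding Uqkt_eq by blast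
    then have "\<phi> (\<lambda>a. 0 * om (\<lambda>n. 0) a) = 0 * \<phi> (om (\<lambda>n. 0))" if "linear_on_Uqkt q \<tau> t \<phi>" for \<phi>
      using that unfolding linear_on_Uqkt_def by blast
    then have z: "\<phi> (om (\<lambda>n. 0)) = 0" if "linear_on_Uqkt q \<tau> t \<phi>" for \<phi>
      using that unfolding om_scale by simp
    show ?case using z[OF lin] z[OF lin'] by simp
  next
    case (insert k F)
    have d: "om (delta k) \<in> Uqkt q \<tau> t" unfolding Uqkt_eq using fsupp_delta by blast
    have "{n. f k * delta k n \<noteq> 0} \<subseteq> {n. delta k n \<noteq> 0}" by auto
    then have fk: "fsupp (\<lambda>n. f k * delta k n)" by (rule finite_subset) (rule fsupp_delta)
    then have d': "om (\<lambda>n. f k * delta k n) \<in> Uqkt q \<tau> t" unfolding Uqkt_eq by blast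
    have r: "om (\<lambda>n. \<Sum>m\<in>F. f m * delta m n) \<in> Uqkt q \<tau> t" using insert unfolding Uqkt_eq by blast
    have "{n. f k * delta k n + (\<Sum>m\<in>F. f m * delta m n) \<noteq> 0} \<subseteq> {n. f k * delta k n \<noteq> 0} \<union> {n. (\<Sum>m\<in>F. f m * delta m n) \<noteq> 0}"
      by auto
    then have fs: "fsupp (\<lambda>n. f k * delta k n + (\<Sum>m\<in>F. f m * delta m n))"
      using fk insert.IH by (meson finite_Un finite_subset)
    have split: "\<phi> (om (\<lambda>n. f k * delta k n + (\<Sum>m\<in>F. f m * delta m n))) = f k * \<phi> (om (delta k)) + \<phi> (om (\<lambda>n. \<Sum>m\<in>F. f m * delta m n))"
      if l: "linear_on_Uqkt q \<tau> t \<phi>" for \<phi>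
    proof -
      have "\<phi> (\<lambda>a. om (\<lambda>n. f k * delta k n) a + om (\<lambda>n. \<Sum>m\<in>F. f m * delta m n) a)
          = \<phi> (om (\<lambda>n. f k * delta k n)) + \<phi> (om (\<lambda>n. \<Sum>m\<in>F. f m * delta m n))"
        using l d' r unfolding linear_on_Uqkt_def by blast
      moreover have "\<phi> (\<lambda>a. f k * om (delta k) a) = f k * \<phi> (om (delta k))"
        using l d unfolding linear_on_Uqkt_def by blast
      ultimately show ?thesis by (simp only: om_plus om_scale)
    qed
    have "\<psi> (om (delta k)) = psi (om (delta k))" using val[of k] unfolding dirac_eq .
    then show ?case using split[OF lin] split[OF lin'] insert fs by simp
  qed
  have "f = (\<lambda>n. \<Sum>m\<in>{n. f n \<noteq> 0}. f m * delta m n)" by (rule delta_expansion) (use f(2) in auto)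
  then have "om f = om (\<lambda>n. \<Sum>m\<in>{n. f n \<noteq> 0}. f m * delta m n)" by (rule arg_cong)
  then show ?thesis unfolding f(1) using ind[OF f(2)] by (simp only:)
qed

end

section \<open>The modular character\<close>

lemma chi_dualA:
  assumes "z \<noteq> 0"
  shows "chi z \<in> dualA q"
proof (rule dualA_I[OF chi_linear])
  fix r x y assume "r \<in> rels_A q"
  note D = linear_functionalD[OF chi_linear]
  have g: "chi z al = z" "chi z be = 0" "chi z ga = 0" "chi z de = 1 / z"
    using chi_hom(5)[of z False False] chi_hom(5)[of z False True] chi_hom(5)[of z True False]
      chi_hom(5)[of z True True] by simp_all
  from \<open>r \<in> rels_A q\<close> have "chi z r = 0"
    using assms by (auto simp: rels_A_def D(5) chi_hom g)
  then show "chi z (x * r * y) = 0" by (simp add: chi_hom)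
qed

lemma chi_conv: "conv (chi z) (chi w) = chi (z * w)"
proof
  fix x
  show "conv (chi z) (chi w) x = chi (z * w) x"
  proof (induction x rule: falgA_induct_left)
    case (gen i j x)
    have "(\<lambda>a. chi v (u i' k * a)) = (\<lambda>a. chi v (u i' k) * chi v a)" for v i' k by (simp add: chi_hom)
    then have "conv (chi z) (chi w) (u i j * x) = (\<Sum>k\<in>UNIV. chi z (u i k) * (chi w (u k j) * conv (chi z) (chi w) x))"
      by (simp only: conv_left[OF chi_linear chi_linear] conv_fun_linear)
    then show ?case unfolding gen by (cases i; cases j) (simp_all only: sum_bool chi_hom, simp_all)
  qed (simp_all add: conv_one conv_add conv_scale chi_linear chi_hom)
qed

lemma chi_one: "chi 1 = counA"
proof
  fix x
  show "chi 1 x = counA x"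
    by (induction x rule: falgA_induct_left) (simp_all add: chi_hom counA_hom)
qed

lemma chi_star:
  assumes "q \<noteq> 0"
  shows "dual_star q (chi z) = chi (cnj z)"
proof
  fix x
  have "cnj (chi z (starA q (antA q x))) = chi (cnj z) x"
  proof (induction x rule: falgA_induct_left)
    case (gen i j x)
    then show ?case unfolding star_ant_hom(3) star_ant_u[OF assms] chi_hom(2) complex_cnj_mult
      by (simp add: chi_hom(5))
  qed (simp_all add: star_ant_hom(1,2,4) chi_hom)
  then show "dual_star q (chi z) x = chi (cnj z) x" by (simp add: dual_star_def)
qed

subsection \<open>Uniqueness of positive square roots\<close>

text \<open>Let \<open>D\<close> be the diagonal matrix with entries \<open>d\<close>.  As \<open>h\<close> commutes with \<open>h\<^sup>2 = D\<^sup>2\<close> and \<open>d\<close> is positive,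
  \<open>h\<close> commutes with \<open>D\<close>, so \<open>(h + D) (h - D) = 0\<close>.  A column \<open>z\<close> of \<open>h - D\<close> therefore satisfies
  \<open>\<langle>z, h z\<rangle> = - \<langle>z, D z\<rangle>\<close>, which is nonnegative on the left, so \<open>z = 0\<close>.\<close>

lemma positive_sqrt_diagonal:
  fixes h y :: "'i \<Rightarrow> 'i \<Rightarrow> complex" and d :: "'i \<Rightarrow> real"
  assumes S: "finite S"
    and pos: "\<And>i j. i \<in> S \<Longrightarrow> j \<in> S \<Longrightarrow> h i j = (\<Sum>k\<in>S. cnj (y k i) * y k j)"
    and sq: "\<And>i j. i \<in> S \<Longrightarrow> j \<in> S \<Longrightarrow> (\<Sum>k\<in>S. h i k * h k j) = (if i = j then complex_of_real ((d i)\<^sup>2) else 0)"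
    and d: "\<And>i. i \<in> S \<Longrightarrow> d i > 0"
    and ij: "i \<in> S" "j \<in> S"
  shows "h i j = (if i = j then complex_of_real (d i) else 0)"
proof -
  have comm: "complex_of_real (d i) * h i j = h i j * complex_of_real (d j)" if i: "i \<in> S" and j: "j \<in> S" for i j
  proof -
    have "(\<Sum>k\<in>S. (\<Sum>l\<in>S. h i l * h l k) * h k j) = (\<Sum>l\<in>S. h i l * (\<Sum>k\<in>S. h l k * h k j))"
      unfolding sum_distrib_left sum_distrib_right mult.assoc by (rule sum.swap)
    moreover have "(\<Sum>k\<in>S. (\<Sum>l\<in>S. h i l * h l k) * h k j) = (\<Sum>k\<in>S. if k = i then complex_of_real ((d i)\<^sup>2) * h i j else 0)"
      using i by (intro sum.cong) (auto simp: sq)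
    moreover have "(\<Sum>l\<in>S. h i l * (\<Sum>k\<in>S. h l k * h k j)) = (\<Sum>l\<in>S. if l = j then h i j * complex_of_real ((d j)\<^sup>2) else 0)"
      using j by (intro sum.cong) (auto simp: sq)
    ultimately have e: "complex_of_real ((d i)\<^sup>2) * h i j = h i j * complex_of_real ((d j)\<^sup>2)"
      using S i j by simp
    show ?thesis
    proof (cases "h i j = 0")
      case False
      with e have "complex_of_real ((d i)\<^sup>2) = complex_of_real ((d j)\<^sup>2)" by simp
      then have "(d i)\<^sup>2 = (d j)\<^sup>2" by (simp only: of_real_eq_iff)
      then have "d i = d j" using d[OF i] d[OF j] by (simp add: power2_eq_iff_nonneg)
      then show ?thesis by simp
    qed simp
  qed
  define z where "z i = h i j - (if i = j then complex_of_real (d j) else 0)" for i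
  have hz: "(\<Sum>k\<in>S. h i k * z k) = - (complex_of_real (d i) * z i)" if i: "i \<in> S" for i
  proof -
    have "(\<Sum>k\<in>S. h i k * z k) = (\<Sum>k\<in>S. h i k * h k j - (if k = j then h i j * complex_of_real (d j) else 0))"
      by (intro sum.cong) (auto simp: z_def algebra_simps)
    also have "\<dots> = (if i = j then complex_of_real ((d i)\<^sup>2) else 0) - h i j * complex_of_real (d j)"
      unfolding sum_subtractf sq[OF i ij(2)] using S ij by simp
    also have "\<dots> = - (complex_of_real (d i) * z i)"
      unfolding comm[OF i ij(2), symmetric] by (simp add: z_def power2_eq_square algebra_simps)
    finally show ?thesis .
  qed
  have "(\<Sum>i\<in>S. cnj (z i) * (\<Sum>k\<in>S. h i k * z k)) = (\<Sum>l\<in>S. cnj (\<Sum>i\<in>S. y l i * z i) * (\<Sum>k\<in>S. y l k * z k))"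
  proof -
    have "(\<Sum>i\<in>S. cnj (z i) * (\<Sum>k\<in>S. h i k * z k)) = (\<Sum>i\<in>S. \<Sum>k\<in>S. \<Sum>l\<in>S. cnj (y l i) * cnj (z i) * (y l k * z k))"
      unfolding sum_distrib_left
    proof (intro sum.cong refl)
      fix i k assume "i \<in> S" "k \<in> S"
      then show "cnj (z i) * (h i k * z k) = (\<Sum>l\<in>S. cnj (y l i) * cnj (z i) * (y l k * z k))"
        by (simp only: pos sum_distrib_left sum_distrib_right ac_simps)
    qed
    also have "\<dots> = (\<Sum>l\<in>S. \<Sum>i\<in>S. \<Sum>k\<in>S. cnj (y l i) * cnj (z i) * (y l k * z k))"
      by (rule sum_rotate)
    also have "\<dots> = (\<Sum>l\<in>S. cnj (\<Sum>i\<in>S. y l i * z i) * (\<Sum>k\<in>S. y l k * z k))"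
      by (simp only: cnj_sum complex_cnj_mult sum_product)
    finally show ?thesis .
  qed
  moreover have "Re (\<Sum>l\<in>S. cnj (\<Sum>i\<in>S. y l i * z i) * (\<Sum>k\<in>S. y l k * z k)) \<ge> 0"
  proof -
    have "0 \<le> Re (cnj w * w)" for w by simp
    then show ?thesis unfolding Re_sum by (intro sum_nonneg)
  qed
  moreover have "(\<Sum>i\<in>S. cnj (z i) * (\<Sum>k\<in>S. h i k * z k)) = - complex_of_real (\<Sum>i\<in>S. d i * (cmod (z i))\<^sup>2)"
  proof -
    have e: "cnj w * w = complex_of_real ((cmod w)\<^sup>2)" for w
      by (subst complex_norm_square) (rule mult.commute)
    have "cnj (z i) * (\<Sum>k\<in>S. h i k * z k) = - complex_of_real (d i * (cmod (z i))\<^sup>2)" if "i \<in> S" for i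
    proof -
      have "cnj (z i) * - (complex_of_real (d i) * z i) = - (complex_of_real (d i) * (cnj (z i) * z i))"
        by simp
      then show ?thesis unfolding hz[OF that] e of_real_mult .
    qed
    then show ?thesis by (simp add: sum_negf)
  qed
  ultimately have "Re (- complex_of_real (\<Sum>i\<in>S. d i * (cmod (z i))\<^sup>2)) \<ge> 0" by (simp only:)
  then have "(\<Sum>i\<in>S. d i * (cmod (z i))\<^sup>2) \<le> 0" by simp
  moreover have "\<And>i. i \<in> S \<Longrightarrow> 0 \<le> d i * (cmod (z i))\<^sup>2" using d by (simp add: less_imp_le)
  ultimately have "d i * (cmod (z i))\<^sup>2 = 0"
    using S ij(1) by (metis (no_types, lifting) order_antisym sum_nonneg sum_nonneg_eq_0_iff)
  then have "z i = 0" using d[OF ij(1)] by simp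
  then show ?thesis by (auto simp: z_def)
qed

text \<open>The matrix entries of the tensor powers of the fundamental corepresentation, indexed by lists of
  equal length.  They exhaust the monomials of the free algebra, so a functional is the same as a
  family of matrices, one for each tensor power, and convolution is matrix multiplication.\<close>

fun u_word :: "bool list \<Rightarrow> bool list \<Rightarrow> genA falg" where
  "u_word (i # I) (j # J) = u i j * u_word I J"
| "u_word _ _ = 1"

definition idx :: "nat \<Rightarrow> bool list set" where "idx n = {I. length I = n}"

lemma idx_finite: "finite (idx n)"
  using finite_lists_length_eq[of "UNIV :: bool set" n] by (simp add: idx_def)

lemma idx_0: "idx 0 = {[]}" by (auto simp: idx_def)

lemma sum_idx_Suc: "(\<Sum>K\<in>idx (Suc n). h K) = (\<Sum>k\<in>UNIV. \<Sum>K\<in>idx n. h (k # K))"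
proof -
  have "(\<Sum>K\<in>idx (Suc n). h K) = (\<Sum>p\<in>UNIV \<times> idx n. h (fst p # snd p))"
    by (rule sum.reindex_cong[of "\<lambda>p. fst p # snd p"])
      (auto simp: inj_on_def idx_def length_Suc_conv image_iff prod_eq_iff)
  then show ?thesis by (simp add: sum.cartesian_product split_beta)
qed

lemma conv_u_word:
  assumes "linear_functional f" "linear_functional g" "I \<in> idx n" "J \<in> idx n"
  shows "conv f g (u_word I J) = (\<Sum>K\<in>idx n. f (u_word I K) * g (u_word K J))"
  using assms
proof (induction n arbitrary: f g I J)
  case 0
  then show ?case by (simp add: idx_0 conv_one)
next
  case (Suc n)
  then obtain i I' j J' where IJ: "I = i # I'" "J = j # J'" "I' \<in> idx n" "J' \<in> idx n"
    by (auto simp: idx_def length_Suc_conv)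
  show ?case unfolding IJ u_word.simps sum_idx_Suc conv_left[OF Suc.prems(1,2)]
    by (intro sum.cong refl Suc.IH linear_functional_mult_left Suc.prems IJ)
qed

lemma dual_star_u_word:
  assumes "q \<noteq> 0" "I \<in> idx n" "J \<in> idx n"
  shows "dual_star q f (u_word I J) = cnj (f (u_word J I))"
proof -
  have "starA q (antA q (u_word I J)) = u_word J I"
    using assms(2,3)
  proof (induction n arbitrary: I J)
    case 0
    then show ?case by (simp add: idx_0 star_ant_hom)
  next
    case (Suc n)
    then obtain i I' j J' where IJ: "I = i # I'" "J = j # J'" "I' \<in> idx n" "J' \<in> idx n"
      by (auto simp: idx_def length_Suc_conv)
    show ?case unfolding IJ u_word.simps star_ant_hom(3) star_ant_u[OF assms(1)] Suc.IH[OF IJ(3,4)] ..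
  qed
  then show ?thesis by (simp add: dual_star_def)
qed

lemma chi_u_word:
  assumes "I \<in> idx n" "J \<in> idx n"
  shows "chi (complex_of_real z) (u_word I J) = (if I = J then complex_of_real (prod_list (map (\<lambda>i. if i then 1 / z else z) I)) else 0)"
  using assms
proof (induction n arbitrary: I J)
  case 0
  then show ?case by (simp add: idx_0 chi_hom)
next
  case (Suc n)
  then obtain i I' j J' where IJ: "I = i # I'" "J = j # J'" "I' \<in> idx n" "J' \<in> idx n"
    by (auto simp: idx_def length_Suc_conv)
  show ?case unfolding IJ u_word.simps chi_hom(2) chi_hom(5) Suc.IH[OF IJ(3,4)] by simp
qed

lemma linear_functional_ext_u_word:
  assumes "linear_functional f" "linear_functional g"
    and u_word: "\<And>n I J. I \<in> idx n \<Longrightarrow> J \<in> idx n \<Longrightarrow> f (u_word I J) = g (u_word I J)"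
  shows "f = g"
proof
  fix x
  have "\<exists>I J. length I = length J \<and> mon (Word l) = u_word I J" for l
  proof (induction l)
    case Nil
    then show ?case by (auto intro!: exI[of _ "[]"])
  next
    case (Cons g l)
    then obtain I J where IJ: "length I = length J" "mon (Word l) = u_word I J" by blast
    obtain i j where "g = ug i j" using genA_ug by blast
    then have "mon (Word (g # l)) = u_word (i # I) (j # J)" by (simp add: mon_Cons IJ)
    then show ?case using IJ(1) by (metis length_Cons)
  qed
  then have "f (mon w) = g (mon w)" for w
    by (metis u_word idx_def mem_Collect_eq word.exhaust)
  then show "f x = g x" by (rule linear_functional_ext[OF assms(1,2)])
qed

text \<open>In each tensor power the character is a positive diagonal matrix.\<close>

lemma dual_sqrt_chi:
  assumes z: "z > 0" and q: "q \<noteq> 0"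
  shows "dual_sqrt q (chi (complex_of_real (z\<^sup>2))) = chi (complex_of_real z)"
  unfolding dual_sqrt_def
proof (rule the_equality)
  have r: "complex_of_real (sqrt z) * complex_of_real (sqrt z) = complex_of_real z"
    using z by (simp flip: of_real_mult)
  have "chi (complex_of_real z) = conv (dual_star q (chi (complex_of_real (sqrt z)))) (chi (complex_of_real (sqrt z)))"
    unfolding chi_star[OF q] complex_cnj_complex_of_real chi_conv r ..
  moreover have "chi (complex_of_real (sqrt z)) \<in> dualA q" using z by (intro chi_dualA) simp
  ultimately have "dual_positive q (chi (complex_of_real z))" unfolding dual_positive_def by blast
  moreover have "conv (chi (complex_of_real z)) (chi (complex_of_real z)) = chi (complex_of_real (z\<^sup>2))"
    unfolding chi_conv by (simp add: power2_eq_square)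
  moreover have "chi (complex_of_real z) \<in> dualA q" using z by (intro chi_dualA) simp
  ultimately show "chi (complex_of_real z) \<in> dualA q \<and> dual_positive q (chi (complex_of_real z)) \<and>
      conv (chi (complex_of_real z)) (chi (complex_of_real z)) = chi (complex_of_real (z\<^sup>2))" by blast
next
  fix h assume h: "h \<in> dualA q \<and> dual_positive q h \<and> conv h h = chi (complex_of_real (z\<^sup>2))"
  then have hl: "linear_functional h" using dualA_linear by blast
  obtain y where y: "y \<in> dualA q" "h = conv (dual_star q y) y" using h unfolding dual_positive_def by blast
  have yl: "linear_functional y" using y dualA_linear by blast
  show "h = chi (complex_of_real z)"
  proof (rule linear_functional_ext_u_word[OF hl chi_linear])
    fix n I J assume IJ: "I \<in> idx n" "J \<in> idx n"
    define d where "d I = prod_list (map (\<lambda>i. if i then 1 / z else z) I)" for I :: "bool list"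
    have d: "d I > 0" for I using z by (induction I) (simp_all add: d_def)
    have dd: "prod_list (map (\<lambda>i. if i then 1 / z\<^sup>2 else z\<^sup>2) I) = (d I)\<^sup>2" for I
      by (induction I) (simp_all add: d_def power2_eq_square)
    have "h (u_word I J) = (if I = J then complex_of_real (d I) else 0)"
    proof (rule positive_sqrt_diagonal[OF idx_finite[of n], where y = "\<lambda>I J. y (u_word I J)"])
      fix I J assume IJ: "I \<in> idx n" "J \<in> idx n"
      show "h (u_word I J) = (\<Sum>K\<in>idx n. cnj (y (u_word K I)) * y (u_word K J))"
        unfolding y(2) conv_u_word[OF dual_star_hom[OF yl] yl IJ]
        by (intro sum.cong refl) (simp add: dual_star_u_word[OF q IJ(1)])
      show "(\<Sum>K\<in>idx n. h (u_word I K) * h (u_word K J)) = (if I = J then complex_of_real ((d I)\<^sup>2) else 0)"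
        unfolding conv_u_word[OF hl hl IJ, symmetric] dd [symmetric] chi_u_word[OF IJ, symmetric] using h by simp
    qed (use IJ d in auto)
    then show "h (u_word I J) = chi (complex_of_real z) (u_word I J)"
      unfolding chi_u_word[OF IJ] d_def .
  qed
qed

lemma dual_inv_chi:
  assumes z: "z \<noteq> 0" and q: "q \<noteq> 0"
  shows "dual_inv q (chi z) = chi (1 / z)"
  unfolding dual_inv_def
proof (rule the_equality)
  show "chi (1 / z) \<in> dualA q \<and> conv (chi (1 / z)) (chi z) = counA \<and> conv (chi z) (chi (1 / z)) = counA"
    using z chi_dualA[of "1 / z" q] by (simp add: chi_conv chi_one)
  fix g assume g: "g \<in> dualA q \<and> conv g (chi z) = counA \<and> conv (chi z) g = counA"
  then have gl: "linear_functional g" using dualA_linear by blast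
  have "conv (conv g (chi z)) (chi (1 / z)) = conv g (conv (chi z) (chi (1 / z)))"
    by (rule conv_assoc[OF gl chi_linear chi_linear])
  then show "g = chi (1 / z)"
    using g z by (simp add: chi_conv chi_one conv_counA_left chi_linear conv_counA_right gl)
qed

subsection \<open>Substitution into an identity between tensors\<close>

text \<open>The hypothesis says that \<open>\<Sum>\<^sub>s \<phi>\<^sub>s \<otimes> y\<^sub>s\<close> vanishes in the tensor product of the dual of \<open>A\<close> with \<open>A\<close>, so one
  may evaluate the first leg at the image of the second leg under \<open>R\<close>.  Without tensor products
  this is a Gaussian elimination: if \<open>\<phi>\<^sub>s\<close> is not zero at some \<open>b\<^sub>0\<close>, the hypothesis at \<open>b\<^sub>0\<close> expresses
  \<open>y\<^sub>s\<close> by the others.\<close>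

lemma tensor_substitution:
  fixes y :: "'i \<Rightarrow> genA falg" and \<phi> :: "'i \<Rightarrow> genA falg \<Rightarrow> complex"
  assumes "finite S"
    and "\<And>s. s \<in> S \<Longrightarrow> \<phi> s \<in> dualA q"
    and R: "\<And>\<omega>. \<omega> \<in> dualA q \<Longrightarrow> (\<lambda>c. \<omega> (R c)) \<in> dualA q"
    and "\<And>b. (\<Sum>s\<in>S. sc (\<phi> s b) * y s) \<in> ideal_A q"
  shows "(\<Sum>s\<in>S. \<phi> s (R (y s))) = 0"
  using assms(1,2,4)
proof (induction S arbitrary: \<phi>)
  case (insert s S)
  show ?case
  proof (cases "\<forall>b. \<phi> s b = 0")
    case True
    have "(\<Sum>t\<in>S. \<phi> t (R (y t))) = 0"
    proof (rule insert.IH)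
      fix b
      show "(\<Sum>t\<in>S. sc (\<phi> t b) * y t) \<in> ideal_A q" using insert.prems(2)[of b] insert.hyps True by simp
    qed (use insert.prems in auto)
    then show ?thesis using insert.hyps True by simp
  next
    case False
    then obtain b0 where b0: "\<phi> s b0 \<noteq> 0" by blast
    define r where "r t = \<phi> t b0 / \<phi> s b0" for t
    define \<phi>' where "\<phi>' t = (\<lambda>b. \<phi> t b + (- r t) * \<phi> s b)" for t
    have sd: "\<phi> s \<in> dualA q" using insert.prems by simp
    let ?Y = "\<lambda>b. \<Sum>t\<in>insert s S. sc (\<phi> t b) * y t"
    have Y: "?Y b = sc (\<phi> s b) * y s + (\<Sum>t\<in>S. sc (\<phi> t b) * y t)" for b using insert.hyps by simp
    have sm: "(\<Sum>t\<in>S. sc (c * f t) * y t) = sc c * (\<Sum>t\<in>S. sc (f t) * y t)" for c f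
      by (simp only: sum_distrib_left sc_mult mult.assoc)
    have "(\<Sum>t\<in>S. \<phi>' t (R (y t))) = 0"
    proof (rule insert.IH)
      show "\<phi>' t \<in> dualA q" if "t \<in> S" for t
        unfolding \<phi>'_def using insert.prems that by (intro dualA_add dualA_scale) simp_all
      fix b
      define k where "k = \<phi> s b / \<phi> s b0"
      have "(\<Sum>t\<in>S. sc (\<phi>' t b) * y t) = (\<Sum>t\<in>S. sc (\<phi> t b) * y t + sc ((- k) * \<phi> t b0) * y t)"
      proof (intro sum.cong refl)
        fix t
        have "\<phi>' t b = \<phi> t b + (- k) * \<phi> t b0" by (simp add: \<phi>'_def r_def k_def)
        then show "sc (\<phi>' t b) * y t = sc (\<phi> t b) * y t + sc ((- k) * \<phi> t b0) * y t"
          by (simp only: sc_add distrib_right)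
      qed
      also have "\<dots> = (\<Sum>t\<in>S. sc (\<phi> t b) * y t) + sc (- k) * (\<Sum>t\<in>S. sc (\<phi> t b0) * y t)"
        unfolding sum.distrib sm ..
      also have "\<dots> = ?Y b + sc (- k) * ?Y b0"
      proof -
        have "sc (\<phi> s b) * y s + sc (- k) * (sc (\<phi> s b0) * y s) = 0"
        proof -
          have k: "- k * \<phi> s b0 = - \<phi> s b" using b0 by (simp add: k_def)
          have "sc (- k) * (sc (\<phi> s b0) * y s) = sc (- k * \<phi> s b0) * y s" by (rule sc_mult_assoc)
          also have "\<dots> = - (sc (\<phi> s b) * y s)" unfolding k sc_uminus by simp
          finally show ?thesis by simp
        qed
        then show ?thesis unfolding Y by (simp add: distrib_left add.assoc add.left_commute)
      qed
      finally show "(\<Sum>t\<in>S. sc (\<phi>' t b) * y t) \<in> ideal_A q"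
        using insert.prems(2) unfolding ideal_A_def by (simp only: ideal_gen_add ideal_gen_mult_left)
    qed
    then have 1: "(\<Sum>t\<in>S. \<phi> t (R (y t))) = (\<Sum>t\<in>S. r t * \<phi> s (R (y t)))"
      by (simp add: \<phi>'_def sum_subtractf)
    have tr: "(\<lambda>c. \<phi> s (R c)) \<in> dualA q" by (rule R[OF sd])
    note L = dualA_linear[OF tr]
    have "\<phi> s (R (?Y b0)) = 0" using tr insert.prems(2) by (simp add: dualA_def)
    then have "(\<Sum>t\<in>insert s S. \<phi> t b0 * \<phi> s (R (y t))) = 0"
      unfolding linear_functional_sum[OF L] linear_functionalD(2)[OF L] .
    then have "\<phi> s b0 * \<phi> s (R (y s)) + (\<Sum>t\<in>S. \<phi> t b0 * \<phi> s (R (y t))) = 0" using insert.hyps by simp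
    moreover have "(\<Sum>t\<in>S. \<phi> t b0 * \<phi> s (R (y t))) = \<phi> s b0 * (\<Sum>t\<in>S. r t * \<phi> s (R (y t)))"
      unfolding sum_distrib_left using b0 by (simp add: r_def)
    ultimately have "\<phi> s b0 * (\<phi> s (R (y s)) + (\<Sum>t\<in>S. r t * \<phi> s (R (y t)))) = 0" by (simp only: distrib_left)
    then have "\<phi> s (R (y s)) + (\<Sum>t\<in>S. r t * \<phi> s (R (y t))) = 0" using b0 by simp
    then show ?thesis using insert.hyps 1 by simp
  qed
qed simp

subsection \<open>The modular character of the invariant state\<close>

definition ant_sq_inv_gen :: "complex \<Rightarrow> genA \<Rightarrow> genA falg" where
  "ant_sq_inv_gen Q = case_genA al (sc (Q * Q) * be) (sc (1 / (Q * Q)) * ga) de"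

text \<open>The inverse \<open>S\<^bsup>-2\<^esup>\<close> of the square of the antipode is an automorphism that rescales \<open>\<beta>\<close> and \<open>\<gamma>\<close>.\<close>

definition ant_sq_inv :: "complex \<Rightarrow> genA falg \<Rightarrow> genA falg" where
  "ant_sq_inv Q = free_hom sc (ant_sq_inv_gen Q)"

lemma ant_sq_inv_hom:
  "ant_sq_inv Q (x + y) = ant_sq_inv Q x + ant_sq_inv Q y" "ant_sq_inv Q (x * y) = ant_sq_inv Q x * ant_sq_inv Q y" "ant_sq_inv Q (sc c) = sc c"
  "ant_sq_inv Q 1 = 1" "ant_sq_inv Q (gen g) = ant_sq_inv_gen Q g"
proof -
  show "ant_sq_inv Q (x * y) = ant_sq_inv Q x * ant_sq_inv Q y"
    unfolding ant_sq_inv_def by (rule free_hom_mult) (simp, simp add: sc_add, simp add: sc_mult, simp add: sc_commute)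
  show "ant_sq_inv Q 1 = 1" using free_hom_sc[of sc "ant_sq_inv_gen Q" 1] by (simp add: ant_sq_inv_def)
qed (simp_all add: ant_sq_inv_def free_hom_add sc_add free_hom_sc free_hom_gen)

lemma ant_sq_inv_minus: "ant_sq_inv Q (x - y) = ant_sq_inv Q x - ant_sq_inv Q y" "ant_sq_inv Q (- x) = - ant_sq_inv Q x"
proof -
  show 1: "ant_sq_inv Q (x - y) = ant_sq_inv Q x - ant_sq_inv Q y" for x y
    using ant_sq_inv_hom(1)[of Q "x - y" y] by simp
  have "ant_sq_inv Q 0 = 0" using ant_sq_inv_hom(3)[of Q 0] by simp
  then show "ant_sq_inv Q (- x) = - ant_sq_inv Q x" using 1[of 0 x] by simp
qed

context pairing
begin

lemma eqA_I: "(\<And>\<omega>. \<omega> \<in> dualA q \<Longrightarrow> \<omega> x = \<omega> y) \<Longrightarrow> eqA q x y"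
  using tau_nondegenerate tau_dualA by blast

lemma Q_nz: "complex_of_real q \<noteq> 0" "q \<noteq> 0" using q01 by auto

lemma ant_sq_inv_dualA:
  assumes w: "\<omega> \<in> dualA q"
  shows "(\<lambda>c. \<omega> (ant_sq_inv q c)) \<in> dualA q"
proof (rule dualA_I)
  note L = linear_functionalD[OF dualA_linear[OF w]]
  show "linear_functional (\<lambda>c. \<omega> (ant_sq_inv q c))"
    unfolding linear_functional_def by (simp add: ant_sq_inv_hom L)
  fix r x y assume r: "r \<in> rels_A q"
  define Q where "Q = complex_of_real q"
  have Q: "Q \<noteq> 0" using Q_nz by (simp add: Q_def)
  note R = dualA_rules(1-3)[OF w] dualA_rules(4,5)[OF w Q_nz(2)] dualA_rules(6,7)[OF w]
  have "\<omega> (X * (ant_sq_inv q r * Y)) = 0" for X Y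
    using r Q unfolding rels_A_def
    by (elim insertE emptyE; simp add: ant_sq_inv_hom ant_sq_inv_minus ant_sq_inv_gen_def L ring_distribs mult.assoc
        sc_left_commute[of "gen g" for g] R flip: Q_def)
  then show "\<omega> (ant_sq_inv q (x * r * y)) = 0" by (simp add: ant_sq_inv_hom mult.assoc)
qed

text \<open>The inverse of the antipode on the generators: \<open>ant_inv_u i k\<close> is \<open>S\<^bsup>-1\<^esup>(u\<^sub>i\<^sub>k)\<close>.\<close>

definition ant_inv_u :: "bool \<Rightarrow> bool \<Rightarrow> genA falg" where
  "ant_inv_u i k = (if i then if k then al else sc (- 1 / q) * ga else if k then sc (- q) * be else de)"

lemma antipode_left: "eqA q (\<Sum>k\<in>UNIV. antA q (u i k) * u k m) (sc (if i = m then 1 else 0))"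
proof (rule eqA_I)
  fix \<omega> assume w: "\<omega> \<in> dualA q"
  note L = linear_functionalD[OF dualA_linear[OF w]]
  note R = dualA_rules(1-3)[OF w] dualA_rules(4,5)[OF w Q_nz(2)] dualA_rules(6,7)[OF w]
  note R1 = R[of 1 1, simplified]
  show "\<omega> (\<Sum>k\<in>UNIV. antA q (u i k) * u k m) = \<omega> (sc (if i = m then 1 else 0))"
    unfolding sum_bool antA_hom using Q_nz
    by (cases i; cases m; simp add: L R1 mult.assoc)
qed

lemma ant_inv_u_left: "eqA q (\<Sum>k\<in>UNIV. u k m * ant_inv_u i k) (sc (if i = m then 1 else 0))"
proof (rule eqA_I)
  fix \<omega> assume w: "\<omega> \<in> dualA q"
  note L = linear_functionalD[OF dualA_linear[OF w]]
  note R = dualA_rules(1-3)[OF w] dualA_rules(4,5)[OF w Q_nz(2)] dualA_rules(6,7)[OF w]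
  note R1 = R[of 1 1, simplified]
  show "\<omega> (\<Sum>k\<in>UNIV. u k m * ant_inv_u i k) = \<omega> (sc (if i = m then 1 else 0))"
    unfolding sum_bool ant_inv_u_def using Q_nz
    by (cases i; cases m; simp add: L R1 mult.assoc)
qed

lemma ant_sq_inv_antA: "ant_sq_inv q (antA q (u i k)) = ant_inv_u i k"
  unfolding antA_hom using Q_nz
  by (cases i; cases k; simp add: ant_sq_inv_hom ant_sq_inv_minus ant_sq_inv_gen_def ant_inv_u_def sc_mult_assoc flip: sc_uminus)

end

locale modular_state = pairing +
  fixes \<Phi> :: "genA falg \<Rightarrow> complex" and \<sigma> :: "genA falg \<Rightarrow> genA falg"
  assumes state: "invariant_state q \<Phi>" and modular: "modular_automorphism q \<Phi> \<sigma>"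
begin

lemma Phi_dualA: "\<Phi> \<in> dualA q" and Phi_one: "\<Phi> 1 = 1"
  and Phi_right: "eqA q (slice_right \<Phi> (copA x)) (sc (\<Phi> x))"
proof -
  show "\<Phi> \<in> dualA q" using state unfolding invariant_state_def by (elim conjE)
  show "\<Phi> 1 = 1" using state unfolding invariant_state_def by (elim conjE)
  have "\<forall>a. eqA q (slice_right \<Phi> (copA a)) (sc (\<Phi> a)) \<and> eqA q (slice_left \<Phi> (copA a)) (sc (\<Phi> a))"
    using state unfolding invariant_state_def by (elim conjE) assumption
  then show "eqA q (slice_right \<Phi> (copA x)) (sc (\<Phi> x))" by (elim allE conjE)
qed

lemma Phi_linear: "linear_functional \<Phi>" by (rule dualA_linear[OF Phi_dualA])

text \<open>Pair the invariance of \<open>\<Phi>\<close> at \<open>u\<^sub>0\<^sub>j u\<^sub>0\<^sub>l\<close> with \<open>e\<close>, whose counit is 0.\<close>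

lemma Phi_quadratic: "\<Phi> (u True j * u False l) + q * \<Phi> (u False j * u True l) = 0"
proof -
  have s: "\<tau> (u False s * u False r) Ee = \<tau> (u False s) Ee * \<tau> (u False r) 1 + \<tau> (u False s) Kk * \<tau> (u False r) Ee" for s r
    unfolding tau_mult_left copU_hom copU_gen.simps slice_both_add[OF tau_linear_right]
      slice_both_tens[OF tau_linear_right tau_linear_right] ..
  define e where "e = complex_of_real (q powr (1 / 2))"
  have e: "e \<noteq> 0" using q01 by (simp add: e_def)
  have "conv (\<lambda>c. \<tau> c Ee) \<Phi> (u False j * u False l) = \<tau> (slice_right \<Phi> (copA (u False j * u False l))) Ee"
    by (rule conv_eval_right) (rule tau_linear_left)
  also have "\<dots> = \<tau> (sc (\<Phi> (u False j * u False l))) Ee" by (rule tau_eqA[OF Phi_right])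
  also have "\<dots> = 0"
    by (simp add: linear_functionalD(6)[OF tau_linear_left] tau_one counU_hom)
  finally have "(\<Sum>s\<in>UNIV. \<Sum>r\<in>UNIV. \<tau> (u False s * u False r) Ee * \<Phi> (u s j * u r l)) = 0"
    unfolding conv_u_u[OF tau_linear_left Phi_linear] .
  then have "e * (\<Phi> (u True j * u False l) + q * \<Phi> (u False j * u True l)) = 0"
    unfolding s tau_u_gens tau_one counA_hom sum_bool e_def by (simp add: algebra_simps)
  then show ?thesis using e by simp
qed

text \<open>The relations from \<open>Phi_quadratic\<close> determine the state on quadratic elements, for instance
  \<open>\<Phi>(\<beta> \<gamma>) = - q / (1 + q\<^sup>2)\<close>.  The left hand side is \<open>\<Sum>\<^sub>k \<Phi>(S\<^bsup>-3\<^esup>(u\<^sub>i\<^sub>k) u\<^sub>k\<^sub>j)\<close>, in the form in which it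
  appears in \<open>counit_modular_preimage\<close>.\<close>

lemma Phi_values:
  "(\<Sum>k\<in>UNIV. \<Phi> (ant_sq_inv q (ant_inv_u i k) * u k j)) = chi (complex_of_real (q\<^sup>2)) (u i j)"
proof -
  note L = linear_functionalD[OF Phi_linear]
  note R = dualA_rules(1-3)[OF Phi_dualA] dualA_rules(4,5)[OF Phi_dualA Q_nz(2)] dualA_rules(6,7)[OF Phi_dualA]
  note R1 = R[of 1 1, simplified]
  define Q where "Q = complex_of_real q"
  have Q: "Q \<noteq> 0" using Q_nz by (simp add: Q_def)
  have "1 + q * q > 0" using q01 by (simp add: add_pos_pos)
  then have "complex_of_real (1 + q * q) \<noteq> 0" by (simp only: of_real_eq_0_iff)
  then have Q1: "1 + Q * Q \<noteq> 0" by (simp add: Q_def)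
  have 1: "\<Phi> (be * ga) * (1 + Q * Q) = - Q"
  proof -
    have "\<Phi> (be * ga) + Q * (Q * \<Phi> (be * ga) + 1) = 0"
      using Phi_quadratic[of False True] by (simp add: R1 Phi_one Q_def)
    then show ?thesis by (simp add: algebra_simps eq_neg_iff_add_eq_0)
  qed
  have 2: "\<Phi> (ga * al) = 0"
  proof -
    have "\<Phi> (ga * al) * (1 + Q * Q) = 0"
      using Phi_quadratic[of False False] by (simp add: R1 Q_def algebra_simps)
    then show ?thesis using Q1 by simp
  qed
  have 3: "\<Phi> (be * de) = 0"
  proof -
    have "\<Phi> (be * de) * (1 + Q * Q) = 0"
      using Phi_quadratic[of True True] Q by (simp add: R1 field_simps flip: Q_def)
    then show ?thesis using Q1 by simp
  qed
  define D where "D = 1 + Q * Q"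
  have D: "D \<noteq> 0" using Q1 by (simp add: D_def)
  have b: "\<Phi> (be * ga) = - Q / D" using 1 D by (simp add: D_def [symmetric] field_simps)
  have c: "chi (complex_of_real (q\<^sup>2)) (u i j) = (if i = j then if i then 1 / (Q * Q) else Q * Q else 0)"
    unfolding chi_hom by (simp add: Q_def power2_eq_square)
  show ?thesis unfolding c sum_bool ant_inv_u_def
    using Q D
    by (cases i; cases j; simp add: ant_sq_inv_hom ant_sq_inv_minus ant_sq_inv_gen_def L R1 2 3 b Phi_one mult.assoc sc_mult_assoc flip: Q_def;
        simp add: field_simps; simp add: D_def algebra_simps)
qed

text \<open>In Sweedler notation \<open>b\<^sub>1 \<Phi>(x b\<^sub>2) = S(x\<^sub>1) \<Phi>(x\<^sub>2 b)\<close>: insert \<open>S(x\<^sub>1) x\<^sub>2\<close> in front of \<open>b\<^sub>1\<close> on the left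
  and apply the invariance of \<open>\<Phi>\<close> to the product \<open>x\<^sub>2 b\<close>.  The induction does this for one letter of
  \<open>x\<close> at a time.\<close>

lemma strong_invariance:
  "eqA q (slice_right (\<lambda>c. \<Phi> (x * c)) (copA b)) (antA q (slice_right (\<lambda>c. \<Phi> (c * b)) (copA x)))"
proof (induction x arbitrary: b rule: falgA_induct_right)
  case one
  have "antA q (slice_right (\<lambda>c. \<Phi> (c * b)) (copA 1)) = sc (\<Phi> b)"
    by (simp add: slice_right_tapp tapp_copA_one antA_hom)
  then show ?case using Phi_right[of b] by simp
next
  case (add x y)
  have "slice_right (\<lambda>c. \<Phi> ((x + y) * c)) (copA b)
      = slice_right (\<lambda>c. \<Phi> (x * c)) (copA b) + slice_right (\<lambda>c. \<Phi> (y * c)) (copA b)"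
    unfolding slice_right_tapp tapp_fun_add [symmetric]
    by (simp add: distrib_right linear_functionalD[OF Phi_linear] sc_add)
  moreover have "antA q (slice_right (\<lambda>c. \<Phi> (c * b)) (copA (x + y)))
      = antA q (slice_right (\<lambda>c. \<Phi> (c * b)) (copA x)) + antA q (slice_right (\<lambda>c. \<Phi> (c * b)) (copA y))"
    unfolding slice_right_tapp tapp_copA_add antA_hom ..
  ultimately show ?case using eqA_add[OF add] by (simp only:)
next
  case (scale k x)
  have "slice_right (\<lambda>c. \<Phi> (sc k * x * c)) (copA b) = sc k * slice_right (\<lambda>c. \<Phi> (x * c)) (copA b)"
    unfolding slice_right_tapp tapp_fun_mult_left [symmetric]
    by (simp add: mult.assoc linear_functionalD[OF Phi_linear] sc_mult)
  moreover have "antA q (slice_right (\<lambda>c. \<Phi> (c * b)) (copA (sc k * x)))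
      = sc k * antA q (slice_right (\<lambda>c. \<Phi> (c * b)) (copA x))"
    unfolding slice_right_tapp tapp_copA_scale antA_scale ..
  ultimately show ?case using eqA_mult_left[OF scale] by (simp only:)
next
  case (gen i j x)
  define S where "S m = slice_right (\<lambda>c. \<Phi> (x * (u m j * c))) (copA b)" for m
  have l1: "linear_functional (\<lambda>c. \<Phi> (c * b))" by (rule linear_functional_mult_right[OF Phi_linear])
  have l2: "linear_functional (\<lambda>c. \<Phi> (x * c))" by (rule linear_functional_mult_left[OF Phi_linear])
  have 1: "antA q (slice_right (\<lambda>c. \<Phi> (c * b)) (copA (x * u i j)))
      = (\<Sum>k\<in>UNIV. antA q (u i k) * antA q (slice_right (\<lambda>c. \<Phi> (c * (u k j * b))) (copA x)))"
    unfolding slice_right_copA_right[OF l1] sum_bool antA_hom mult.assoc ..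
  have 2: "slice_right (\<lambda>c. \<Phi> (x * c)) (copA (u k j * b)) = (\<Sum>m\<in>UNIV. u k m * S m)" for k
    unfolding slice_right_copA_left[OF l2] S_def ..
  have A: "eqA q (\<Sum>k\<in>UNIV. antA q (u i k) * slice_right (\<lambda>c. \<Phi> (x * c)) (copA (u k j * b)))
      (antA q (slice_right (\<lambda>c. \<Phi> (c * b)) (copA (x * u i j))))"
    unfolding 1 sum_bool[of "\<lambda>k. antA q (u i k) * _ k"]
    by (rule eqA_add; rule eqA_mult_left; rule gen)
  have B: "(\<Sum>k\<in>UNIV. antA q (u i k) * slice_right (\<lambda>c. \<Phi> (x * c)) (copA (u k j * b)))
      = (\<Sum>m\<in>UNIV. (\<Sum>k\<in>UNIV. antA q (u i k) * u k m) * S m)"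
    unfolding 2 sum_distrib_left sum_distrib_right mult.assoc by (rule sum.swap)
  have C: "eqA q (\<Sum>m\<in>UNIV. (\<Sum>k\<in>UNIV. antA q (u i k) * u k m) * S m)
      (\<Sum>m\<in>UNIV. sc (if i = m then 1 else 0) * S m)"
    unfolding sum_bool[of "\<lambda>m. _ m * S m"]
    by (rule eqA_add; rule eqA_mult_right; rule antipode_left)
  have D: "(\<Sum>m\<in>UNIV. sc (if i = m then 1 else 0) * S m) = slice_right (\<lambda>c. \<Phi> (x * u i j * c)) (copA b)"
    by (cases i) (simp_all add: sum_bool S_def mult.assoc)
  show ?case by (rule eqA_trans[OF eqA_sym[OF C[unfolded D]] A[unfolded B]])
qed

text \<open>The mirror image for a generator, \<open>b\<^sub>1 \<Phi>(b\<^sub>2 u\<^sub>i\<^sub>j) = \<Sum>\<^sub>k S\<^bsup>-1\<^esup>(u\<^sub>i\<^sub>k) \<Phi>(b u\<^sub>k\<^sub>j)\<close>, which needs the inverse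
  of the antipode.\<close>

lemma strong_invariance_gen:
  "eqA q (slice_right (\<lambda>c. \<Phi> (c * u i j)) (copA b)) (\<Sum>k\<in>UNIV. sc (\<Phi> (b * u k j)) * ant_inv_u i k)"
proof -
  define S where "S m = slice_right (\<lambda>c. \<Phi> (c * u m j)) (copA b)" for m
  have A: "eqA q (\<Sum>k\<in>UNIV. slice_right \<Phi> (copA (b * u k j)) * ant_inv_u i k) (\<Sum>k\<in>UNIV. sc (\<Phi> (b * u k j)) * ant_inv_u i k)"
    unfolding sum_bool by (rule eqA_add; rule eqA_mult_right; rule Phi_right)
  have B: "(\<Sum>k\<in>UNIV. slice_right \<Phi> (copA (b * u k j)) * ant_inv_u i k)
      = (\<Sum>m\<in>UNIV. S m * (\<Sum>k\<in>UNIV. u k m * ant_inv_u i k))"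
    unfolding slice_right_copA_right[OF Phi_linear] S_def [symmetric] sum_distrib_left sum_distrib_right mult.assoc
    by (rule sum.swap)
  have C: "eqA q (\<Sum>m\<in>UNIV. S m * (\<Sum>k\<in>UNIV. u k m * ant_inv_u i k)) (\<Sum>m\<in>UNIV. S m * sc (if i = m then 1 else 0))"
    unfolding sum_bool[of "\<lambda>m. S m * _ m"] by (rule eqA_add; rule eqA_mult_left; rule ant_inv_u_left)
  have D: "(\<Sum>m\<in>UNIV. S m * sc (if i = m then 1 else 0)) = slice_right (\<lambda>c. \<Phi> (c * u i j)) (copA b)"
    by (cases i) (simp_all add: sum_bool S_def)
  show ?thesis by (rule eqA_trans[OF eqA_sym[OF C[unfolded D]] A[unfolded B]])
qed

text \<open>\<open>ant_sq_inv\<close> after the antipode is \<open>S\<^bsup>-1\<^esup>\<close>, and \<open>x\<^sub>2 S\<^bsup>-1\<^esup>(x\<^sub>1) = \<epsilon>(x)\<close>.\<close>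

lemma counit_recovery: "eqA q (tapp (\<lambda>x y. y * ant_sq_inv q (antA q x)) (copA x)) (sc (counA x))"
proof (induction x rule: falgA_induct_left)
  case one
  then show ?case by (simp add: tapp_copA_one antA_hom ant_sq_inv_hom counA_hom eqA_refl)
next
  case (add x y)
  then show ?case unfolding tapp_copA_add counA_hom sc_add by (rule eqA_add)
next
  case (scale c x)
  then show ?case unfolding tapp_copA_scale counA_hom sc_mult by (rule eqA_mult_left)
next
  case (gen i j x)
  let ?B = "\<lambda>x y. y * ant_sq_inv q (antA q x)"
  have B: "bilin ?B"
    unfolding bilin_def
    by (simp add: antA_hom(1) antA_scale ant_sq_inv_hom distrib_left distrib_right sc_left_commute mult.assoc)
  have 1: "tapp ?B (copA (u i j * x)) = (\<Sum>k\<in>UNIV. u k j * (tapp ?B (copA x) * ant_inv_u i k))"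
    unfolding tapp_copA_left[OF B] antA_hom(2) ant_sq_inv_hom(2) ant_sq_inv_antA
      tapp_fun_mult_right [symmetric] tapp_fun_mult_left [symmetric] by (simp only: mult.assoc)
  have 2: "eqA q (\<Sum>k\<in>UNIV. u k j * (tapp ?B (copA x) * ant_inv_u i k)) (\<Sum>k\<in>UNIV. u k j * (sc (counA x) * ant_inv_u i k))"
    unfolding sum_bool by (rule eqA_add; rule eqA_mult_left; rule eqA_mult_right; rule gen)
  have 3: "(\<Sum>k\<in>UNIV. u k j * (sc (counA x) * ant_inv_u i k)) = sc (counA x) * (\<Sum>k\<in>UNIV. u k j * ant_inv_u i k)"
    unfolding sum_bool distrib_left by (simp only: sc_left_commute[of "gen g" for g])
  have 4: "eqA q (sc (counA x) * (\<Sum>k\<in>UNIV. u k j * ant_inv_u i k)) (sc (counA x) * sc (if i = j then 1 else 0))"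
    by (rule eqA_mult_left[OF ant_inv_u_left])
  have 5: "sc (counA x) * sc (if i = j then 1 else 0) = sc (counA (u i j * x))"
    by (simp add: counA_hom)
  show ?case unfolding 1 using eqA_trans[OF 2[unfolded 3] 4[unfolded 5]] .
qed

text \<open>By the modular property \<open>\<Phi>(x b) = \<Phi>(b u\<^sub>i\<^sub>j)\<close>, so the two forms of strong invariance give
  \<open>S(x\<^sub>1) \<Phi>(x\<^sub>2 b) = \<Sum>\<^sub>k S\<^bsup>-1\<^esup>(u\<^sub>i\<^sub>k) \<Phi>(b u\<^sub>k\<^sub>j)\<close> for all \<open>b\<close>.  Substituting for \<open>b\<close> the image under \<open>S\<^bsup>-2\<^esup>\<close>
  of the other factor turns the left hand side into \<open>\<Phi>(x\<^sub>2 S\<^bsup>-1\<^esup>(x\<^sub>1)) = \<epsilon>(x)\<close> and the right hand side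
  into the sum in \<open>Phi_values\<close>.\<close>

lemma counit_modular_preimage:
  assumes "eqA q (\<sigma> x) (u i j)"
  shows "counA x = chi (complex_of_real (q\<^sup>2)) (u i j)"
proof -
  note L = linear_functionalD[OF Phi_linear]
  have KMS: "\<Phi> (x * b) = \<Phi> (b * u i j)" for b
  proof -
    have "\<forall>a b. \<Phi> (a * b) = \<Phi> (b * \<sigma> a)" using modular unfolding modular_automorphism_def by (elim conjE)
    then have "\<Phi> (x * b) = \<Phi> (b * \<sigma> x)" by (elim allE)
    also have "\<dots> = \<Phi> (b * u i j)" by (rule dualA_eqA[OF Phi_dualA eqA_mult_left[OF assms]])
    finally show ?thesis .
  qed
  \<comment> \<open>\<open>\<phi>\<close> and \<open>y\<close> are the two legs of the difference of the two sides of the identity to substitute into\<close>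
  define S where "S = Poly_Mapping.keys (copA x) <+> (UNIV :: bool set)"
  define \<phi> where "\<phi> = case_sum (\<lambda>p b. Poly_Mapping.lookup (copA x) p * \<Phi> (mon (snd p) * b)) (\<lambda>k b. (- 1) * \<Phi> (b * u k j))"
  define y where "y = case_sum (\<lambda>p :: genA word \<times> genA word. antA q (mon (fst p))) (ant_inv_u i)"
  have split: "(\<Sum>s\<in>S. f s) = (\<Sum>p\<in>Poly_Mapping.keys (copA x). f (Inl p)) + (\<Sum>k\<in>UNIV. f (Inr k))"
    for f :: "_ \<Rightarrow> 'c::comm_monoid_add"
    unfolding S_def by (subst sum.Plus) simp_all
  have "(\<Sum>s\<in>S. \<phi> s (ant_sq_inv q (y s))) = 0"
  proof (rule tensor_substitution[where q = q and R = "ant_sq_inv q" and \<phi> = \<phi> and y = y])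
    show "finite S" by (simp add: S_def)
    show "\<phi> s \<in> dualA q" if "s \<in> S" for s
    proof (cases s)
      case (Inl p)
      show ?thesis unfolding Inl \<phi>_def sum.case
        by (rule dualA_scale[OF dualA_translate_left[OF Phi_dualA]])
    next
      case (Inr k)
      show ?thesis unfolding Inr \<phi>_def sum.case
        by (rule dualA_scale[OF dualA_translate_right[OF Phi_dualA]])
    qed
    show "(\<lambda>c. \<omega> (ant_sq_inv q c)) \<in> dualA q" if "\<omega> \<in> dualA q" for \<omega> by (rule ant_sq_inv_dualA[OF that])
    fix b
    have ant_sum: "antA q (\<Sum>p\<in>P. f p) = (\<Sum>p\<in>P. antA q (f p))" for P and f :: "_ \<Rightarrow> genA falg"
    proof (induction P rule: infinite_finite_induct)
      case (insert p P)
      then show ?case by (simp add: antA_hom(1))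
    qed (use antA_hom(3)[of q 0] in simp_all)
    have "antA q (slice_right (\<lambda>c. \<Phi> (c * b)) (copA x)) = (\<Sum>p\<in>Poly_Mapping.keys (copA x). sc (\<phi> (Inl p) b) * y (Inl p))"
      unfolding slice_right_def ant_sum antA_scale by (simp add: \<phi>_def y_def)
    moreover have "(\<Sum>k\<in>UNIV. sc (\<Phi> (b * u k j)) * ant_inv_u i k) = - (\<Sum>k\<in>UNIV. sc (\<phi> (Inr k) b) * y (Inr k))"
      by (simp add: \<phi>_def y_def sum_bool sc_uminus)
    moreover have "eqA q (antA q (slice_right (\<lambda>c. \<Phi> (c * b)) (copA x))) (\<Sum>k\<in>UNIV. sc (\<Phi> (b * u k j)) * ant_inv_u i k)"
      using eqA_trans[OF eqA_sym[OF strong_invariance[of x b, unfolded KMS]] strong_invariance_gen[of i j b]] .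
    ultimately show "(\<Sum>s\<in>S. sc (\<phi> s b) * y s) \<in> ideal_A q"
      unfolding split eqA_def by simp
  qed
  then have "(\<Sum>p\<in>Poly_Mapping.keys (copA x). Poly_Mapping.lookup (copA x) p * \<Phi> (mon (snd p) * ant_sq_inv q (antA q (mon (fst p)))))
      = (\<Sum>k\<in>UNIV. \<Phi> (ant_sq_inv q (ant_inv_u i k) * u k j))"
    unfolding split by (simp add: \<phi>_def y_def sum_negf)
  moreover have "(\<Sum>p\<in>Poly_Mapping.keys (copA x). Poly_Mapping.lookup (copA x) p * \<Phi> (mon (snd p) * ant_sq_inv q (antA q (mon (fst p)))))
      = \<Phi> (tapp (\<lambda>x y. y * ant_sq_inv q (antA q x)) (copA x))"
    unfolding tapp_def linear_functional_sum[OF Phi_linear] L(2) ..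
  moreover have "\<Phi> (tapp (\<lambda>x y. y * ant_sq_inv q (antA q x)) (copA x)) = counA x"
    unfolding dualA_eqA[OF Phi_dualA counit_recovery] L(6) Phi_one by simp
  ultimately show ?thesis unfolding Phi_values by simp
qed

text \<open>Counit and modular automorphism are multiplicative, so the generators suffice.\<close>

lemma deltaA_eq: "deltaA q \<sigma> = chi (complex_of_real (q\<^sup>2))"
proof
  fix x
  have s: "\<And>x y. eqA q (\<sigma> x) (\<sigma> y) \<longleftrightarrow> eqA q x y" "\<And>y. \<exists>x. eqA q (\<sigma> x) y"
    "\<And>x y. eqA q (\<sigma> (x + y)) (\<sigma> x + \<sigma> y)" "\<And>c x. eqA q (\<sigma> (sc c * x)) (sc c * \<sigma> x)"
    "\<And>x y. eqA q (\<sigma> (x * y)) (\<sigma> x * \<sigma> y)" "eqA q (\<sigma> 1) 1"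
    using modular unfolding modular_automorphism_def by (elim conjE allE; simp)+
  have "\<exists>b. eqA q (\<sigma> b) x \<and> counA b = chi (complex_of_real (q\<^sup>2)) x"
  proof (induction x rule: falgA_induct_left)
    case one
    show ?case using s(6) by (intro exI[of _ 1]) (simp add: counA_hom chi_hom)
  next
    case (add x y)
    then obtain b c where b: "eqA q (\<sigma> b) x" "counA b = chi (complex_of_real (q\<^sup>2)) x"
      and c: "eqA q (\<sigma> c) y" "counA c = chi (complex_of_real (q\<^sup>2)) y" by blast
    show ?case
      using eqA_trans[OF s(3) eqA_add[OF b(1) c(1)]] b(2) c(2)
      by (intro exI[of _ "b + c"]) (simp add: counA_hom chi_hom)
  next
    case (scale k x)
    then obtain b where b: "eqA q (\<sigma> b) x" "counA b = chi (complex_of_real (q\<^sup>2)) x" by blast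
    show ?case
      using eqA_trans[OF s(4) eqA_mult_left[OF b(1)]] b(2)
      by (intro exI[of _ "sc k * b"]) (simp add: counA_hom chi_hom)
  next
    case (gen i j x)
    then obtain b where b: "eqA q (\<sigma> b) x" "counA b = chi (complex_of_real (q\<^sup>2)) x" by blast
    obtain c where c: "eqA q (\<sigma> c) (u i j)" using s(2) by blast
    have "eqA q (\<sigma> c * \<sigma> b) (u i j * x)"
      by (rule eqA_trans[OF eqA_mult_left[OF b(1)] eqA_mult_right[OF c]])
    then have "eqA q (\<sigma> (c * b)) (u i j * x)" by (rule eqA_trans[OF s(5)])
    moreover have "counA (c * b) = chi (complex_of_real (q\<^sup>2)) (u i j * x)"
      unfolding counA_hom(2) chi_hom(2) b(2) counit_modular_preimage[OF c] ..
    ultimately show ?case by blast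
  qed
  then obtain b where b: "eqA q (\<sigma> b) x" "counA b = chi (complex_of_real (q\<^sup>2)) x" by blast
  define b' where "b' = (SOME b. eqA q (\<sigma> b) x)"
  have "eqA q (\<sigma> b') x" unfolding b'_def using b(1) by (rule someI)
  then have "eqA q (\<sigma> b') (\<sigma> b)" using b(1) eqA_sym eqA_trans by blast
  then have "eqA q b' b" by (simp only: s(1))
  then have "counA b' = counA b" by (rule dualA_eqA[OF counA_dualA[OF Q_nz(2)]])
  then show "deltaA q \<sigma> x = chi (complex_of_real (q\<^sup>2)) x" by (simp only: deltaA_def b'_def b(2))
qed

lemma deltaA_minus_half_eq: "deltaA_minus_half q \<sigma> = chi (complex_of_real (1 / q))"
  unfolding deltaA_minus_half_def deltaA_eq dual_sqrt_chi[OF q01(1) Q_nz(2)] dual_inv_chi[OF Q_nz]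
  by simp

end

section \<open>The invariant integral\<close>

theorem theorem3p1:
  fixes q t a :: real
    and \<tau> :: "genA falg \<Rightarrow> genU falg \<Rightarrow> complex"
    and \<Phi>\<^sub>A :: "genA falg \<Rightarrow> complex"
    and \<sigma>\<^sub>A :: "genA falg \<Rightarrow> genA falg"
  assumes "0 < q" "q < 1"
    and "t = q powr a - q powr (- a)"
    and "hopf_pairing q \<tau>"
    and "invariant_state q \<Phi>\<^sub>A"
    and "modular_automorphism q \<Phi>\<^sub>A \<sigma>\<^sub>A"
  shows "\<exists>\<psi>. invariant_integral q \<tau> t (deltaA_minus_half q \<sigma>\<^sub>A) \<psi> \<and>
           (\<forall>n::int. \<psi> (dirac q \<tau> t (qnum q (a + n))) =
              (q powr (a + n) + q powr (- a - n)) / (q powr a + q powr (- a))) \<and>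
           (\<forall>\<psi>'. linear_on_Uqkt q \<tau> t \<psi>' \<and>
              (\<forall>n::int. \<psi>' (dirac q \<tau> t (qnum q (a + n))) =
                 (q powr (a + n) + q powr (- a - n)) / (q powr a + q powr (- a)))
              \<longrightarrow> (\<forall>x\<in>Uqkt q \<tau> t. \<psi>' x = \<psi> x))"
proof -
  interpret qsphere q \<tau> a t
    by unfold_locales (fact assms)+
  interpret modular_state q \<tau> \<Phi>\<^sub>A \<sigma>\<^sub>A
    by unfold_locales (fact assms)+
  show ?thesis
  proof (intro exI[of _ psi] conjI allI impI ballI)
    show "invariant_integral q \<tau> t (deltaA_minus_half q \<sigma>\<^sub>A) psi"
      unfolding deltaA_minus_half_eq by (rule psi_invariant_integral)
    show "psi (dirac q \<tau> t (qnum q (a + n))) =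
        (q powr (a + n) + q powr (- a - n)) / (q powr a + q powr (- a))" for n :: int
      by (rule psi_dirac)
    fix \<psi>' x
    assume *: "linear_on_Uqkt q \<tau> t \<psi>' \<and> (\<forall>n::int. \<psi>' (dirac q \<tau> t (qnum q (a + n))) =
        (q powr (a + n) + q powr (- a - n)) / (q powr a + q powr (- a)))" and x: "x \<in> Uqkt q \<tau> t"
    show "\<psi>' x = psi x"
      by (rule psi_unique) (use * x in \<open>simp_all only: psi_dirac\<close>)
  qed
qed

end
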